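(* Let $N \cong \mathbb{Z}^2$ be a lattice of rank $2$, let $\Sigma$ be a complete fan in $N_{\mathbb{R}} = N \otimes_{\mathbb{Z}} \mathbb{R}$, let $\Sigma(1)$ be the set of primitive generators in $N$ of the 1-dimensional cones of $\Sigma$, and let $X = X(\Sigma)$ be the corresponding toric variety, so $\dim(X)=2$. Then exactly one of the following holds: (1) $\Sigma(1)$ is unimodular and $X$ is diagonally split at all integers $q \geq 2$. (2) $\Sigma(1)$ is $2$-regular but not unimodular, and, for integers $q\geq 2$, $X$ is diagonally split at $q$ if and only if $q$ is odd. (3) $\Sigma(1)$ is not $2$-regular, and $X$ is not diagonally split, i.e., there is no integer $q\ge 2$ such that $X$ is diagonally split at $q$.
   Context: Unimodular: $\Sigma(1)$ is unimodular if every maximal linearly independent subset of $\Sigma(1)$ generates the lattice $N$. $k$-regular: for a lattice $N$ of rank $n$ and a positive integer $k$, $\Sigma(1)$ is $k$-regular if, for every maximal linearly independent subset $\{v_1,\dots,v_n\}$ of $\Sigma(1)$, the quotient $N/\langle v_1,\dots,v_n\rangle$ is $k$-torsion, i.e., annihilated by $k$ (here $\langle v_1,\dots,v_n\rangle$ is the subgroup generated by the $v_i$). Diagonal splittings: let $X$ be a toric variety (over a field) given by a complete fan $\Sigma$. For an integer $q\ge 2$, multiplication by $q$ on $N_{\mathbb{R}}$ preserves $\Sigma$ and induces a morphism $F\colon X\to X$. A splitting of $X$ at $q$ is an $\mathcal{O}_X$-module map $\pi\colon F_*\mathcal{O}_X\to\mathcal{O}_X$ whose composition with the natural map $\mathcal{O}_X\to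 F_*\mathcal{O}_X$ is the identity. It is compatible with a subvariety $Z\subset X$ with ideal sheaf $I_Z$ if $\pi(F_*I_Z)\subset I_Z$. The toric variety $X$ is diagonally split at $q$ if there is a splitting at $q$ of the toric variety $X\times X$ compatible with the diagonal $\Delta\subset X\times X$. Recalled known characterization (from earlier work of Payne): with $M=\operatorname{Hom}(N,\mathbb{Z})$ and $M_{\mathbb{R}}=M\otimes_{\mathbb{Z}}\mathbb{R}$, $X$ is diagonally split at $q\ge 2$ if and only if the open polytope $\mathbb{F}_\Sigma=\{u\in M_{\mathbb{R}} : |\langle u,v\rangle|<1 \text{ for all } v\in\Sigma(1)\}$ contains a representative of every class in $\frac{1}{q}M/M$. *)

theory Defs
  imports
    "HOL-Analysis.Polytope"
    "HOL-Algebra.Ideal"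
    "HOL-Library.Poly_Mapping"
    "HOL-Library.Product_Lexorder"
    "HOL-Computational_Algebra.Fraction_Field"
begin

section \<open>Lattices and fans\<close>

text \<open>
  The lattice is \<open>N = \<int> \<times> \<int>\<close> inside \<open>N\<^sub>\<real> = \<real> \<times> \<real>\<close>, and
  \<open>M = Hom(N, \<int>)\<close> is the type \<^typ>\<open>int \<times> int\<close>, paired with \<open>N\<^sub>\<real>\<close> by \<open>pairing\<close>.
\<close>

definition lattice_N :: "(real \<times> real) set" where
  "lattice_N = \<int> \<times> \<int>"

definition pairing :: "int \<times> int \<Rightarrow> real \<times> real \<Rightarrow> real" where
  "pairing m v = of_int (fst m) * fst v + of_int (snd m) * snd v"

definition rational_polyhedral_cone :: "(real \<times> real) set \<Rightarrow> bool" where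
  "rational_polyhedral_cone \<sigma> \<longleftrightarrow>
     (\<exists>G. finite G \<and> G \<subseteq> lattice_N \<and> \<sigma> = convex_cone hull G)"

definition strongly_convex :: "(real \<times> real) set \<Rightarrow> bool" where
  "strongly_convex \<sigma> \<longleftrightarrow> \<sigma> \<inter> uminus ` \<sigma> = {0}"

text \<open>
  The library relation \<open>face_of\<close> also counts the empty set as a face; faces of cones are
  nonempty.
\<close>

definition fan :: "(real \<times> real) set set \<Rightarrow> bool" where
  "fan \<Sigma> \<longleftrightarrow> finite \<Sigma>
     \<and> (\<forall>\<sigma>\<in>\<Sigma>. rational_polyhedral_cone \<sigma> \<and> strongly_convex \<sigma>)
     \<and> (\<forall>\<sigma>\<in>\<Sigma>. \<forall>\<tau>. \<tau> face_of \<sigma> \<and> \<tau> \<noteq> {} \<longrightarrow> \<tau> \<in> \<Sigma>)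
     \<and> (\<forall>\<sigma>\<in>\<Sigma>. \<forall>\<tau>\<in>\<Sigma>. (\<sigma> \<inter> \<tau>) face_of \<sigma> \<and> (\<sigma> \<inter> \<tau>) face_of \<tau>)"

definition complete_fan :: "(real \<times> real) set set \<Rightarrow> bool" where
  "complete_fan \<Sigma> \<longleftrightarrow> fan \<Sigma> \<and> \<Union>\<Sigma> = UNIV"

definition primitive :: "real \<times> real \<Rightarrow> bool" where
  "primitive v \<longleftrightarrow> v \<in> lattice_N \<and> v \<noteq> 0
     \<and> (\<forall>w\<in>lattice_N. \<forall>k::nat. v = real k *\<^sub>R w \<longrightarrow> k = 1)"

definition rays :: "(real \<times> real) set set \<Rightarrow> (real \<times> real) set" where
  "rays \<Sigma> = {v. primitive v \<and> convex_cone hull {v} \<in> \<Sigma>}"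

definition maximal_independent_subset :: "'a::real_vector set \<Rightarrow> 'a set \<Rightarrow> bool" where
  "maximal_independent_subset B A \<longleftrightarrow> B \<subseteq> A \<and> independent B
     \<and> (\<forall>C. B \<subset> C \<and> C \<subseteq> A \<longrightarrow> \<not> independent C)"

definition generated_subgroup :: "'a::ab_group_add set \<Rightarrow> 'a set" where
  "generated_subgroup B = (\<lambda>H. 0 \<in> H \<and> (\<forall>x\<in>H. \<forall>y\<in>H. x - y \<in> H)) hull B"

definition unimodular :: "(real \<times> real) set \<Rightarrow> bool" where
  "unimodular A \<longleftrightarrow>
     (\<forall>B. maximal_independent_subset B A \<longrightarrow> generated_subgroup B = lattice_N)"

definition k_regular :: "nat \<Rightarrow> (real \<times> real) set \<Rightarrow> bool" where
  "k_regular k A \<longleftrightarrow>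
     (\<forall>B. maximal_independent_subset B A \<longrightarrow>
        (\<forall>v\<in>lattice_N. real k *\<^sub>R v \<in> generated_subgroup B))"


section \<open>Group algebras and their fraction fields\<close>

text \<open>
  For an abelian group \<open>'m\<close>, the type \<open>'m \<Rightarrow>\<^sub>0 'k\<close> with its convolution product is the group
  algebra \<open>k[M]\<close>, and \<open>single m 1\<close> is the character \<open>\<chi>\<^sup>m\<close>. The library knows it to be an integral
  domain when \<open>'m\<close> carries a compatible linear order; the lexicographic order on pairs
  is used for this purpose only and enters none of the definitions below.
\<close>

instance prod :: (ordered_cancel_comm_monoid_add, ordered_cancel_comm_monoid_add)
  ordered_cancel_comm_monoid_add
  by standard (auto simp: less_eq_prod_def intro: add_left_mono add_strict_left_mono)

type_synonym ('m, 'k) function_field = "('m \<Rightarrow>\<^sub>0 'k) fract"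

definition monoid_algebra :: "'m::comm_monoid_add set \<Rightarrow> ('m \<Rightarrow>\<^sub>0 'k::field) ring" where
  "monoid_algebra S =
     \<lparr>carrier = {f. Poly_Mapping.keys f \<subseteq> S}, monoid.mult = (*), one = 1, zero = 0, add = (+)\<rparr>"

definition algebra_map :: "('m \<Rightarrow> 'n) \<Rightarrow> ('m \<Rightarrow>\<^sub>0 'k::field) \<Rightarrow> ('n \<Rightarrow>\<^sub>0 'k)" where
  "algebra_map h f =
     (\<Sum>m\<in>Poly_Mapping.keys f. Poly_Mapping.single (h m) (Poly_Mapping.lookup f m))"

text \<open>The extension of \<open>algebra_map h\<close> to fraction fields, meaningful for injective \<open>h\<close>.\<close>

definition function_field_map ::
  "('m \<Rightarrow> 'n) \<Rightarrow> ('m::{ordered_cancel_comm_monoid_add, linorder}, 'k::field) function_field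
     \<Rightarrow> ('n::{ordered_cancel_comm_monoid_add, linorder}, 'k) function_field" where
  "function_field_map h x =
     (THE y. \<exists>a b. b \<noteq> 0 \<and> x = Fract a b \<and> y = Fract (algebra_map h a) (algebra_map h b))"

definition scale :: "nat \<Rightarrow> 'm::comm_monoid_add \<Rightarrow> 'm" where
  "scale q m = (\<Sum>i<q. m)"


section \<open>Schemes glued from spectra of monoid algebras\<close>

text \<open>
  Toric varieties and their products are separated integral schemes covered by open affines
  \<open>Spec k[S]\<close>, where \<open>S\<close> ranges over a set \<open>C\<close> of submonoids of \<open>M\<close> and all the \<open>k[S]\<close> have
  fraction field \<open>K = Frac k[M]\<close>. A point of a separated integral scheme is determined by its
  local ring as a subring of \<open>K\<close>. The scheme with charts \<open>C\<close> is therefore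
  represented by the set of local rings \<open>k[S]\<^sub>P \<subseteq> K\<close>, and the gluing of two charts is the
  coincidence of their local rings.
\<close>

type_synonym ('m, 'k) point = "('m, 'k) function_field set"

definition Spec :: "'m::{ordered_cancel_comm_monoid_add, linorder} set
    \<Rightarrow> ('m \<Rightarrow>\<^sub>0 'k::field) set set" where
  "Spec S = {P. primeideal P (monoid_algebra S)}"

definition local_ring :: "'m::{ordered_cancel_comm_monoid_add, linorder} set
    \<Rightarrow> ('m \<Rightarrow>\<^sub>0 'k::field) set \<Rightarrow> ('m, 'k) point" where
  "local_ring S P =
     {Fract a s | a s. a \<in> carrier (monoid_algebra S) \<and> s \<in> carrier (monoid_algebra S) - P}"

definition maximal_ideal_of :: "('m::{ordered_cancel_comm_monoid_add, linorder}, 'k::field) point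
    \<Rightarrow> ('m, 'k) function_field set" where
  "maximal_ideal_of x = {f \<in> x. \<forall>g\<in>x. f * g \<noteq> 1}"

definition basic_open :: "'m::{ordered_cancel_comm_monoid_add, linorder} set
    \<Rightarrow> ('m \<Rightarrow>\<^sub>0 'k::field) \<Rightarrow> ('m, 'k) point set" where
  "basic_open S f = {local_ring S P | P. P \<in> Spec S \<and> f \<notin> P}"

definition zariski :: "'m::{ordered_cancel_comm_monoid_add, linorder} set set
    \<Rightarrow> ('m, 'k::field) point topology" where
  "zariski C =
     topology_generated_by {basic_open S f | S f. S \<in> C \<and> f \<in> carrier (monoid_algebra S)}"

text \<open>
  On a nonempty open set the sections of the structure sheaf are the rational functions lying
  in all its local rings, and restriction maps are inclusions. The empty open set, where the
  sections form the zero ring, is left out throughout; it imposes no condition on maps of sheaves.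
\<close>

definition sections :: "('m::{ordered_cancel_comm_monoid_add, linorder}, 'k::field) point set
    \<Rightarrow> ('m, 'k) function_field set" where
  "sections U = \<Inter>U"

definition nonempty_open :: "'m::{ordered_cancel_comm_monoid_add, linorder} set set
    \<Rightarrow> ('m, 'k::field) point set \<Rightarrow> bool" where
  "nonempty_open C U \<longleftrightarrow> openin (zariski C) U \<and> U \<noteq> {}"

definition ideal_sheaf :: "('m::{ordered_cancel_comm_monoid_add, linorder}, 'k::field) point set
    \<Rightarrow> ('m, 'k) point set \<Rightarrow> ('m, 'k) function_field set" where
  "ideal_sheaf Z U = {f \<in> sections U. \<forall>x\<in>U \<inter> Z. f \<in> maximal_ideal_of x}"


section \<open>Splittings\<close>

text \<open>
  Multiplication by \<open>q\<close> induces the morphism \<open>F\<close> which on each chart is \<open>Spec\<close> of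
  \<open>\<chi>\<^sup>m \<mapsto> \<chi>\<^bsup>qm\<^esup>\<close>. Its pullback on sections is \<open>F_pullback q\<close>; \<open>F_preimage q C U\<close> is the
  preimage of \<open>U\<close> under the map of points.
\<close>

definition F_pullback ::
  "nat \<Rightarrow> ('m::{ordered_cancel_comm_monoid_add, linorder}, 'k::field) function_field
     \<Rightarrow> ('m, 'k) function_field" where
  "F_pullback q = function_field_map (scale q)"

definition F_preimage :: "nat \<Rightarrow> 'm::{ordered_cancel_comm_monoid_add, linorder} set set
    \<Rightarrow> ('m, 'k::field) point set \<Rightarrow> ('m, 'k) point set" where
  "F_preimage q C U =
     {local_ring S P | S P. S \<in> C \<and> P \<in> Spec S
        \<and> local_ring S {f \<in> carrier (monoid_algebra S). algebra_map (scale q) f \<in> P} \<in> U}"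

text \<open>
  \<open>\<pi> U\<close> is the component \<open>(F\<^sub>*\<O>)(U) = \<O>(F\<^sup>-\<^sup>1 U) \<rightarrow> \<O>(U)\<close> of a map of sheaves; a section \<open>a\<close> of \<open>\<O>\<close>
  acts on \<open>F\<^sub>*\<O>\<close> as multiplication by \<open>F_pullback q a\<close>.
\<close>

definition is_module_map :: "nat \<Rightarrow> 'm::{ordered_cancel_comm_monoid_add, linorder} set set
    \<Rightarrow> (('m, 'k::field) point set \<Rightarrow> ('m, 'k) function_field \<Rightarrow> ('m, 'k) function_field) \<Rightarrow> bool"
  where
  "is_module_map q C \<pi> \<longleftrightarrow>
     (\<forall>U. nonempty_open C U \<longrightarrow>
        (\<forall>b\<in>sections (F_preimage q C U). \<pi> U b \<in> sections U)
      \<and> (\<forall>b\<in>sections (F_preimage q C U). \<forall>c\<in>sections (F_preimage q C U).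
           \<pi> U (b + c) = \<pi> U b + \<pi> U c)
      \<and> (\<forall>a\<in>sections U. \<forall>b\<in>sections (F_preimage q C U).
           \<pi> U (F_pullback q a * b) = a * \<pi> U b)
      \<and> (\<forall>V. nonempty_open C V \<and> V \<subseteq> U \<longrightarrow>
           (\<forall>b\<in>sections (F_preimage q C U). \<pi> V b = \<pi> U b)))"

definition is_splitting :: "nat \<Rightarrow> 'm::{ordered_cancel_comm_monoid_add, linorder} set set
    \<Rightarrow> (('m, 'k::field) point set \<Rightarrow> ('m, 'k) function_field \<Rightarrow> ('m, 'k) function_field) \<Rightarrow> bool"
  where
  "is_splitting q C \<pi> \<longleftrightarrow> is_module_map q C \<pi>
     \<and> (\<forall>U. nonempty_open C U \<longrightarrow> (\<forall>a\<in>sections U. \<pi> U (F_pullback q a) = a))"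

definition compatible_with :: "nat \<Rightarrow> 'm::{ordered_cancel_comm_monoid_add, linorder} set set
    \<Rightarrow> (('m, 'k::field) point set \<Rightarrow> ('m, 'k) function_field \<Rightarrow> ('m, 'k) function_field)
    \<Rightarrow> ('m, 'k) point set \<Rightarrow> bool" where
  "compatible_with q C \<pi> Z \<longleftrightarrow>
     (\<forall>U. nonempty_open C U \<longrightarrow> \<pi> U ` ideal_sheaf Z (F_preimage q C U) \<subseteq> ideal_sheaf Z U)"


section \<open>Diagonally split toric varieties\<close>

text \<open>The charts of the toric variety \<open>X(\<Sigma>)\<close> are the \<open>Spec k[\<sigma>\<^sup>\<or> \<inter> M]\<close> for \<open>\<sigma> \<in> \<Sigma>\<close>.\<close>

definition dual_monoid :: "(real \<times> real) set \<Rightarrow> (int \<times> int) set" where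
  "dual_monoid \<sigma> = {m. \<forall>v\<in>\<sigma>. 0 \<le> pairing m v}"

definition toric_charts :: "(real \<times> real) set set \<Rightarrow> (int \<times> int) set set" where
  "toric_charts \<Sigma> = dual_monoid ` \<Sigma>"

text \<open>
  As \<open>k[S] \<otimes>\<^sub>k k[T] = k[S \<times> T]\<close>, the products \<open>S \<times> T\<close> are charts of the product over \<open>k\<close>.
  The diagonal morphism is given on \<open>Spec k[S]\<close> by the multiplication map
  \<open>k[S \<times> S] \<rightarrow> k[S]\<close>, \<open>\<chi>\<^bsup>(m, m')\<^esup> \<mapsto> \<chi>\<^bsup>m + m'\<^esup>\<close>, and \<open>diagonal C\<close> is its image.
\<close>

definition product_charts :: "'m set set \<Rightarrow> ('m \<times> 'm) set set" where
  "product_charts C = {S \<times> T | S T. S \<in> C \<and> T \<in> C}"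

definition diagonal :: "'m::{ordered_cancel_comm_monoid_add, linorder} set set
    \<Rightarrow> ('m \<times> 'm, 'k::field) point set" where
  "diagonal C =
     {local_ring (S \<times> S)
        {f \<in> carrier (monoid_algebra (S \<times> S)). algebra_map (\<lambda>(m, m'). m + m') f \<in> P} | S P.
      S \<in> C \<and> P \<in> Spec S}"

definition diagonally_split :: "'k::field itself \<Rightarrow> (real \<times> real) set set \<Rightarrow> nat \<Rightarrow> bool" where
  "diagonally_split _ \<Sigma> q \<longleftrightarrow>
     (\<exists>\<pi> :: ((int \<times> int) \<times> (int \<times> int), 'k) point set
           \<Rightarrow> ((int \<times> int) \<times> (int \<times> int), 'k) function_field
           \<Rightarrow> ((int \<times> int) \<times> (int \<times> int), 'k) function_field.
        is_splitting q (product_charts (toric_charts \<Sigma>)) \<pi>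
      \<and> compatible_with q (product_charts (toric_charts \<Sigma>)) \<pi> (diagonal (toric_charts \<Sigma>)))"

definition exactly_one_of_three :: "bool \<Rightarrow> bool \<Rightarrow> bool \<Rightarrow> bool" where
  "exactly_one_of_three P Q R \<longleftrightarrow>
     (P \<and> \<not> Q \<and> \<not> R) \<or> (\<not> P \<and> Q \<and> \<not> R) \<or> (\<not> P \<and> \<not> Q \<and> R)"

end

theory Submission
  imports Defs
begin

text \<open>
  Write \<open>M = \<int>\<^sup>2\<close> and \<open>k[M \<times> M]\<close> for the coordinate ring of the torus of \<open>X \<times> X\<close>, and let \<open>\<delta>\<close> be
  restriction to the diagonal, \<open>\<chi>\<^bsup>(m, m')\<^esup> \<mapsto> \<chi>\<^bsup>m + m'\<^esup>\<close>.

  If \<open>\<pi>\<close> is a splitting at \<open>q\<close> compatible with the diagonal, then \<open>\<delta> (\<pi> \<chi>\<^bsup>(a, -a)\<^esup>) = \<delta> (\<pi> 1) = 1\<close>, so some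
  \<open>\<chi>\<^bsup>(b, -b)\<^esup>\<close> occurs in \<open>\<pi> \<chi>\<^bsup>(a, -a)\<^esup>\<close>. Regularity along the two divisors of \<open>X \<times> X\<close> belonging to a ray \<open>v\<close>
  gives \<open>\<langle>b - a/q, v\<rangle> > -1\<close> and \<open>\<langle>a/q - b, v\<rangle> > -1\<close>, so \<open>b - a/q\<close> represents the class of \<open>-a/q\<close> in the
  open polygon. Conversely, a system of representatives in the polygon defines a \<open>\<pi>\<close> on monomials. It
  extends to all open sets because open sets are stable under generization: at a point \<open>P\<close> of \<open>U\<close> in the
  chart \<open>S\<close>, a section over \<open>F\<^sup>-\<^sup>1 U\<close> is a fraction with denominator in \<open>F(k[S] - P)\<close>, since otherwise its
  ideal of denominators would lie in a prime that avoids this set and hence belongs to \<open>F\<^sup>-\<^sup>1 U\<close>. For the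
  same reason the diagonal need only be tested at its generic point.

  In dimension two, two rays of determinant \<open>d\<close> with \<open>d * (q div 2) \<ge> q\<close> exclude the class of
  \<open>(q div 2)/q\<close> times the primitive functional vanishing on one of them. If all determinants are at most \<open>2\<close>
  in absolute value, the coordinates of each ray in a basis of rays of maximal determinant have absolute
  values that sum to at most \<open>1\<close> (index two), or are \<open>0, \<plusminus>1\<close> with a common sign pattern (unimodular).
\<close>

section \<open>Lattice geometry of the rays\<close>

definition lat :: "int \<times> int \<Rightarrow> real \<times> real" where
  "lat p = (of_int (fst p), of_int (snd p))"

text \<open>For independent \<open>p\<close> and \<open>r\<close> its absolute value is the index of
  the sublattice they generate, so unimodularity and 2-regularity become bounds on it.\<close>

definition pair_det :: "int \<times> int \<Rightarrow> int \<times> int \<Rightarrow> int" where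
  "pair_det p r = fst p * snd r - snd p * fst r"

definition dot :: "int \<times> int \<Rightarrow> int \<times> int \<Rightarrow> int" where
  "dot m p = fst m * fst p + snd m * snd p"

text \<open>With \<open>u = b - a/q\<close> this says that the class of \<open>-a/q\<close> in \<open>(1/q)M/M\<close> has a representative in the open
  polygon \<open>{u. \<bar>\<langle>u, v\<rangle>\<bar> < 1}\<close>.\<close>

definition fractionally_covered :: "(real \<times> real) set \<Rightarrow> nat \<Rightarrow> bool" where
  "fractionally_covered A q \<longleftrightarrow>
     (\<forall>a. \<exists>b. \<forall>v\<in>A. \<bar>real q * pairing b v - pairing a v\<bar> < real q)"

lemma pairing_lat: "pairing m (lat p) = of_int (dot m p)"
  by (simp add: pairing_def lat_def dot_def)

lemma lat_inject [simp]: "lat p = lat r \<longleftrightarrow> p = r"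
  by (auto simp: lat_def prod_eq_iff)

lemma lattice_N_eq: "lattice_N = range lat"
  by (auto simp: lattice_N_def lat_def Ints_def image_iff)

lemma lattice_factor_primitive:
  assumes "v \<in> lattice_N" "v \<noteq> 0"
  obtains k w where "k > 0" "primitive w" "v = real k *\<^sub>R w"
proof -
  obtain p where p: "v = lat p" using assms by (auto simp: lattice_N_eq)
  obtain x y where xy: "p = (x, y)" by force
  let ?g = "gcd x y"
  have nz: "x \<noteq> 0 \<or> y \<noteq> 0" using assms p xy by (auto simp: lat_def zero_prod_def)
  then have g: "?g > 0" by (simp add: gcd_pos_int)
  obtain x' y' where x'y': "x = ?g * x'" "y = ?g * y'" by (meson dvdE gcd_dvd1 gcd_dvd2)
  have co: "coprime x' y'"
    using nz x'y' by (metis div_gcd_coprime gcd_eq_0_iff nonzero_mult_div_cancel_left)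
  have "primitive (lat (x', y'))"
    unfolding primitive_def
  proof (intro conjI ballI allI impI)
    show "lat (x', y') \<in> lattice_N" by (simp add: lattice_N_eq)
    show "lat (x', y') \<noteq> 0" using co by (auto simp: lat_def zero_prod_def)
    fix w and k :: nat assume "w \<in> lattice_N" and w: "lat (x', y') = real k *\<^sub>R w"
    then obtain a b where "w = lat (a, b)" by (auto simp: lattice_N_eq)
    with w have "real_of_int x' = real_of_int (int k * a)" "real_of_int y' = real_of_int (int k * b)"
      by (auto simp: lat_def)
    then have "x' = int k * a" "y' = int k * b" by (simp_all only: of_int_eq_iff)
    then have "is_unit (int k)" using co by (metis coprime_common_divisor dvd_triv_left)
    then show "k = 1" by simp
  qed
  moreover have "v = real (nat ?g) *\<^sub>R lat (x', y')"
  proof -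
    have "real (nat ?g) = real_of_int ?g" using g by simp
    moreover have "real_of_int x = real_of_int ?g * real_of_int x'" "real_of_int y = real_of_int ?g * real_of_int y'"
      using x'y' by (metis of_int_mult)+
    ultimately show ?thesis by (simp add: p xy lat_def)
  qed
  ultimately show thesis using that[of "nat ?g"] g by simp
qed

lemma primitiveE:
  assumes "primitive v"
  obtains p where "v = lat p" "coprime (fst p) (snd p)"
proof -
  have v: "v \<in> lattice_N" "v \<noteq> 0" and uniq: "\<And>w k. w \<in> lattice_N \<Longrightarrow> v = real k *\<^sub>R w \<Longrightarrow> k = 1"
    using assms unfolding primitive_def by auto
  obtain p where p: "v = lat p" using v by (auto simp: lattice_N_eq)
  obtain x y where xy: "p = (x, y)" by force
  let ?g = "gcd x y"
  obtain x' y' where x'y': "x = ?g * x'" "y = ?g * y'" by (meson dvdE gcd_dvd1 gcd_dvd2)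
  have "real_of_int x = real_of_int ?g * real_of_int x'" "real_of_int y = real_of_int ?g * real_of_int y'"
    using x'y' by (metis of_int_mult)+
  then have "v = real (nat ?g) *\<^sub>R lat (x', y')"
    by (simp add: p xy lat_def)
  then have "nat ?g = 1" using uniq[of "lat (x', y')"] by (simp add: lattice_N_eq)
  then show thesis using that[of p] p xy by (simp add: coprime_iff_gcd_eq_1)
qed

text \<open>By Bezout. It makes the order along the divisor of a ray a surjective function of the
  exponent.\<close>

lemma primitive_dot_surj:
  assumes "coprime (fst p) (snd p)"
  obtains c where "dot c p = n"
proof -
  obtain a b where "a * fst p + b * snd p = 1"
    using assms by (metis bezout_int coprime_iff_gcd_eq_1)
  then have "dot (n * a, n * b) p = n"
    by (simp add: dot_def) (metis (no_types, lifting) distrib_left mult.assoc mult.right_neutral)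
  then show thesis by (rule that)
qed

subsection \<open>Determinants and lattice indices\<close>

lemma generated_subgroup_pair:
  "generated_subgroup {v, w} = {of_int a *\<^sub>R v + of_int b *\<^sub>R w | a b. True}"
    (is "_ = ?G") for v w :: "'a::real_vector"
proof
  let ?P = "\<lambda>H::'a set. 0 \<in> H \<and> (\<forall>x\<in>H. \<forall>y\<in>H. x - y \<in> H)"
  show "generated_subgroup {v, w} \<subseteq> ?G"
    unfolding generated_subgroup_def
  proof (rule hull_minimal)
    have "v = of_int 1 *\<^sub>R v + of_int 0 *\<^sub>R w" "w = of_int 0 *\<^sub>R v + of_int 1 *\<^sub>R w" by auto
    then show "{v, w} \<subseteq> ?G" by blast
    have "0 = of_int 0 *\<^sub>R v + of_int 0 *\<^sub>R w" by simp
    then have "0 \<in> ?G" by blast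
    moreover have "x - y \<in> ?G" if "x \<in> ?G" "y \<in> ?G" for x y
    proof -
      obtain a b c d where "x = of_int a *\<^sub>R v + of_int b *\<^sub>R w" "y = of_int c *\<^sub>R v + of_int d *\<^sub>R w"
        using \<open>x \<in> ?G\<close> \<open>y \<in> ?G\<close> by blast
      then have "x - y = of_int (a - c) *\<^sub>R v + of_int (b - d) *\<^sub>R w"
        by (simp add: algebra_simps)
      then show ?thesis by blast
    qed
    ultimately show "?P ?G" by blast
  qed
  show "?G \<subseteq> generated_subgroup {v, w}"
    unfolding generated_subgroup_def
  proof
    fix x assume "x \<in> ?G"
    then obtain a b where x: "x = of_int a *\<^sub>R v + of_int b *\<^sub>R w" by blast
    have "x \<in> H" if H: "?P H" and "{v, w} \<subseteq> H" for H
    proof -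
      have um: "- y \<in> H" if "y \<in> H" for y using H that by (metis diff_0)
      have ad: "y + z \<in> H" if "y \<in> H" "z \<in> H" for y z using H that um[of z] by (metis diff_minus_eq_add)
      have nat: "of_int (int n) *\<^sub>R y \<in> H" if "y \<in> H" for n y
        by (induction n) (use H that ad in \<open>auto simp: algebra_simps\<close>)
      have "of_int k *\<^sub>R y \<in> H" if "y \<in> H" for k y
      proof (cases "k \<ge> 0")
        case True then show ?thesis using nat[OF that, of "nat k"] by simp
      next
        case False then show ?thesis using um[OF nat[OF that, of "nat (-k)"]] by simp
      qed
      then show ?thesis using ad that x by auto
    qed
    then show "x \<in> ?P hull {v, w}" by (auto simp: hull_def)
  qed
qed

text \<open>The case \<open>p = r\<close> is excluded because the set would collapse to a singleton,
  which can be independent although the determinant is zero.\<close>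

lemma independent_pair_iff_det:
  assumes "p \<noteq> r"
  shows "independent {lat p, lat r} \<longleftrightarrow> pair_det p r \<noteq> 0"
proof -
  obtain x y x' y' where xy: "p = (x, y)" "r = (x', y')" by force
  have *: "dependent {lat p, lat r} \<longleftrightarrow>
      (\<exists>u. (u (lat p) \<noteq> 0 \<or> u (lat r) \<noteq> 0) \<and> u (lat p) *\<^sub>R lat p + u (lat r) *\<^sub>R lat r = 0)"
    using assms by (subst dependent_finite) auto
  have "\<dots> \<longleftrightarrow> (\<exists>s t. (s \<noteq> 0 \<or> t \<noteq> 0) \<and> s *\<^sub>R lat p + t *\<^sub>R lat r = 0)" (is "_ \<longleftrightarrow> ?Q")
  proof
    assume ?Q
    then obtain s t where "(s \<noteq> 0 \<or> t \<noteq> 0) \<and> s *\<^sub>R lat p + t *\<^sub>R lat r = 0" by blast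
    then show "\<exists>u. (u (lat p) \<noteq> 0 \<or> u (lat r) \<noteq> 0) \<and> u (lat p) *\<^sub>R lat p + u (lat r) *\<^sub>R lat r = 0"
      using assms by (intro exI[of _ "\<lambda>x. if x = lat p then s else t"]) simp
  qed blast
  also have "\<dots> \<longleftrightarrow> pair_det p r = 0"
  proof
    assume ?Q
    then obtain s t where st: "s \<noteq> 0 \<or> t \<noteq> 0" and "s *\<^sub>R lat p + t *\<^sub>R lat r = 0" by blast
    then have e: "s * x + t * x' = 0" "s * y + t * y' = 0"
      by (auto simp: lat_def xy zero_prod_def)
    have "s * (x * y' - y * x') = y' * (s * x + t * x') - x' * (s * y + t * y')"
      by (simp add: algebra_simps)
    then have "s * (x * y' - y * x') = 0" using e by simp
    moreover have "t * (x * y' - y * x') = x * (s * y + t * y') - y * (s * x + t * x')"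
      by (simp add: algebra_simps)
    then have "t * (x * y' - y * x') = 0" using e by simp
    ultimately have "real_of_int (x * y' - y * x') = 0" using st by auto
    then have "x * y' - y * x' = 0" by (simp only: of_int_eq_0_iff)
    then show "pair_det p r = 0" by (simp add: pair_det_def xy)
  next
    assume "pair_det p r = 0"
    then have "x * y' - y * x' = 0" by (simp add: pair_det_def xy)
    then have d: "real_of_int x * y' = real_of_int y * x'" by (metis eq_iff_diff_eq_0 of_int_mult)
    \<comment> \<open>With determinant zero, a coordinate of \<open>r\<close> and a nonzero
      coordinate of \<open>p\<close> serve as coefficients; \<open>p = 0\<close> is a relation by
      itself.\<close>
    show ?Q
    proof (cases "p = (0, 0)")
      case True
      then have "(1::real) *\<^sub>R lat p + 0 *\<^sub>R lat r = 0" by (simp add: lat_def zero_prod_def)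
      then show ?thesis by (metis zero_neq_one)
    next
      case False
      show ?thesis
      proof (cases "x = 0")
        case True
        then have "y \<noteq> 0" using False xy by auto
        then show ?thesis using d True
          by (intro exI[of _ "- of_int y'"] exI[of _ "of_int y"]) (auto simp: lat_def xy zero_prod_def)
      next
        case False
        then show ?thesis using d
          by (intro exI[of _ "- of_int x'"] exI[of _ "of_int x"]) (auto simp: lat_def xy zero_prod_def)
      qed
    qed
  qed
  finally show ?thesis using * by simp
qed

lemma maximal_independent_subset_pair:
  assumes "lat p \<in> A" "lat r \<in> A" "pair_det p r \<noteq> 0"
  shows "maximal_independent_subset {lat p, lat r} A"
proof -
  have ne: "p \<noteq> r" using assms(3) by (auto simp: pair_det_def)
  then have ind: "independent {lat p, lat r}" using assms independent_pair_iff_det by blast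
  have "\<not> independent C" if "{lat p, lat r} \<subset> C" for C
  proof
    assume C: "independent C"
    then have "finite C" by (rule independent_imp_finite)
    then have "card {lat p, lat r} < card C" using that psubset_card_mono by blast
    moreover have "card C \<le> 2" using independent_bound[OF C] by simp
    ultimately show False using ne by simp
  qed
  then show ?thesis using assms ind by (auto simp: maximal_independent_subset_def)
qed

text \<open>Maximality forces \<open>B\<close> to span all that \<open>A\<close> spans, here the
  plane, so \<open>B\<close> is a basis.\<close>

lemma maximal_independent_subset_is_pair:
  assumes "maximal_independent_subset B A" "A \<subseteq> lattice_N" "span A = UNIV"
  obtains p r where "B = {lat p, lat r}" "lat p \<in> A" "lat r \<in> A" "pair_det p r \<noteq> 0"
proof -
  have B: "B \<subseteq> A" "independent B" and mx: "\<And>C. B \<subset> C \<Longrightarrow> C \<subseteq> A \<Longrightarrow> \<not> independent C"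
    using assms(1) unfolding maximal_independent_subset_def by auto
  have "A \<subseteq> span B"
  proof
    fix x assume x: "x \<in> A"
    show "x \<in> span B"
    proof (rule ccontr)
      assume n: "x \<notin> span B"
      then have "independent (insert x B)" using B by (simp add: independent_insert)
      moreover have "B \<subset> insert x B" using n span_base by auto
      ultimately show False using mx[of "insert x B"] x B by auto
    qed
  qed
  then have "span B = UNIV" using assms(3) by (metis span_mono span_span top.extremum_uniqueI)
  then have "card B = 2"
    using B(2) basis_card_eq_dim[of B UNIV] by auto
  then obtain v w where vw: "B = {v, w}" "v \<noteq> w" by (meson card_2_iff)
  have "v \<in> lattice_N" "w \<in> lattice_N" using vw(1) B(1) assms(2) by blast+
  then obtain p r where pr': "v = lat p" "w = lat r" unfolding lattice_N_eq by (elim rangeE)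
  then show thesis using that[of p r] vw B pr' independent_pair_iff_det[of p r] by auto
qed

text \<open>Cramer's rule: the coefficients of \<open>pair_det p r\<close> times a lattice vector
  are themselves determinants, hence integers.\<close>

lemma det_multiple_in_generated_subgroup:
  assumes "pair_det p r dvd k"
  shows "of_int k *\<^sub>R lat m \<in> generated_subgroup {lat p, lat r}"
proof -
  obtain c where c: "k = pair_det p r * c" using assms by blast
  have "of_int k *\<^sub>R lat m = of_int (c * pair_det m r) *\<^sub>R lat p + of_int (c * pair_det p m) *\<^sub>R lat r"
    by (simp add: c lat_def pair_det_def algebra_simps)
  then show ?thesis unfolding generated_subgroup_pair by blast
qed

text \<open>Comparing determinants of the inclusion \<open>k N \<subseteq> \<langle>p, r\<rangle>\<close>.\<close>

lemma torsion_quotient_det: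
  assumes "\<forall>v\<in>lattice_N. of_int k *\<^sub>R v \<in> generated_subgroup {lat p, lat r}"
  obtains e where "k * k = e * pair_det p r" "\<And>d. e dvd d \<Longrightarrow> k dvd d * fst p \<and> k dvd d * snd p"
proof -
  have ex: "\<exists>s t. k * fst m = s * fst p + t * fst r \<and> k * snd m = s * snd p + t * snd r" for m
  proof -
    have "of_int k *\<^sub>R lat m \<in> generated_subgroup {lat p, lat r}"
      using assms lattice_N_eq by blast
    then obtain s t where "of_int k *\<^sub>R lat m = of_int s *\<^sub>R lat p + of_int t *\<^sub>R lat r"
      unfolding generated_subgroup_pair by blast
    then have "real_of_int (k * fst m) = of_int (s * fst p + t * fst r)"
      "real_of_int (k * snd m) = of_int (s * snd p + t * snd r)"
      by (auto simp: lat_def)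
    then show ?thesis by (metis of_int_eq_iff)
  qed
  obtain a b where ab: "k = a * fst p + b * fst r" "0 = a * snd p + b * snd r"
    using ex[of "(1, 0)"] by auto
  obtain c d where cd: "0 = c * fst p + d * fst r" "k = c * snd p + d * snd r"
    using ex[of "(0, 1)"] by auto
  \<comment> \<open>The determinant of the integer matrix that writes \<open>k\<close> times the
    standard basis in terms of \<open>p\<close> and \<open>r\<close>.\<close>
  let ?e = "a * d - b * c"
  have "k * k = (a * fst p + b * fst r) * (c * snd p + d * snd r) - (a * snd p + b * snd r) * (c * fst p + d * fst r)"
    using ab cd by simp
  also have "\<dots> = ?e * pair_det p r" by (simp add: pair_det_def algebra_simps)
  finally have "k * k = ?e * pair_det p r" .
  moreover have "k dvd n * fst p \<and> k dvd n * snd p" if "?e dvd n" for n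
  proof -
    \<comment> \<open>Eliminating \<open>r\<close> from these relations shows that \<open>?e\<close>
      times \<open>p\<close> lies in \<open>k\<close> times the lattice.\<close>
    have "?e * fst p = d * (a * fst p + b * fst r) - b * (c * fst p + d * fst r)"
      by (simp add: algebra_simps)
    also have "\<dots> = k * d" using ab cd by simp
    finally have 1: "k dvd ?e * fst p" by simp
    have "?e * snd p = d * (a * snd p + b * snd r) - b * (c * snd p + d * snd r)"
      by (simp add: algebra_simps)
    also have "\<dots> = k * (- b)" using ab cd by simp
    finally have 2: "k dvd ?e * snd p" by simp
    show ?thesis using that 1 2 by (meson dvd_refl dvd_trans mult_dvd_mono)
  qed
  ultimately show thesis by (rule that)
qed

text \<open>\<open>torsion_quotient_det\<close> with \<open>k = 1\<close> exhibits the determinant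
  of a generating pair as a unit; conversely a unit determinant divides 1, and
  \<open>det_multiple_in_generated_subgroup\<close> yields the whole lattice.\<close>

lemma unimodular_iff_det:
  assumes "A \<subseteq> lattice_N" "span A = UNIV"
  shows "unimodular A \<longleftrightarrow> (\<forall>p r. lat p \<in> A \<and> lat r \<in> A \<longrightarrow> \<bar>pair_det p r\<bar> \<le> 1)"
proof (intro iffI allI impI)
  fix p r assume u: "unimodular A" and pr: "lat p \<in> A \<and> lat r \<in> A"
  show "\<bar>pair_det p r\<bar> \<le> 1"
  proof (cases "pair_det p r = 0")
    case False
    then have "generated_subgroup {lat p, lat r} = lattice_N"
      using u pr maximal_independent_subset_pair unfolding unimodular_def by blast
    then have "\<forall>v\<in>lattice_N. of_int 1 *\<^sub>R v \<in> generated_subgroup {lat p, lat r}" by simp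
    then obtain e where "1 * 1 = e * pair_det p r" by (rule torsion_quotient_det)
    then have "pair_det p r dvd 1" by (metis dvd_triv_right mult_1)
    then show ?thesis by simp
  qed simp
next
  assume d: "\<forall>p r. lat p \<in> A \<and> lat r \<in> A \<longrightarrow> \<bar>pair_det p r\<bar> \<le> 1"
  show "unimodular A"
    unfolding unimodular_def
  proof (intro allI impI)
    fix B assume "maximal_independent_subset B A"
    then obtain p r where B: "B = {lat p, lat r}" "lat p \<in> A" "lat r \<in> A" "pair_det p r \<noteq> 0"
      using maximal_independent_subset_is_pair assms by metis
    then have "\<bar>pair_det p r\<bar> = 1" using d[rule_format, of p r] by linarith
    then have "pair_det p r dvd 1" by simp
    then have "lat m \<in> generated_subgroup B" for m
      using det_multiple_in_generated_subgroup[of p r 1 m] B by simp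
    moreover have "of_int a *\<^sub>R lat p + of_int b *\<^sub>R lat r \<in> lattice_N" for a b
      by (simp add: lattice_N_def lat_def)
    then have "generated_subgroup B \<subseteq> lattice_N" unfolding B(1) generated_subgroup_pair by blast
    ultimately show "generated_subgroup B = lattice_N" by (auto simp: lattice_N_eq)
  qed
qed

text \<open>If twice the lattice lies in the subgroup generated by \<open>p\<close> and
  \<open>r\<close>, the determinant divides 4. Were it \<plusminus>4, that subgroup would equal
  twice the lattice, which contains no primitive vector.\<close>

lemma two_regular_iff_det:
  assumes "\<forall>v\<in>A. primitive v" "span A = UNIV"
  shows "k_regular 2 A \<longleftrightarrow> (\<forall>p r. lat p \<in> A \<and> lat r \<in> A \<longrightarrow> \<bar>pair_det p r\<bar> \<le> 2)"
proof (intro iffI allI impI)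
  fix p r assume u: "k_regular 2 A" and pr: "lat p \<in> A \<and> lat r \<in> A"
  have co: "coprime (fst p) (snd p)" using assms pr by (metis primitiveE lat_inject)
  show "\<bar>pair_det p r\<bar> \<le> 2"
  proof (cases "pair_det p r = 0")
    case False
    then have "\<forall>v\<in>lattice_N. of_int 2 *\<^sub>R v \<in> generated_subgroup {lat p, lat r}"
      using u pr maximal_independent_subset_pair unfolding k_regular_def by simp
    then obtain e where e: "2 * 2 = e * pair_det p r" "\<And>d. e dvd d \<Longrightarrow> 2 dvd d * fst p \<and> 2 dvd d * snd p"
      by (rule torsion_quotient_det) blast
    have "\<not> e dvd 1" using e(2)[of 1] co by (metis coprime_common_divisor mult_1 odd_one)
    then have "\<bar>e\<bar> \<noteq> 1" by auto
    moreover have "e \<noteq> 0" using e(1) by auto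
    ultimately have "\<bar>e\<bar> \<ge> 2" by linarith
    moreover have "\<bar>e\<bar> * \<bar>pair_det p r\<bar> = 4" using e(1) by (metis abs_mult abs_numeral mult_2 numeral_Bit0)
    ultimately show ?thesis
      using mult_right_mono[of 2 "\<bar>e\<bar>" "\<bar>pair_det p r\<bar>"] by linarith
  qed simp
next
  assume d: "\<forall>p r. lat p \<in> A \<and> lat r \<in> A \<longrightarrow> \<bar>pair_det p r\<bar> \<le> 2"
  show "k_regular 2 A"
    unfolding k_regular_def
  proof (intro allI impI ballI)
    fix B v assume "maximal_independent_subset B A" and v: "v \<in> lattice_N"
    moreover have "A \<subseteq> lattice_N" using assms(1) by (auto simp: primitive_def)
    ultimately obtain p r where B: "B = {lat p, lat r}" "lat p \<in> A" "lat r \<in> A" "pair_det p r \<noteq> 0"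
      using maximal_independent_subset_is_pair assms(2) by metis
    then have "\<bar>pair_det p r\<bar> = 1 \<or> \<bar>pair_det p r\<bar> = 2" using d[rule_format, of p r] by linarith
    then have "pair_det p r dvd 2" by (metis abs_dvd_iff dvd_refl one_dvd)
    then show "real 2 *\<^sub>R v \<in> generated_subgroup B"
      using det_multiple_in_generated_subgroup[of p r 2] v B by (auto simp: lattice_N_eq)
  qed
qed

subsection \<open>Lattice points in the polygon\<close>

lemma fractionally_covered_lat:
  assumes "A \<subseteq> lattice_N"
  shows "fractionally_covered A q \<longleftrightarrow>
    (\<forall>a. \<exists>b. \<forall>p. lat p \<in> A \<longrightarrow> \<bar>int q * dot b p - dot a p\<bar> < int q)"
proof -
  have "\<bar>real q * pairing b (lat p) - pairing a (lat p)\<bar> < real q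
      \<longleftrightarrow> \<bar>int q * dot b p - dot a p\<bar> < int q" for a b p
  proof -
    have "\<bar>real q * pairing b (lat p) - pairing a (lat p)\<bar> = of_int \<bar>int q * dot b p - dot a p\<bar>"
      by (simp add: pairing_lat)
    then show ?thesis by (metis of_int_less_iff of_int_of_nat_eq)
  qed
  moreover have "(\<forall>v\<in>A. P v) \<longleftrightarrow> (\<forall>p. lat p \<in> A \<longrightarrow> P (lat p))" for P
  proof -
    have "\<exists>p. v = lat p" if "v \<in> A" for v using subsetD[OF assms that] by (simp add: lattice_N_eq image_iff)
    then show ?thesis by metis
  qed
  ultimately show ?thesis unfolding fractionally_covered_def by simp
qed

text \<open>The obstructing class is \<open>(q div 2)/q\<close> times the primitive functional vanishing on \<open>p\<close>.\<close>

lemma not_fractionally_covered: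
  assumes "\<forall>v\<in>A. primitive v" "lat p \<in> A" "lat r \<in> A" and q: "q \<ge> 2"
    and large: "int q \<le> \<bar>pair_det p r\<bar> * int (q div 2)"
  shows "\<not> fractionally_covered A q"
proof
  assume R: "fractionally_covered A q"
  let ?h = "int (q div 2)"
  have A: "A \<subseteq> lattice_N" using assms(1) by (auto simp: primitive_def)
  have co: "coprime (fst p) (snd p)" using assms by (metis primitiveE lat_inject)
  obtain b where b: "\<And>s. lat s \<in> A \<Longrightarrow> \<bar>int q * dot b s - dot (- ?h * snd p, ?h * fst p) s\<bar> < int q"
    using R unfolding fractionally_covered_lat[OF A] by blast
  \<comment> \<open>The chosen class vanishes on \<open>p\<close>, so \<open>b\<close> pairs with
    \<open>p\<close> to an integer of absolute value below 1.\<close>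
  have "\<bar>int q * dot b p\<bar> < int q" using b[OF assms(2)] by (simp add: dot_def algebra_simps)
  then have "\<bar>dot b p\<bar> < 1" using q by (simp add: abs_mult)
  then have z: "fst b * fst p + snd b * snd p = 0" by (simp add: dot_def)
  obtain s t where st: "s * fst p + t * snd p = 1"
    using co by (metis bezout_int coprime_iff_gcd_eq_1)
  \<comment> \<open>As \<open>p\<close> is primitive, a functional killing it is an integer multiple
    \<open>j\<close> of \<open>(- snd p, fst p)\<close>; the Bezout coefficients read off
    \<open>j\<close>.\<close>
  define j where "j = s * snd b - t * fst b"
  have "j * fst p = snd b * (s * fst p + t * snd p) - t * (fst b * fst p + snd b * snd p)"
    unfolding j_def by (simp add: algebra_simps)
  then have j1: "snd b = j * fst p" using st z by simp
  have "- j * snd p = fst b * (s * fst p + t * snd p) - s * (fst b * fst p + snd b * snd p)"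
    unfolding j_def by (simp add: algebra_simps)
  then have j2: "fst b = - j * snd p" using st z by simp
  have "int q * dot b r - dot (- ?h * snd p, ?h * fst p) r = (int q * j - ?h) * pair_det p r"
    by (simp add: dot_def j1 j2 pair_det_def algebra_simps)
  then have "\<bar>int q * j - ?h\<bar> * \<bar>pair_det p r\<bar> < int q" using b[OF assms(3)] by (simp add: abs_mult)
  then have "\<bar>int q * j - ?h\<bar> * \<bar>pair_det p r\<bar> < ?h * \<bar>pair_det p r\<bar>" using large by (simp add: mult.commute)
  then have l: "\<bar>int q * j - ?h\<bar> < ?h" by (meson abs_ge_zero linorder_not_le mult_right_mono)
  \<comment> \<open>No multiple of \<open>q\<close> is closer to \<open>q div 2\<close> than 0 is,
    because \<open>q div 2\<close> is at most half of \<open>q\<close>.\<close>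
  have hq: "2 * ?h \<le> int q" by simp
  show False
  proof (cases "j \<le> 0")
    case True
    then have "int q * j \<le> 0" by (simp add: mult_nonneg_nonpos)
    then show False using l by linarith
  next
    case False
    then have "int q * 1 \<le> int q * j" by (intro mult_left_mono) auto
    then show False using l hq by linarith
  qed
qed

lemma dot_cramer:
  "pair_det p r * dot m s = pair_det s r * dot m p + pair_det p s * dot m r"
  by (simp add: pair_det_def dot_def algebra_simps)

text \<open>Relative to the basis \<open>p\<close>, \<open>r\<close> every ray has coordinates 0 or
  \<plusminus>1, and all rays with two nonzero coordinates share the sign of their product. Rounding
  the two values of \<open>a\<close> in directions matched to that sign keeps the rounding errors
  from adding up on such a ray.\<close>

lemma fractionally_covered_unimodular:
  assumes prim: "\<forall>v\<in>A. primitive v"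
    and det: "\<And>p r. lat p \<in> A \<Longrightarrow> lat r \<in> A \<Longrightarrow> \<bar>pair_det p r\<bar> \<le> 1"
    and pr: "lat p \<in> A" "lat r \<in> A" "pair_det p r \<noteq> 0" and q: "q > 0"
  shows "fractionally_covered A q"
proof -
  have A: "A \<subseteq> lattice_N" using prim by (auto simp: primitive_def)
  have D: "\<bar>pair_det p r\<bar> = 1" using det[OF pr(1,2)] pr(3) by linarith
  then have DD: "pair_det p r * pair_det p r = 1" by (metis abs_mult_self_eq mult_1)
  \<comment> \<open>The determinant is its own inverse, so \<open>c s\<close> and \<open>d s\<close>
    are the coordinates of \<open>s\<close> relative to \<open>p\<close> and
    \<open>r\<close>.\<close>
  define c where "c s = pair_det p r * pair_det s r" for s
  define d where "d s = pair_det p r * pair_det p s" for s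
  have c1: "\<bar>c s\<bar> \<le> 1" and d1: "\<bar>d s\<bar> \<le> 1" if "lat s \<in> A" for s
    using det[OF that pr(2)] det[OF pr(1) that] D by (auto simp: c_def d_def abs_mult)
  have cd: "dot m s = c s * dot m p + d s * dot m r" for m s
  proof -
    have "pair_det p r * (pair_det p r * dot m s) = c s * dot m p + d s * dot m r"
      unfolding dot_cramer[of p r m s] c_def d_def by (simp add: algebra_simps)
    then show ?thesis using DD by (simp add: mult.assoc[symmetric])
  qed
  have cross: "pair_det p r * pair_det s t = c s * d t - d s * c t" for s t
  proof -
    have "c s * d t - d s * c t = (pair_det p r * pair_det p r) * (pair_det s r * pair_det p t - pair_det p s * pair_det t r)"
      by (simp add: c_def d_def algebra_simps)
    also have "\<dots> = pair_det p r * pair_det s t"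
      unfolding DD by (simp add: pair_det_def algebra_simps)
    finally show ?thesis by simp
  qed
  have solve: "\<exists>b. dot b p = i \<and> dot b r = j" for i j
  proof -
    let ?b = "(pair_det p r * (i * snd r - j * snd p), pair_det p r * (j * fst p - i * fst r))"
    have "dot ?b p = pair_det p r * pair_det p r * i" "dot ?b r = pair_det p r * pair_det p r * j"
      by (simp_all add: dot_def) (simp_all add: pair_det_def algebra_simps)
    then show ?thesis using DD by (metis mult_1)
  qed
  have down: "\<exists>i. int q * i - x \<le> 0 \<and> - int q < int q * i - x" for x
  proof -
    have "int q * (x div int q) = x - x mod int q" by (rule minus_mod_eq_mult_div [symmetric])
    then show ?thesis using q by (intro exI[of _ "x div int q"]) simp
  qed
  have up: "\<exists>i. 0 \<le> int q * i - x \<and> int q * i - x < int q" for x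
  proof -
    obtain i where "int q * i - (- x) \<le> 0 \<and> - int q < int q * i - (- x)" using down by blast
    then show ?thesis by (intro exI[of _ "- i"]) simp
  qed
  \<comment> \<open>Two rays with opposite signs of \<open>c * d\<close>, such as
    \<open>p + r\<close> and \<open>p - r\<close>, have determinant \<plusminus>2.\<close>
  have signs: "(\<forall>s. lat s \<in> A \<longrightarrow> c s * d s \<ge> 0) \<or> (\<forall>s. lat s \<in> A \<longrightarrow> c s * d s \<le> 0)"
  proof (rule ccontr)
    assume "\<not> ?thesis"
    then obtain s t where st: "lat s \<in> A" "c s * d s < 0" "lat t \<in> A" "c t * d t > 0"
      by (meson linorder_not_le)
    then have "\<bar>pair_det s t\<bar> \<le> 1" using det by blast
    then have "\<bar>c s * d t - d s * c t\<bar> \<le> 1" using cross[of s t] D by (metis abs_mult mult_1)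
    moreover have "c s = -1 \<or> c s = 0 \<or> c s = 1" "c t = -1 \<or> c t = 0 \<or> c t = 1"
      "d s = -1 \<or> d s = 0 \<or> d s = 1" "d t = -1 \<or> d t = 0 \<or> d t = 1"
      using c1[OF st(1)] c1[OF st(3)] d1[OF st(1)] d1[OF st(3)] by linarith+
    ultimately show False using st(2,4) by (elim disjE) simp_all
  qed
  have "\<exists>b. \<forall>s. lat s \<in> A \<longrightarrow> \<bar>int q * dot b s - dot a s\<bar> < int q" for a
  proof -
    obtain i where i: "0 \<le> int q * i - dot a p" "int q * i - dot a p < int q" using up by blast
    \<comment> \<open>The error at \<open>p\<close> is nonnegative; \<open>j\<close> is rounded so
      that the contributions of \<open>p\<close> and \<open>r\<close> to a ray never have the same
      nonzero sign.\<close>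
    have "\<exists>j. \<bar>int q * j - dot a r\<bar> < int q \<and>
        (\<forall>s. lat s \<in> A \<longrightarrow> c s * d s * (int q * j - dot a r) \<le> 0)"
      using signs
    proof
      assume s: "\<forall>s. lat s \<in> A \<longrightarrow> c s * d s \<ge> 0"
      obtain j where "int q * j - dot a r \<le> 0" "- int q < int q * j - dot a r" using down by blast
      then show ?thesis using s q by (intro exI[of _ j]) (auto intro: mult_nonneg_nonpos)
    next
      assume s: "\<forall>s. lat s \<in> A \<longrightarrow> c s * d s \<le> 0"
      obtain j where "0 \<le> int q * j - dot a r" "int q * j - dot a r < int q" using up by blast
      then show ?thesis using s by (intro exI[of _ j]) (auto intro: mult_nonpos_nonneg)
    qed
    then obtain j where j: "\<bar>int q * j - dot a r\<bar> < int q"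
      "\<And>s. lat s \<in> A \<Longrightarrow> c s * d s * (int q * j - dot a r) \<le> 0" by blast
    obtain b where b: "dot b p = i" "dot b r = j" using solve by blast
    have "\<bar>int q * dot b s - dot a s\<bar> < int q" if "lat s \<in> A" for s
    proof -
      have e: "int q * dot b s - dot a s = c s * (int q * i - dot a p) + d s * (int q * j - dot a r)"
        unfolding cd[of _ s] by (simp add: b algebra_simps)
      have "c s = -1 \<or> c s = 0 \<or> c s = 1" "d s = -1 \<or> d s = 0 \<or> d s = 1"
        using c1[OF that] d1[OF that] by linarith+
      then show ?thesis unfolding e using j(2)[OF that] i j(1) q by (elim disjE) simp_all
    qed
    then show ?thesis by blast
  qed
  then show ?thesis using fractionally_covered_lat[OF A] by blast
qed

text \<open>Every ray is a combination of \<open>p\<close> and \<open>r\<close> with coefficients of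
  absolute sum at most 1, so it suffices to control \<open>b\<close> on these two. Any pair of
  values of equal parity is attained by some \<open>b\<close>, and for odd \<open>q\<close>
  admissible roundings of equal parity exist.\<close>

lemma fractionally_covered_index_two:
  assumes prim: "\<forall>v\<in>A. primitive v"
    and det: "\<And>p r. lat p \<in> A \<Longrightarrow> lat r \<in> A \<Longrightarrow> \<bar>pair_det p r\<bar> \<le> 2"
    and pr: "lat p \<in> A" "lat r \<in> A" "\<bar>pair_det p r\<bar> = 2" and q: "odd q"
  shows "fractionally_covered A q"
proof -
  have A: "A \<subseteq> lattice_N" using prim by (auto simp: primitive_def)
  have co: "coprime (fst s) (snd s)" if "lat s \<in> A" for s
    using prim that by (metis primitiveE lat_inject)
  have odd: "odd (fst s) \<or> odd (snd s)" if "lat s \<in> A" for s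
    using co[OF that] by (metis coprime_common_divisor odd_one)
  \<comment> \<open>Modulo 2 both vectors are nonzero and proportional, hence equal.\<close>
  have "even (pair_det p r)" using pr(3) by (metis dvd_abs_iff dvd_refl)
  then have par: "even (fst p - fst r)" "even (snd p - snd r)"
    using odd[OF pr(1)] odd[OF pr(2)] by (auto simp: pair_det_def)
  have qp: "q > 0" using q by (rule odd_pos)
  \<comment> \<open>The two determinants agree modulo 2, so a sum above 2 forces both to be
    \<plusminus>2. Then \<open>s\<close> is \<plusminus>\<open>p\<close>
    \<plusminus>\<open>r\<close> and has even coordinates, against primitivity.\<close>
  have small: "\<bar>pair_det s r\<bar> + \<bar>pair_det p s\<bar> \<le> 2" if s: "lat s \<in> A" for s
  proof (rule ccontr)
    assume large: "\<not> ?thesis"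
    have b: "\<bar>pair_det s r\<bar> \<le> 2" "\<bar>pair_det p s\<bar> \<le> 2" using det s pr by blast+
    have "even (pair_det s r + pair_det p s)"
      using par by (auto simp: pair_det_def)
    then have both: "\<bar>pair_det s r\<bar> = 2" "\<bar>pair_det p s\<bar> = 2"
      using b large by presburger+
    have e: "pair_det p r * fst s = pair_det s r * fst p + pair_det p s * fst r"
      "pair_det p r * snd s = pair_det s r * snd p + pair_det p s * snd r"
      by (simp_all add: pair_det_def algebra_simps)
    have "pair_det p r = 2 \<or> pair_det p r = -2" "pair_det s r = 2 \<or> pair_det s r = -2"
      "pair_det p s = 2 \<or> pair_det p s = -2"
      using both pr(3) by linarith+
    then have "even (fst s) \<and> even (snd s)" using e par by (elim disjE) (simp only:, presburger)+
    then show False using odd[OF s] by simp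
  qed
  have solve: "\<exists>b. dot b p = i \<and> dot b r = j" if "even (i - j)" for i j
  proof -
    have ev: "even (i * snd r - j * snd p)" "even (j * fst p - i * fst r)"
      using that par by auto
    have "pair_det p r = 2 * 1 \<or> pair_det p r = 2 * (-1)" using pr(3) by linarith
    then obtain e where ee: "pair_det p r = 2 * e" "e * e = 1" by fastforce
    obtain m n where mn: "i * snd r - j * snd p = 2 * m" "j * fst p - i * fst r = 2 * n"
      using ev by (meson evenE)
    let ?b = "(e * m, e * n)"
    have "2 * dot ?b p = e * (2 * m * fst p + 2 * n * snd p)" "2 * dot ?b r = e * (2 * m * fst r + 2 * n * snd r)"
      by (simp_all add: dot_def algebra_simps)
    then have "2 * dot ?b p = e * (pair_det p r * i)" "2 * dot ?b r = e * (pair_det p r * j)"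
      unfolding mn[symmetric] by (simp_all add: pair_det_def algebra_simps)
    then have "dot ?b p = i" "dot ?b r = j" using ee by auto
    then show ?thesis by blast
  qed
  \<comment> \<open>Unless \<open>q\<close> divides \<open>x\<close>, both neighbouring multiples of
    \<open>q\<close> lie at distance less than \<open>q\<close> from \<open>x\<close>, so the parity
    of the quotient can be chosen.\<close>
  have choice: "\<exists>i. \<bar>int q * i - x\<bar> < int q \<and> (int q dvd x \<or> even (i - n))" for x n
  proof (cases "even (x div int q - n)")
    case True
    have "\<bar>int q * (x div int q) - x\<bar> < int q"
      unfolding minus_mod_eq_mult_div [symmetric] using qp by simp
    then show ?thesis using True by blast
  next
    case False
    show ?thesis
    proof (cases "int q dvd x")
      case True
      then have "int q * (x div int q) = x" by simp
      then show ?thesis using True qp by (intro exI[of _ "x div int q"]) simp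
    next
      case F: False
      then have "x mod int q \<noteq> 0" by (simp add: dvd_eq_mod_eq_0)
      then have "x mod int q > 0" using qp pos_mod_sign[of "int q" x] by linarith
      then have "\<bar>int q * (x div int q + 1) - x\<bar> < int q"
        using qp pos_mod_bound[of "int q" x] minus_mod_eq_mult_div[of x "int q"] unfolding distrib_left by linarith
      moreover have "even (x div int q + 1 - n)" using False by simp
      ultimately show ?thesis by blast
    qed
  qed
  have "\<exists>b. \<forall>s. lat s \<in> A \<longrightarrow> \<bar>int q * dot b s - dot a s\<bar> < int q" for a
  proof -
    have ev: "even (dot a p - dot a r)"
    proof -
      have "dot a p - dot a r = fst a * (fst p - fst r) + snd a * (snd p - snd r)"
        by (simp add: dot_def algebra_simps)
      then show ?thesis using par by simp
    qed
    have "\<exists>i j. \<bar>int q * i - dot a p\<bar> < int q \<and> \<bar>int q * j - dot a r\<bar> < int q \<and> even (i - j)"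
    proof (cases "int q dvd dot a p")
      case True
      then obtain i where i: "dot a p = int q * i" by blast
      obtain j where j: "\<bar>int q * j - dot a r\<bar> < int q" "int q dvd dot a r \<or> even (j - i)"
        using choice by blast
      have "even (i - j)"
      proof (cases "int q dvd dot a r")
        case True
        then obtain k where k: "dot a r = int q * k" by blast
        have "\<bar>int q * (j - k)\<bar> < int q" using j(1) k by (simp add: algebra_simps)
        then have "\<bar>j - k\<bar> < 1" using qp by (simp add: abs_mult)
        then have "j = k" by simp
        \<comment> \<open>Both quotients are forced here; oddness of \<open>q\<close> transfers the
          parity of \<open>dot a p - dot a r\<close> to their difference.\<close>
        moreover have "even (int q * (i - k))" using ev i k by (simp add: algebra_simps)
        ultimately show ?thesis using q by simp
      next
        case False then show ?thesis using j by presburger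
      qed
      then show ?thesis using j i qp by (intro exI[of _ i] exI[of _ j]) simp
    next
      case False
      obtain j where j: "\<bar>int q * j - dot a r\<bar> < int q" using choice by blast
      then show ?thesis using choice[of "dot a p" j] False by blast
    qed
    then obtain i j where ij: "\<bar>int q * i - dot a p\<bar> < int q" "\<bar>int q * j - dot a r\<bar> < int q" "even (i - j)"
      by blast
    then obtain b where b: "dot b p = i" "dot b r = j" using solve by blast
    have "\<bar>int q * dot b s - dot a s\<bar> < int q" if s: "lat s \<in> A" for s
    proof -
      let ?I = "int q * i - dot a p" and ?J = "int q * j - dot a r"
      have "pair_det p r * (int q * dot b s - dot a s)
          = int q * (pair_det p r * dot b s) - pair_det p r * dot a s" by (simp add: algebra_simps)
      also have "\<dots> = pair_det s r * ?I + pair_det p s * ?J"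
        unfolding dot_cramer[of p r _ s] by (simp add: b algebra_simps)
      finally have "2 * \<bar>int q * dot b s - dot a s\<bar> = \<bar>pair_det s r * ?I + pair_det p s * ?J\<bar>"
        using pr(3) by (metis abs_mult)
      also have "\<dots> \<le> \<bar>pair_det s r\<bar> * \<bar>?I\<bar> + \<bar>pair_det p s\<bar> * \<bar>?J\<bar>"
        by (metis abs_mult abs_triangle_ineq)
      \<comment> \<open>The integral bound \<open>q - 1\<close> keeps the final inequality strict
        even if a coefficient vanishes.\<close>
      also have "\<dots> \<le> \<bar>pair_det s r\<bar> * (int q - 1) + \<bar>pair_det p s\<bar> * (int q - 1)"
        using ij by (intro add_mono mult_left_mono) auto
      also have "\<dots> = (\<bar>pair_det s r\<bar> + \<bar>pair_det p s\<bar>) * (int q - 1)" by (simp add: algebra_simps)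
      also have "\<dots> \<le> 2 * (int q - 1)" using small[OF s] qp by (intro mult_right_mono) auto
      finally show ?thesis by simp
    qed
    then show ?thesis by blast
  qed
  then show ?thesis using fractionally_covered_lat[OF A] by blast
qed

text \<open>\<open>D\<close> stands for diagonal splitting, which enters only through the covering
  criterion. The cases are determinants at most 1, largest determinant exactly 2, and some
  determinant at least 3, in absolute value.\<close>

lemma trichotomy_from_covering:
  assumes prim: "\<forall>v\<in>A. primitive v" and sp: "span A = UNIV"
    and split: "\<And>q. q \<ge> 2 \<Longrightarrow> D q \<longleftrightarrow> fractionally_covered A q"
  shows "exactly_one_of_three
    (unimodular A \<and> (\<forall>q::nat\<ge>2. D q))
    (k_regular 2 A \<and> \<not> unimodular A \<and> (\<forall>q::nat\<ge>2. D q \<longleftrightarrow> odd q))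
    (\<not> k_regular 2 A \<and> (\<nexists>q::nat. q \<ge> 2 \<and> D q))"
proof -
  have A: "A \<subseteq> lattice_N" using prim by (auto simp: primitive_def)
  note u = unimodular_iff_det[OF A sp] and k = two_regular_iff_det[OF prim sp]
  obtain B where B: "B \<subseteq> A" "independent B" "A \<subseteq> span B" using maximal_independent_subset by blast
  then have "span B = UNIV" using sp by (metis span_mono span_span top.extremum_uniqueI)
  then have "card B = 2" using B(2) basis_card_eq_dim[of B UNIV] by auto
  then obtain v w where vw: "B = {v, w}" "v \<noteq> w" by (meson card_2_iff)
  have "v \<in> lattice_N" "w \<in> lattice_N" using vw(1) B(1) A by blast+
  then obtain p r where pr': "v = lat p" "w = lat r" unfolding lattice_N_eq by (elim rangeE)
  then have pr: "lat p \<in> A" "lat r \<in> A" "pair_det p r \<noteq> 0"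
    using vw B pr' independent_pair_iff_det[of p r] by auto
  have uk: "unimodular A \<Longrightarrow> k_regular 2 A" unfolding u k by (meson one_le_numeral order_trans)
  consider "unimodular A" | "\<not> unimodular A" "k_regular 2 A" | "\<not> k_regular 2 A" by blast
  then show ?thesis
  proof cases
    case 1
    then have "D q" if "q \<ge> 2" for q
      using fractionally_covered_unimodular[OF prim _ pr, of q] split[OF that] that u by auto
    then show ?thesis using 1 uk by (auto simp: exactly_one_of_three_def)
  next
    case 2
    then obtain s t where st: "lat s \<in> A" "lat t \<in> A" "\<bar>pair_det s t\<bar> > 1"
      unfolding u by (meson linorder_not_le)
    then have st2: "\<bar>pair_det s t\<bar> = 2" using 2(2)[unfolded k, rule_format, of s t] by linarith
    have "D q \<longleftrightarrow> odd q" if q: "q \<ge> 2" for q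
    proof
      assume "odd q"
      then show "D q" using fractionally_covered_index_two[OF prim _ st(1,2) st2] split[OF q] 2(2)
        unfolding k by blast
    next
      assume D: "D q"
      show "odd q"
      proof
        assume "even q"
        \<comment> \<open>For even \<open>q\<close>, twice \<open>q div 2\<close> is exactly
          \<open>q\<close>, so determinant 2 obstructs.\<close>
        then have "int q \<le> \<bar>pair_det s t\<bar> * int (q div 2)" using st2 by auto
        then show False using not_fractionally_covered[OF prim st(1,2) q] D split[OF q] by blast
      qed
    qed
    then show ?thesis using 2 by (auto simp: exactly_one_of_three_def)
  next
    case 3
    then obtain s t where st: "lat s \<in> A" "lat t \<in> A" "\<bar>pair_det s t\<bar> > 2"
      unfolding k by (meson linorder_not_le)
    have "\<not> D q" if q: "q \<ge> 2" for q
    proof -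
      \<comment> \<open>Determinant 3 already obstructs every \<open>q \<ge> 2\<close>, with
        equality at \<open>q = 3\<close>.\<close>
      have "3 * (q div 2) \<ge> q" using q by presburger
      then have "int q \<le> 3 * int (q div 2)" by linarith
      also have "\<dots> \<le> \<bar>pair_det s t\<bar> * int (q div 2)" using st(3) by (intro mult_right_mono) auto
      finally show ?thesis using not_fractionally_covered[OF prim st(1,2) q] split[OF q] by blast
    qed
    then show ?thesis using 3 uk by (auto simp: exactly_one_of_three_def)
  qed
qed

section \<open>Cones of a fan\<close>

lemma strongly_convexD:
  assumes "strongly_convex \<sigma>" "x \<in> \<sigma>" "- x \<in> \<sigma>"
  shows "x = 0"
proof -
  have "x \<in> \<sigma> \<inter> uminus ` \<sigma>" using assms by (metis IntI image_eqI minus_minus)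
  then show ?thesis using assms(1) unfolding strongly_convex_def by blast
qed

lemma convex_cone_hull_singleton:
  "convex_cone hull {g} = {t *\<^sub>R g | t. 0 \<le> t}" for g :: "'a::real_vector"
proof
  have "convex_cone {t *\<^sub>R g | t. 0 \<le> t}"
    unfolding convex_cone_iff
  proof (intro conjI ballI allI impI)
    show "0 \<in> {t *\<^sub>R g | t. 0 \<le> t}" by (auto intro: exI[of _ 0])
    fix x y assume "x \<in> {t *\<^sub>R g | t. 0 \<le> t}" "y \<in> {t *\<^sub>R g | t. 0 \<le> t}"
    then obtain s t where "x = s *\<^sub>R g" "y = t *\<^sub>R g" "0 \<le> s" "0 \<le> t" by blast
    then have "x + y = (s + t) *\<^sub>R g" "0 \<le> s + t" by (auto simp: scaleR_left_distrib)
    then show "x + y \<in> {t *\<^sub>R g | t. 0 \<le> t}" by blast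
  next
    fix x and c :: real assume "x \<in> {t *\<^sub>R g | t. 0 \<le> t}" "0 \<le> c"
    then obtain s where "x = s *\<^sub>R g" "0 \<le> s" by blast
    then have "c *\<^sub>R x = (c * s) *\<^sub>R g" "0 \<le> c * s" using \<open>0 \<le> c\<close> by auto
    then show "c *\<^sub>R x \<in> {t *\<^sub>R g | t. 0 \<le> t}" by blast
  qed
  moreover have "g = 1 *\<^sub>R g \<and> (0::real) \<le> 1" by simp
  then have "{g} \<subseteq> {t *\<^sub>R g | t. 0 \<le> t}" by blast
  ultimately show "convex_cone hull {g} \<subseteq> {t *\<^sub>R g | t. 0 \<le> t}" by (intro hull_minimal)
  show "{t *\<^sub>R g | t. 0 \<le> t} \<subseteq> convex_cone hull {g}"
    by (clarify, intro convex_cone_hull_mul) (simp_all add: hull_inc)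
qed

lemma convex_cone_hull_insert_cases:
  assumes "x \<in> convex_cone hull (insert g H)"
  obtains t h where "0 \<le> t" "h \<in> convex_cone hull H" "x = t *\<^sub>R g + h"
proof -
  have "convex_cone hull (insert g H) = (\<Union>x\<in>convex_cone hull {g}. \<Union>y\<in>convex_cone hull H. {x + y})"
    using convex_cone_hull_Un[of "{g}" H] by simp
  then show thesis using assms that unfolding convex_cone_hull_singleton by auto
qed

section \<open>Extreme rays generate the cones of a fan\<close>

lemma zero_face_of_strongly_convex:
  assumes "convex_cone \<sigma>" "strongly_convex \<sigma>"
  shows "{0} face_of \<sigma>"
  unfolding face_of_def
proof (intro conjI ballI impI)
  show "{0} \<subseteq> \<sigma>" using assms(1) convex_cone_contains_0 by blast
  show "convex {0::real \<times> real}" by simp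
  fix a b x assume ab: "a \<in> \<sigma>" "b \<in> \<sigma>" and "x \<in> {0::real \<times> real}" "x \<in> open_segment a b"
  then obtain u where u: "0 < u" "u < 1" "0 = (1 - u) *\<^sub>R a + u *\<^sub>R b" by (auto simp: in_segment)
  have "(1 - u) *\<^sub>R a \<in> \<sigma>" "u *\<^sub>R b \<in> \<sigma>" using ab u assms(1) by (auto intro: convex_cone_scaleR)
  moreover have "u *\<^sub>R b = - ((1 - u) *\<^sub>R a)" using u by (metis add_eq_0_iff)
  ultimately have "(1 - u) *\<^sub>R a = 0" using strongly_convexD assms(2) by metis
  then show "a \<in> {0}" "b \<in> {0}" using u by auto
qed

text \<open>If a multiple of \<open>g\<close> lies between \<open>x\<close> and \<open>y\<close>,
  collecting all multiples of \<open>g\<close> leaves some \<open>c *\<^sub>R g\<close> in the cone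
  over \<open>H\<close>. Irredundancy excludes \<open>c > 0\<close>, and strong convexity makes the
  vector zero for \<open>c \<le> 0\<close>; the remainders of \<open>x\<close> and \<open>y\<close>
  are then opposite up to positive factors, so they vanish too.\<close>

lemma minimal_generator_spans_face:
  assumes \<sigma>: "\<sigma> = convex_cone hull (insert g H)" "strongly_convex \<sigma>"
    and min: "g \<notin> convex_cone hull H"
  shows "convex_cone hull {g} face_of \<sigma>"
  unfolding face_of_def
proof (intro conjI ballI impI)
  let ?C = "convex_cone hull H"
  have \<sigma>c: "convex_cone \<sigma>" and Cc: "convex_cone ?C" unfolding \<sigma> by (rule convex_cone_convex_cone_hull)+
  have C\<sigma>: "?C \<subseteq> \<sigma>" and g\<sigma>: "g \<in> \<sigma>" unfolding \<sigma> by (auto intro: hull_mono[THEN subsetD] hull_inc)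
  show "convex_cone hull {g} \<subseteq> \<sigma>" unfolding \<sigma> by (rule hull_mono) simp
  show "convex (convex_cone hull {g})" by (rule convex_convex_cone_hull)
  fix x y z assume xy: "x \<in> \<sigma>" "y \<in> \<sigma>" and z: "z \<in> convex_cone hull {g}" "z \<in> open_segment x y"
  obtain u where u: "0 < u" "u < 1" "z = (1 - u) *\<^sub>R x + u *\<^sub>R y" using z by (auto simp: in_segment)
  obtain t where t: "z = t *\<^sub>R g" using z unfolding convex_cone_hull_singleton by blast
  obtain a h where h: "0 \<le> a" "h \<in> ?C" "x = a *\<^sub>R g + h" using xy unfolding \<sigma> by (elim convex_cone_hull_insert_cases)
  obtain b k where k: "0 \<le> b" "k \<in> ?C" "y = b *\<^sub>R g + k" using xy unfolding \<sigma> by (elim convex_cone_hull_insert_cases)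
  have uh: "(1 - u) *\<^sub>R h \<in> ?C" and uk: "u *\<^sub>R k \<in> ?C"
    using u h k Cc by (auto intro: convex_cone_scaleR)
  define c where "c = t - (1 - u) * a - u * b"
  have e: "c *\<^sub>R g = (1 - u) *\<^sub>R h + u *\<^sub>R k"
    using u(3) unfolding t h k c_def by (simp add: algebra_simps)
  have eC: "c *\<^sub>R g \<in> ?C" unfolding e using uh uk Cc convex_cone_add by blast
  have "c \<le> 0"
  proof (rule ccontr)
    assume "\<not> c \<le> 0"
    then have "(1 / c) *\<^sub>R (c *\<^sub>R g) \<in> ?C" using \<open>\<not> c \<le> 0\<close> by (intro convex_cone_hull_mul[OF eC]) simp
    then show False using min \<open>\<not> c \<le> 0\<close> by simp
  qed
  then have "- (c *\<^sub>R g) \<in> \<sigma>" using convex_cone_scaleR[OF \<sigma>c, of "-c" g] g\<sigma> by simp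
  then have "c *\<^sub>R g = 0" using strongly_convexD[OF \<sigma>(2)] eC C\<sigma> by blast
  then have opp: "u *\<^sub>R k = - ((1 - u) *\<^sub>R h)" unfolding e by (metis add_eq_0_iff)
  then have "(1 - u) *\<^sub>R h = 0" using strongly_convexD[OF \<sigma>(2)] uh uk C\<sigma> by (metis subsetD)
  then have "h = 0" "k = 0" using opp u by auto
  then show "x \<in> convex_cone hull {g}" "y \<in> convex_cone hull {g}"
    unfolding convex_cone_hull_singleton using h k by auto
qed

text \<open>A generating subset of least cardinality is irredundant, so
  \<open>minimal_generator_spans_face\<close> applies to each of its members.\<close>

lemma strongly_convex_cone_face_generators:
  assumes "finite G" "strongly_convex (convex_cone hull G)"
  obtains H where "H \<subseteq> G" "convex_cone hull H = convex_cone hull G"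
    "\<forall>g\<in>H. g \<noteq> 0 \<and> convex_cone hull {g} face_of convex_cone hull G"
proof -
  let ?Q = "\<lambda>H. H \<subseteq> G \<and> convex_cone hull H = convex_cone hull G"
  obtain H where H: "?Q H" and min: "\<And>H'. ?Q H' \<Longrightarrow> card H \<le> card H'"
    using ex_has_least_nat[of ?Q G card] by auto
  have fin: "finite H" using H assms finite_subset by blast
  have "g \<noteq> 0 \<and> convex_cone hull {g} face_of convex_cone hull G" if g: "g \<in> H" for g
  proof -
    have ins: "insert g (H - {g}) = H" using g by blast
    have n: "g \<notin> convex_cone hull (H - {g})"
    proof
      assume "g \<in> convex_cone hull (H - {g})"
      then have "convex_cone hull (H - {g}) = convex_cone hull H"
        by (metis hull_redundant ins)
      then have "?Q (H - {g})" using H by auto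
      then have "card H \<le> card (H - {g})" by (rule min)
      then show False using fin g by (meson card_Diff1_less linorder_not_le)
    qed
    then have "g \<noteq> 0" using convex_cone_hull_contains_0 by metis
    moreover have "convex_cone hull {g} face_of convex_cone hull G"
      using minimal_generator_spans_face[OF _ assms(2) n] ins H by simp
    ultimately show ?thesis by blast
  qed
  then show thesis using that H by blast
qed

lemma convex_cone_hull_scaleR:
  fixes g :: "'a::real_vector"
  assumes "c > 0"
  shows "convex_cone hull {c *\<^sub>R g} = convex_cone hull {g}"
proof -
  have "c *\<^sub>R g \<in> convex_cone hull {g}" using assms by (intro convex_cone_hull_mul hull_inc) auto
  moreover have "(1 / c) *\<^sub>R (c *\<^sub>R g) \<in> convex_cone hull {c *\<^sub>R g}"
    using assms by (intro convex_cone_hull_mul hull_inc) auto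
  then have "g \<in> convex_cone hull {c *\<^sub>R g}" using assms by simp
  ultimately show ?thesis
    by (intro equalityI hull_minimal convex_cone_convex_cone_hull) auto
qed

lemma fan_coneD:
  assumes "fan \<Sigma>" "\<sigma> \<in> \<Sigma>"
  shows "rational_polyhedral_cone \<sigma>" "strongly_convex \<sigma>"
    and "\<tau> face_of \<sigma> \<Longrightarrow> \<tau> \<noteq> {} \<Longrightarrow> \<tau> \<in> \<Sigma>"
  using assms unfolding fan_def by simp_all

text \<open>Each extreme generator is a positive multiple of a primitive vector that spans the same
  face, and a fan contains the faces of its cones.\<close>

lemma fan_cone_generated_by_rays:
  assumes "fan \<Sigma>" "\<sigma> \<in> \<Sigma>"
  shows "convex_cone hull (rays \<Sigma> \<inter> \<sigma>) = \<sigma>"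
proof
  obtain G where G: "finite G" "G \<subseteq> lattice_N" "\<sigma> = convex_cone hull G"
    using fan_coneD(1)[OF assms] unfolding rational_polyhedral_cone_def by (elim exE conjE)
  note sc = fan_coneD(2)[OF assms] and face = fan_coneD(3)[OF assms]
  have c\<sigma>: "convex_cone \<sigma>" unfolding G by (rule convex_cone_convex_cone_hull)
  then show "convex_cone hull (rays \<Sigma> \<inter> \<sigma>) \<subseteq> \<sigma>" by (intro hull_minimal) auto
  obtain H where H: "H \<subseteq> G" "convex_cone hull H = \<sigma>"
    "\<forall>g\<in>H. g \<noteq> 0 \<and> convex_cone hull {g} face_of \<sigma>"
    by (rule strongly_convex_cone_face_generators[OF G(1) sc[unfolded G(3)], folded G(3)])
  have "g \<in> convex_cone hull (rays \<Sigma> \<inter> \<sigma>)" if g: "g \<in> H" for g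
  proof -
    have "g \<in> lattice_N" "g \<noteq> 0" using g H G by auto
    then obtain k w where w: "k > 0" "primitive w" "g = real k *\<^sub>R w" by (rule lattice_factor_primitive)
    have eq: "convex_cone hull {g} = convex_cone hull {w}" using w by (simp add: convex_cone_hull_scaleR)
    have "convex_cone hull {g} \<in> \<Sigma>"
      using face H(3)[rule_format, OF g] convex_cone_hull_nonempty by blast
    then have "w \<in> rays \<Sigma>" using w eq by (simp add: rays_def)
    moreover have "w \<in> convex_cone hull {g}" unfolding eq by (simp add: hull_inc)
    then have "w \<in> \<sigma>" using H(3)[rule_format, OF g] face_of_imp_subset by blast
    ultimately show ?thesis unfolding w(3) by (intro convex_cone_hull_mul hull_inc) auto
  qed
  then show "\<sigma> \<subseteq> convex_cone hull (rays \<Sigma> \<inter> \<sigma>)"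
    unfolding H(2)[symmetric] by (intro hull_minimal convex_cone_convex_cone_hull subsetI)
qed

lemma pairing_linear:
  "pairing m (x + y) = pairing m x + pairing m y" "pairing m (c *\<^sub>R x) = c * pairing m x"
  by (simp_all add: pairing_def algebra_simps)

lemma dual_monoid_convex_cone_hull:
  "dual_monoid (convex_cone hull A) = {m. \<forall>v\<in>A. 0 \<le> pairing m v}"
proof -
  have "convex_cone hull A \<subseteq> {v. 0 \<le> pairing m v}" if "\<forall>v\<in>A. 0 \<le> pairing m v" for m
  proof (rule hull_minimal)
    show "A \<subseteq> {v. 0 \<le> pairing m v}" using that by blast
    have "0 \<in> {v. 0 \<le> pairing m v}" by (simp add: pairing_def)
    then show "convex_cone {v. 0 \<le> pairing m v}"
      unfolding convex_cone_iff by (auto simp: pairing_linear)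
  qed
  then show ?thesis unfolding dual_monoid_def by (auto intro: hull_inc)
qed

text \<open>Bounds known only on the rays can therefore decide membership in a chart monoid.\<close>

lemma dual_monoid_fan_cone:
  assumes "fan \<Sigma>" "\<sigma> \<in> \<Sigma>"
  shows "dual_monoid \<sigma> = {m. \<forall>v\<in>rays \<Sigma> \<inter> \<sigma>. 0 \<le> pairing m v}"
  by (metis fan_cone_generated_by_rays[OF assms] dual_monoid_convex_cone_hull)

text \<open>Its dual monoid is all of \<open>M\<close>, so the torus is one of the charts.\<close>

lemma complete_fan_zero_cone:
  assumes "complete_fan \<Sigma>"
  shows "{0} \<in> \<Sigma>"
proof -
  have fan: "fan \<Sigma>" and "\<Sigma> \<noteq> {}" using assms unfolding complete_fan_def by auto
  then obtain \<sigma> where \<sigma>: "\<sigma> \<in> \<Sigma>" by blast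
  obtain G where "\<sigma> = convex_cone hull G"
    using fan_coneD(1)[OF fan \<sigma>] unfolding rational_polyhedral_cone_def by (elim exE conjE)
  then have "convex_cone \<sigma>" by (simp only: convex_cone_convex_cone_hull)
  then have "{0} face_of \<sigma>" using zero_face_of_strongly_convex fan_coneD(2)[OF fan \<sigma>] by blast
  then show ?thesis using fan_coneD(3)[OF fan \<sigma>] by simp
qed

lemma complete_fan_span_rays:
  assumes "complete_fan \<Sigma>"
  shows "span (rays \<Sigma>) = UNIV"
proof -
  have "\<sigma> \<subseteq> span (rays \<Sigma>)" if "\<sigma> \<in> \<Sigma>" for \<sigma>
  proof -
    have "convex_cone hull (rays \<Sigma> \<inter> \<sigma>) \<subseteq> span (rays \<Sigma>)"
      by (rule hull_minimal) (auto intro: span_base convex_cone_span)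
    then show ?thesis using fan_cone_generated_by_rays that assms unfolding complete_fan_def by metis
  qed
  then show ?thesis using assms unfolding complete_fan_def by blast
qed

section \<open>Monoid algebras\<close>

subsection \<open>Monomial maps\<close>

lemma poly_mapping_sum_monomials:
  "f = (\<Sum>m\<in>Poly_Mapping.keys f. Poly_Mapping.single m (Poly_Mapping.lookup f m))"
  by (rule poly_mapping_eqI)
    (simp add: lookup_sum lookup_single when_def in_keys_iff if_distrib cong: if_cong)

lemma poly_mapping_monomial_induct [consumes 1, case_names zero monomial add]:
  fixes f :: "'m \<Rightarrow>\<^sub>0 'k::comm_monoid_add"
  assumes "Poly_Mapping.keys f \<subseteq> S" "P 0"
    and mono: "\<And>m c. m \<in> S \<Longrightarrow> P (Poly_Mapping.single m c)"
    and add: "\<And>g h. P g \<Longrightarrow> P h \<Longrightarrow> P (g + h)"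
  shows "P f"
proof -
  have "P (\<Sum>m\<in>A. Poly_Mapping.single m (Poly_Mapping.lookup f m))" if "A \<subseteq> Poly_Mapping.keys f" for A
    using finite_subset[OF that finite_keys] that
  proof (induction A rule: finite_induct)
    case (insert m A)
    then have "m \<in> S" using assms(1) by blast
    then show ?case using insert mono add by simp
  qed (simp add: assms(2))
  then show ?thesis using poly_mapping_sum_monomials[of f] by (metis order_refl)
qed

lemma additive_eq_on_monomials:
  fixes \<phi> \<psi> :: "('m \<Rightarrow>\<^sub>0 'k::comm_monoid_add) \<Rightarrow> 'b::ab_group_add"
  assumes "\<And>f g. \<phi> (f + g) = \<phi> f + \<phi> g" "\<And>f g. \<psi> (f + g) = \<psi> f + \<psi> g"
    and "\<And>m c. \<phi> (Poly_Mapping.single m c) = \<psi> (Poly_Mapping.single m c)"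
  shows "\<phi> f = \<psi> f"
proof (rule poly_mapping_monomial_induct[OF subset_UNIV, where P = "\<lambda>f. \<phi> f = \<psi> f"])
  show "\<phi> 0 = \<psi> 0" using assms(1)[of 0 0] assms(2)[of 0 0] by simp
qed (simp_all add: assms)

text \<open>Multiplication by \<open>single 0 c\<close> is multiplication by the scalar
  \<open>c\<close>, so this is the \<open>k\<close>-linear map with prescribed values on the
  monomials.\<close>

definition linear_extension :: "('m \<Rightarrow> ('n::comm_monoid_add \<Rightarrow>\<^sub>0 'k::field)) \<Rightarrow> ('m \<Rightarrow>\<^sub>0 'k) \<Rightarrow> ('n \<Rightarrow>\<^sub>0 'k)" where
  "linear_extension B f = (\<Sum>m\<in>Poly_Mapping.keys f. Poly_Mapping.single 0 (Poly_Mapping.lookup f m) * B m)"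

lemma linear_extension_superset:
  assumes "finite A" "Poly_Mapping.keys f \<subseteq> A"
  shows "linear_extension B f = (\<Sum>m\<in>A. Poly_Mapping.single 0 (Poly_Mapping.lookup f m) * B m)"
  unfolding linear_extension_def using assms
  by (intro sum.mono_neutral_left) (auto simp: in_keys_iff)

lemma linear_extension_add:
  "linear_extension B (f + g) = linear_extension B f + linear_extension B g"
proof -
  let ?A = "Poly_Mapping.keys f \<union> Poly_Mapping.keys g"
  have "Poly_Mapping.keys (f + g) \<subseteq> ?A" by (rule Poly_Mapping.keys_add)
  then show ?thesis
    using linear_extension_superset[of ?A f B] linear_extension_superset[of ?A g B]
      linear_extension_superset[of ?A "f + g" B]
    by (simp add: sum.distrib lookup_add single_add distrib_right)
qed

lemma linear_extension_single:
  "linear_extension B (Poly_Mapping.single m c) = Poly_Mapping.single 0 c * B m"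
  by (cases "c = 0") (simp_all add: linear_extension_def)

lemma linear_extension_zero [simp]: "linear_extension B 0 = 0"
  by (simp add: linear_extension_def)

lemma algebra_map_eq_linear_extension:
  "algebra_map h = linear_extension (\<lambda>m. Poly_Mapping.single (h m :: 'n::comm_monoid_add) 1)"
  by (rule ext) (simp add: algebra_map_def linear_extension_def mult_single)

lemma algebra_map_add: "algebra_map h (f + g) = algebra_map h f + algebra_map (h :: _ \<Rightarrow> _::comm_monoid_add) g"
  by (simp add: algebra_map_eq_linear_extension linear_extension_add)

lemma algebra_map_single:
  "algebra_map h (Poly_Mapping.single m c) = Poly_Mapping.single (h m :: _::comm_monoid_add) c"
  by (simp add: algebra_map_eq_linear_extension linear_extension_single mult_single)

lemma algebra_map_zero [simp]: "algebra_map h 0 = 0"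
  by (simp add: algebra_map_def)

lemma algebra_map_diff:
  "algebra_map h (f - g) = algebra_map h f - algebra_map (h :: _ \<Rightarrow> _::comm_monoid_add) g"
  by (metis algebra_map_add diff_add_cancel eq_diff_eq)

lemma algebra_map_mult:
  fixes h :: "'m::comm_monoid_add \<Rightarrow> 'n::comm_monoid_add"
  assumes "\<And>x y. h (x + y) = h x + h y"
  shows "algebra_map h (f * g) = algebra_map h f * algebra_map h g"
proof (rule additive_eq_on_monomials[where f = f and \<phi> = "\<lambda>f. algebra_map h (f * g)"
      and \<psi> = "\<lambda>f. algebra_map h f * algebra_map h g"])
  fix m and c :: 'a
  show "algebra_map h (Poly_Mapping.single m c * g) = algebra_map h (Poly_Mapping.single m c) * algebra_map h g"
    by (rule additive_eq_on_monomials[where f = g and \<phi> = "\<lambda>g. algebra_map h (Poly_Mapping.single m c * g)"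
          and \<psi> = "\<lambda>g. algebra_map h (Poly_Mapping.single m c) * algebra_map h g"])
      (simp_all add: algebra_map_add algebra_map_single mult_single assms distrib_left)
qed (simp_all add: algebra_map_add distrib_right)

lemma algebra_map_one:
  fixes h :: "'m::comm_monoid_add \<Rightarrow> 'n::comm_monoid_add"
  assumes "h 0 = 0"
  shows "algebra_map h 1 = 1"
  using algebra_map_single[of h 0 1] assms by simp

lemma keys_algebra_map: "Poly_Mapping.keys (algebra_map h f) \<subseteq> h ` Poly_Mapping.keys f"
  unfolding algebra_map_def by (rule subset_trans[OF keys_sum]) (auto split: if_splits)

lemma lookup_algebra_map_inj:
  assumes "inj h"
  shows "Poly_Mapping.lookup (algebra_map h f) (h m) = Poly_Mapping.lookup f m"
  unfolding algebra_map_def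
  by (simp add: lookup_sum lookup_single when_def inj_eq[OF assms] in_keys_iff if_distrib cong: if_cong)

lemma algebra_map_eq_zero_iff:
  assumes "inj h"
  shows "algebra_map h f = 0 \<longleftrightarrow> f = 0"
  using lookup_algebra_map_inj[OF assms, of f]
  by (metis algebra_map_zero lookup_zero poly_mapping_eqI)

text \<open>Multiplicativity transports the cross-multiplied equation of two equal fractions, and
  injectivity keeps denominators nonzero, so the description in \<open>function_field_map\<close>
  determines a unique value.\<close>

lemma function_field_map_Fract:
  fixes h :: "'m::{ordered_cancel_comm_monoid_add, linorder} \<Rightarrow> 'n::{ordered_cancel_comm_monoid_add, linorder}"
  assumes h: "\<And>x y. h (x + y) = h x + h y" "inj h" and b: "b \<noteq> 0"
  shows "function_field_map h (Fract a b) = Fract (algebra_map h a) (algebra_map h b)"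
  unfolding function_field_map_def
proof (rule the_equality)
  show "\<exists>a' b'. b' \<noteq> 0 \<and> Fract a b = Fract a' b'
      \<and> Fract (algebra_map h a) (algebra_map h b) = Fract (algebra_map h a') (algebra_map h b')"
    using b by blast
  fix y assume "\<exists>a' b'. b' \<noteq> 0 \<and> Fract a b = Fract a' b' \<and> y = Fract (algebra_map h a') (algebra_map h b')"
  then obtain a' b' where ab: "b' \<noteq> 0" "Fract a b = Fract a' b'" "y = Fract (algebra_map h a') (algebra_map h b')"
    by blast
  then have "a * b' = a' * b" using b by (simp add: eq_fract)
  then have "algebra_map h a * algebra_map h b' = algebra_map h a' * algebra_map h b"
    using algebra_map_mult[of h] h(1) by metis
  then show "y = Fract (algebra_map h a) (algebra_map h b)"
    using ab(1) b by (simp add: ab(3) eq_fract algebra_map_eq_zero_iff[OF h(2)])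
qed

subsection \<open>Monoid algebras and their primes\<close>

definition is_submonoid :: "'m::comm_monoid_add set \<Rightarrow> bool" where
  "is_submonoid S \<longleftrightarrow> 0 \<in> S \<and> (\<forall>x\<in>S. \<forall>y\<in>S. x + y \<in> S)"

definition supported :: "'m set \<Rightarrow> ('m \<Rightarrow>\<^sub>0 'k::field) set" where
  "supported S = {f. Poly_Mapping.keys f \<subseteq> S}"

lemma carrier_monoid_algebra [simp]: "carrier (monoid_algebra S) = supported S"
  by (simp add: monoid_algebra_def supported_def)

lemma supported_zero [simp]: "0 \<in> supported S"
  by (simp add: supported_def)

lemma supported_UNIV [simp]: "f \<in> supported UNIV"
  by (simp add: supported_def)

lemma supported_single: "m \<in> S \<Longrightarrow> Poly_Mapping.single m c \<in> supported S"
  by (simp add: supported_def)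

lemma supported_one: "is_submonoid S \<Longrightarrow> 1 \<in> supported S"
  by (simp add: supported_def is_submonoid_def)

lemma supported_add: "f \<in> supported S \<Longrightarrow> g \<in> supported S \<Longrightarrow> f + g \<in> supported S"
  using Poly_Mapping.keys_add[of f g] by (auto simp: supported_def)

lemma supported_uminus: "f \<in> supported S \<Longrightarrow> - f \<in> supported S"
  by (auto simp: supported_def in_keys_iff)

lemma supported_diff: "f \<in> supported S \<Longrightarrow> g \<in> supported S \<Longrightarrow> f - g \<in> supported S"
  by (metis supported_add supported_uminus uminus_add_conv_diff add.commute)

lemma supported_mult:
  assumes "is_submonoid S" "f \<in> supported S" "g \<in> supported S"
  shows "f * g \<in> supported S"
proof -
  have "{a + b | a b. a \<in> Poly_Mapping.keys f \<and> b \<in> Poly_Mapping.keys g} \<subseteq> S"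
    using assms unfolding supported_def is_submonoid_def by blast
  then show ?thesis using keys_mult[of f g] unfolding supported_def by blast
qed

lemma cring_monoid_algebra:
  assumes "is_submonoid S"
  shows "cring (monoid_algebra S :: ('m::comm_monoid_add \<Rightarrow>\<^sub>0 'k::field) ring)"
proof (rule cringI)
  let ?R = "monoid_algebra S :: ('m \<Rightarrow>\<^sub>0 'k) ring"
  have ops: "x \<otimes>\<^bsub>?R\<^esub> y = x * y" "\<one>\<^bsub>?R\<^esub> = 1" for x y
    by (simp_all add: monoid_algebra_def)
  show "abelian_group (monoid_algebra S :: ('m \<Rightarrow>\<^sub>0 'k) ring)"
  proof (rule abelian_groupI)
    fix x :: "'m \<Rightarrow>\<^sub>0 'k" assume "x \<in> carrier (monoid_algebra S)"
    then show "\<exists>y\<in>carrier (monoid_algebra S). y \<oplus>\<^bsub>monoid_algebra S\<^esub> x = \<zero>\<^bsub>monoid_algebra S\<^esub>"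
      by (intro bexI[of _ "- x"]) (auto simp: monoid_algebra_def[of S] supported_uminus[unfolded supported_def, simplified])
  qed (use assms in \<open>auto simp: monoid_algebra_def supported_add[unfolded supported_def, simplified] add.assoc add.commute\<close>)
  show "comm_monoid (monoid_algebra S :: ('m \<Rightarrow>\<^sub>0 'k) ring)"
    by (rule comm_monoidI)
      (simp_all only: carrier_monoid_algebra supported_one[OF assms] supported_mult[OF assms] ops
        mult.assoc mult_1, simp add: mult.commute)
qed (simp add: monoid_algebra_def distrib_right)

definition is_ideal :: "'m::comm_monoid_add set \<Rightarrow> ('m \<Rightarrow>\<^sub>0 'k::field) set \<Rightarrow> bool" where
  "is_ideal S I \<longleftrightarrow> I \<subseteq> supported S \<and> 0 \<in> I \<and> (\<forall>f\<in>I. \<forall>g\<in>I. f + g \<in> I)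
     \<and> (\<forall>f\<in>supported S. \<forall>g\<in>I. f * g \<in> I)"

lemma is_idealD:
  assumes "is_ideal S I"
  shows "f \<in> I \<Longrightarrow> f \<in> supported S" "0 \<in> I" "f \<in> I \<Longrightarrow> g \<in> I \<Longrightarrow> f + g \<in> I"
    "f \<in> supported S \<Longrightarrow> g \<in> I \<Longrightarrow> f * g \<in> I" "g \<in> supported S \<Longrightarrow> f \<in> I \<Longrightarrow> f * g \<in> I"
  using assms by (auto simp: is_ideal_def mult.commute)

text \<open>Trades the ring record for the type-class operations, so that later arguments compute
  directly in the group algebra.\<close>

lemma Spec_iff:
  fixes P :: "('m::{ordered_cancel_comm_monoid_add, linorder} \<Rightarrow>\<^sub>0 'k::field) set"
  assumes S: "is_submonoid S"
  shows "P \<in> Spec S \<longleftrightarrow> is_ideal S P \<and> 1 \<notin> P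
    \<and> (\<forall>f\<in>supported S. \<forall>g\<in>supported S. f * g \<in> P \<longrightarrow> f \<in> P \<or> g \<in> P)"
proof
  let ?R = "monoid_algebra S :: ('m \<Rightarrow>\<^sub>0 'k) ring"
  have ops: "x \<otimes>\<^bsub>?R\<^esub> y = x * y" "x \<oplus>\<^bsub>?R\<^esub> y = x + y" "\<one>\<^bsub>?R\<^esub> = 1" "\<zero>\<^bsub>?R\<^esub> = 0" for x y
    by (simp_all add: monoid_algebra_def)
  {
    assume "P \<in> Spec S"
    then interpret primeideal P ?R by (simp add: Spec_def)
    have "is_ideal S P"
      unfolding is_ideal_def
      using a_subset additive_subgroup.zero_closed[OF additive_subgroup_axioms]
        additive_subgroup.a_closed[OF additive_subgroup_axioms] I_l_closed
      by (simp add: ops)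
    moreover have "1 \<notin> P" using one_imp_carrier I_notcarr by (auto simp: ops)
    ultimately show "is_ideal S P \<and> 1 \<notin> P
      \<and> (\<forall>f\<in>supported S. \<forall>g\<in>supported S. f * g \<in> P \<longrightarrow> f \<in> P \<or> g \<in> P)"
      using I_prime by (simp add: ops)
  next
    assume P: "is_ideal S P \<and> 1 \<notin> P
      \<and> (\<forall>f\<in>supported S. \<forall>g\<in>supported S. f * g \<in> P \<longrightarrow> f \<in> P \<or> g \<in> P)"
    interpret R: cring ?R using S by (rule cring_monoid_algebra)
    have um: "\<ominus>\<^bsub>?R\<^esub> x = - x" if "x \<in> supported S" for x
      using that R.minus_equality[of "- x" x] by (simp add: ops supported_uminus)
    have neg: "- x \<in> P" if "x \<in> P" for x
    proof -
      have "(- 1) * x \<in> P" using P that S supported_one supported_uminus unfolding is_ideal_def by blast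
      then show ?thesis by simp
    qed
    have "primeideal P ?R"
    proof (intro primeidealI idealI R.is_cring R.ring_axioms)
      show "subgroup P (add_monoid ?R)"
      proof (rule R.add.subgroupI)
        fix x assume "x \<in> P"
        then show "\<ominus>\<^bsub>?R\<^esub> x \<in> P" using P um neg unfolding is_ideal_def by auto
      qed (use P in \<open>auto simp: is_ideal_def ops\<close>)
      show "carrier ?R \<noteq> P" using P supported_one[OF S] by auto
    qed (use P is_idealD(4,5)[of S P] in \<open>auto simp: ops\<close>)
    then show "P \<in> Spec S" by (simp add: Spec_def)
  }
qed

lemma SpecD:
  assumes "is_submonoid S" "P \<in> Spec S"
  shows "is_ideal S P" "1 \<notin> P"
    "f \<in> supported S \<Longrightarrow> g \<in> supported S \<Longrightarrow> f * g \<in> P \<Longrightarrow> f \<in> P \<or> g \<in> P"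
  using assms(2) unfolding Spec_iff[OF assms(1)] by auto

lemma zero_in_Spec:
  assumes "is_submonoid S"
  shows "{0} \<in> Spec S"
  unfolding Spec_iff[OF assms] by (simp add: is_ideal_def)

text \<open>Krull's argument: Zorn gives an ideal maximal among those that contain \<open>D\<close>
  and avoid \<open>W\<close>, and such an ideal is prime.\<close>

lemma ex_prime_avoiding:
  fixes D :: "('m::{ordered_cancel_comm_monoid_add, linorder} \<Rightarrow>\<^sub>0 'k::field) set"
  assumes S: "is_submonoid S" and D: "is_ideal S D" and dis: "D \<inter> W = {}"
    and W: "W \<subseteq> supported S" "1 \<in> W" "\<And>x y. x \<in> W \<Longrightarrow> y \<in> W \<Longrightarrow> x * y \<in> W"
  obtains P where "P \<in> Spec S" "D \<subseteq> P" "P \<inter> W = {}"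
proof -
  let ?A = "{I. is_ideal S I \<and> D \<subseteq> I \<and> I \<inter> W = {}}"
  have "\<exists>M\<in>?A. \<forall>X\<in>?A. M \<subseteq> X \<longrightarrow> X = M"
  proof (rule subset_Zorn_nonempty)
    show "?A \<noteq> {}" using D dis by blast
    fix C assume C: "C \<noteq> {}" "subset.chain ?A C"
    have sub: "C \<subseteq> ?A" and tot: "X \<subseteq> Y \<or> Y \<subseteq> X" if "X \<in> C" "Y \<in> C" for X Y
      using C that unfolding subset_chain_def by auto
    have CA: "is_ideal S I" "D \<subseteq> I" "I \<inter> W = {}" if "I \<in> C" for I using sub[OF that that] that by auto
    have "is_ideal S (\<Union>C)"
      unfolding is_ideal_def
    proof (intro conjI ballI)
      show "\<Union>C \<subseteq> supported S" using CA(1) is_idealD(1) by blast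
      show "0 \<in> \<Union>C" using C(1) CA(1) is_idealD(2) by blast
      fix f g assume "f \<in> \<Union>C" "g \<in> \<Union>C"
      then obtain X Y where XY: "X \<in> C" "Y \<in> C" "f \<in> X" "g \<in> Y" by blast
      then consider "f \<in> Y" | "g \<in> X" using tot by blast
      then show "f + g \<in> \<Union>C" using XY is_idealD(3)[OF CA(1)] by cases blast+
    next
      fix f g :: "'m \<Rightarrow>\<^sub>0 'k" assume "f \<in> supported S" "g \<in> \<Union>C"
      then show "f * g \<in> \<Union>C" using is_idealD(4)[OF CA(1)] by blast
    qed
    then show "\<Union>C \<in> ?A" using CA C(1) by blast
  qed
  then obtain P where P: "is_ideal S P" "D \<subseteq> P" "P \<inter> W = {}"
    and max: "\<And>X. is_ideal S X \<Longrightarrow> P \<subseteq> X \<Longrightarrow> X \<inter> W = {} \<Longrightarrow> X = P" by auto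
  \<comment> \<open>Adjoining \<open>f\<close> to \<open>P\<close> would contradict maximality
    unless the larger ideal meets \<open>W\<close>.\<close>
  have step: "\<exists>p\<in>P. \<exists>c\<in>supported S. p + c * f \<in> W"
    if f: "f \<in> supported S" "f \<notin> P" for f :: "'m \<Rightarrow>\<^sub>0 'k"
  proof -
    let ?X = "{p + c * f | p c. p \<in> P \<and> c \<in> supported S}"
    have "is_ideal S ?X"
      unfolding is_ideal_def
    proof (intro conjI ballI)
      show "?X \<subseteq> supported S" using f is_idealD(1)[OF P(1)] S by (auto intro!: supported_add supported_mult)
      have "0 = 0 + 0 * f" by simp
      then show "0 \<in> ?X" using is_idealD(2)[OF P(1)] supported_zero by blast
      fix x y assume "x \<in> ?X" "y \<in> ?X"
      then obtain p c p' c' where "x = p + c * f" "y = p' + c' * f" and *: "p \<in> P" "p' \<in> P" "c \<in> supported S" "c' \<in> supported S"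
        by blast
      then have "x + y = (p + p') + (c + c') * f" by (simp add: algebra_simps)
      then show "x + y \<in> ?X" using is_idealD(3)[OF P(1)] supported_add * by blast
    next
      fix a x :: "'m \<Rightarrow>\<^sub>0 'k" assume a: "a \<in> supported S" and "x \<in> ?X"
      then obtain p c where "x = p + c * f" and *: "p \<in> P" "c \<in> supported S" by blast
      then have "a * x = a * p + (a * c) * f" by (simp add: algebra_simps)
      then show "a * x \<in> ?X" using is_idealD(4)[OF P(1) a] supported_mult[OF S a] * by blast
    qed
    moreover have "P \<subseteq> ?X"
    proof
      fix p assume "p \<in> P"
      moreover have "p = p + 0 * f" by simp
      ultimately show "p \<in> ?X" using supported_zero by blast
    qed
    moreover have "f = 0 + 1 * f" by simp
    then have "f \<in> ?X" using is_idealD(2)[OF P(1)] supported_one[OF S] by blast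
    ultimately have "?X \<inter> W \<noteq> {}" using max f by blast
    then show ?thesis by blast
  qed
  have "f \<in> P \<or> g \<in> P" if fg: "f \<in> supported S" "g \<in> supported S" "f * g \<in> P" for f g
  proof (rule ccontr)
    assume "\<not> ?thesis"
    then obtain p c p' c' where *: "p \<in> P" "c \<in> supported S" "p + c * f \<in> W" "p' \<in> P" "c' \<in> supported S" "p' + c' * g \<in> W"
      using step fg by blast
    have "(p' + c' * g) * p \<in> P" using * W(1) is_idealD(4)[OF P(1)] by blast
    moreover have "c * f * p' \<in> P" using * fg supported_mult[OF S] is_idealD(4)[OF P(1)] by blast
    moreover have "(c * c') * (f * g) \<in> P" using * fg supported_mult[OF S] is_idealD(4)[OF P(1)] by blast
    ultimately have "(p' + c' * g) * p + (c * f * p' + (c * c') * (f * g)) \<in> P"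
      using is_idealD(3)[OF P(1)] by blast
    \<comment> \<open>Every term of the expanded product has a factor in \<open>P\<close>, the last
      one through \<open>f * g\<close>.\<close>
    moreover have "(p + c * f) * (p' + c' * g) = (p' + c' * g) * p + (c * f * p' + (c * c') * (f * g))"
      by (simp add: algebra_simps)
    ultimately have "(p + c * f) * (p' + c' * g) \<in> P" by simp
    then show False using * W(3) P(3) by blast
  qed
  then have "P \<in> Spec S" unfolding Spec_iff[OF S] using P W(2) by blast
  then show thesis using that P by blast
qed

section \<open>Charts and their points\<close>

subsection \<open>Local rings\<close>

lemma local_ringI:
  "a \<in> supported S \<Longrightarrow> s \<in> supported S \<Longrightarrow> s \<notin> P \<Longrightarrow> Fract a s \<in> local_ring S P"
  unfolding local_ring_def by auto

lemma local_ringE: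
  assumes "x \<in> local_ring S P"
  obtains a s where "a \<in> supported S" "s \<in> supported S" "s \<notin> P" "x = Fract a s"
  using assms unfolding local_ring_def by auto

lemma Spec_nonzero: "is_submonoid S \<Longrightarrow> P \<in> Spec S \<Longrightarrow> s \<notin> P \<Longrightarrow> s \<noteq> 0"
  using SpecD(1) is_idealD(2) by blast

lemma Spec_mult_notin:
  "is_submonoid S \<Longrightarrow> P \<in> Spec S \<Longrightarrow> s \<in> supported S \<Longrightarrow> t \<in> supported S \<Longrightarrow> s \<notin> P \<Longrightarrow> t \<notin> P \<Longrightarrow> s * t \<notin> P"
  using SpecD(3) by blast

lemma supported_in_local_ring:
  assumes "is_submonoid S" "P \<in> Spec S" "f \<in> supported S"
  shows "Fract f 1 \<in> local_ring S P"
  using assms SpecD(2) supported_one by (intro local_ringI) auto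

lemma local_ring_add:
  assumes S: "is_submonoid S" "P \<in> Spec S" and "x \<in> local_ring S P" "y \<in> local_ring S P"
  shows "x + y \<in> local_ring S P"
proof -
  obtain a s where a: "a \<in> supported S" "s \<in> supported S" "s \<notin> P" "x = Fract a s" using assms(3) by (rule local_ringE)
  obtain b t where b: "b \<in> supported S" "t \<in> supported S" "t \<notin> P" "y = Fract b t" using assms(4) by (rule local_ringE)
  have "x + y = Fract (a * t + b * s) (s * t)"
    using Spec_nonzero[OF S] a b by simp
  moreover have "s * t \<notin> P" using Spec_mult_notin[OF S] a b by blast
  ultimately show ?thesis
    using a b S(1) by (auto intro!: local_ringI supported_add supported_mult)
qed

lemma local_ring_mult:
  assumes S: "is_submonoid S" "P \<in> Spec S" and "x \<in> local_ring S P" "y \<in> local_ring S P"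
  shows "x * y \<in> local_ring S P"
proof -
  obtain a s where a: "a \<in> supported S" "s \<in> supported S" "s \<notin> P" "x = Fract a s" using assms(3) by (rule local_ringE)
  obtain b t where b: "b \<in> supported S" "t \<in> supported S" "t \<notin> P" "y = Fract b t" using assms(4) by (rule local_ringE)
  have "x * y = Fract (a * b) (s * t)" using a b by simp
  moreover have "s * t \<notin> P" using Spec_mult_notin[OF S] a b by blast
  ultimately show ?thesis
    using a b S(1) by (auto intro!: local_ringI supported_mult)
qed

text \<open>A numerator outside \<open>P\<close> may serve as a denominator, which inverts the
  fraction; an inverse of a fraction with numerator in \<open>P\<close> would put a product of two
  allowed denominators into \<open>P\<close>.\<close>

lemma Fract_in_maximal_ideal_iff:
  assumes S: "is_submonoid S" "P \<in> Spec S" and a: "a \<in> supported S" "s \<in> supported S" "s \<notin> P"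
  shows "Fract a s \<in> maximal_ideal_of (local_ring S P) \<longleftrightarrow> a \<in> P"
proof
  assume m: "Fract a s \<in> maximal_ideal_of (local_ring S P)"
  show "a \<in> P"
  proof (rule ccontr)
    assume n: "a \<notin> P"
    then have "Fract s a \<in> local_ring S P" using a by (intro local_ringI)
    moreover have "Fract a s * Fract s a = 1"
      using Spec_nonzero[OF S] n a by (simp add: One_fract_def eq_fract mult.commute)
    ultimately show False using m unfolding maximal_ideal_of_def by blast
  qed
next
  assume p: "a \<in> P"
  have "Fract a s * g \<noteq> 1" if "g \<in> local_ring S P" for g
  proof
    assume one: "Fract a s * g = 1"
    obtain b t where b: "b \<in> supported S" "t \<in> supported S" "t \<notin> P" "g = Fract b t"
      using \<open>g \<in> local_ring S P\<close> by (rule local_ringE)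
    have "s * t \<notin> P" using Spec_mult_notin[OF S] a b by blast
    moreover have "a * b = s * t"
      using one b Spec_nonzero[OF S] a by (simp add: One_fract_def eq_fract)
    moreover have "a * b \<in> P" using is_idealD(5)[OF SpecD(1)[OF S]] p b by blast
    ultimately show False by simp
  qed
  then show "Fract a s \<in> maximal_ideal_of (local_ring S P)"
    using a unfolding maximal_ideal_of_def by (auto intro: local_ringI)
qed

lemma maximal_ideal_local_ringE:
  assumes S: "is_submonoid S" "P \<in> Spec S" and x: "x \<in> maximal_ideal_of (local_ring S P)"
  obtains a s where "a \<in> P" "s \<in> supported S" "s \<notin> P" "x = Fract a s"
proof -
  have "x \<in> local_ring S P" using x unfolding maximal_ideal_of_def by blast
  then obtain a s where a: "a \<in> supported S" "s \<in> supported S" "s \<notin> P" "x = Fract a s" by (rule local_ringE)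
  then show thesis using that x Fract_in_maximal_ideal_iff[OF S a(1-3)] by blast
qed

lemma maximal_ideal_add:
  assumes S: "is_submonoid S" "P \<in> Spec S"
    and "x \<in> maximal_ideal_of (local_ring S P)" "y \<in> maximal_ideal_of (local_ring S P)"
  shows "x + y \<in> maximal_ideal_of (local_ring S P)"
proof -
  note I = SpecD(1)[OF S]
  obtain a s where a: "a \<in> P" "s \<in> supported S" "s \<notin> P" "x = Fract a s"
    using maximal_ideal_local_ringE[OF S assms(3)] .
  obtain b t where b: "b \<in> P" "t \<in> supported S" "t \<notin> P" "y = Fract b t"
    using maximal_ideal_local_ringE[OF S assms(4)] .
  have e: "x + y = Fract (a * t + b * s) (s * t)"
    using Spec_nonzero[OF S] a b by simp
  have "a * t + b * s \<in> P" using is_idealD(3)[OF I] is_idealD(5)[OF I] a b by blast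
  moreover have "s * t \<in> supported S" "s * t \<notin> P" using a b supported_mult Spec_mult_notin S by blast+
  ultimately show ?thesis unfolding e using Fract_in_maximal_ideal_iff[OF S] is_idealD(1)[OF I] by blast
qed

text \<open>\<open>Q\<close> is the contraction of the maximal ideal to \<open>k[T]\<close>. By
  \<open>sub\<close> the local ring contains \<open>k[T]\<close>, and by \<open>frac\<close> each of
  its elements is a fraction over \<open>k[T]\<close> whose denominator is a unit, so localizing
  \<open>k[T]\<close> at \<open>Q\<close> gives back the same ring.\<close>

lemma local_ring_change_chart:
  fixes P :: "('m::{ordered_cancel_comm_monoid_add, linorder} \<Rightarrow>\<^sub>0 'k::field) set"
  assumes S: "is_submonoid S" "P \<in> Spec S" and T: "is_submonoid T"
    and sub: "\<And>f. f \<in> supported T \<Longrightarrow> Fract f 1 \<in> local_ring S P"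
    and frac: "\<And>y. y \<in> local_ring S P \<Longrightarrow>
      \<exists>a\<in>supported T. \<exists>s\<in>supported T. s \<noteq> 0 \<and> y = Fract a s \<and> Fract 1 s \<in> local_ring S P"
  obtains Q where "Q \<in> Spec T" "local_ring S P = local_ring T Q"
    "\<And>f. f \<in> supported T \<Longrightarrow> f \<in> Q \<longleftrightarrow> Fract f 1 \<in> maximal_ideal_of (local_ring S P)"
proof -
  let ?R = "local_ring S P"
  let ?m = "maximal_ideal_of ?R"
  define Q where "Q = {f \<in> supported T. Fract f 1 \<in> ?m}"
  have unit: "f \<notin> Q \<longleftrightarrow> f \<noteq> 0 \<and> Fract 1 f \<in> ?R" if f: "f \<in> supported T" for f
  proof
    assume "f \<notin> Q"
    then obtain g where g: "g \<in> ?R" "Fract f 1 * g = 1"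
      using f sub[OF f] unfolding Q_def maximal_ideal_of_def by blast
    have nz: "f \<noteq> 0" using g(2) by (auto simp: fract_collapse)
    have "Fract 1 f * Fract f 1 = 1" using nz by (simp add: One_fract_def eq_fract)
    then have "g = (Fract 1 f * Fract f 1) * g" by simp
    also have "\<dots> = Fract 1 f" unfolding mult.assoc g(2) by simp
    finally have "g = Fract 1 f" .
    then show "f \<noteq> 0 \<and> Fract 1 f \<in> ?R" using g nz by simp
  next
    assume "f \<noteq> 0 \<and> Fract 1 f \<in> ?R"
    moreover from this have "Fract f 1 * Fract 1 f = 1" by (simp add: One_fract_def eq_fract)
    ultimately show "f \<notin> Q" unfolding Q_def maximal_ideal_of_def by blast
  qed
  have "Q \<in> Spec T"
    unfolding Spec_iff[OF T]
  proof (intro conjI ballI impI)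
    show "is_ideal T Q"
      unfolding is_ideal_def
    proof (intro conjI ballI)
      show "Q \<subseteq> supported T" unfolding Q_def by blast
      show "0 \<in> Q" using unit[of 0] by auto
      fix f g assume "f \<in> Q" "g \<in> Q"
      then show "f + g \<in> Q"
        using maximal_ideal_add[OF S, of "Fract f 1" "Fract g 1"] supported_add unfolding Q_def by auto
    next
      fix f g :: "'m \<Rightarrow>\<^sub>0 'k" assume fg: "f \<in> supported T" "g \<in> Q"
      then have s: "g \<in> supported T" "f * g \<in> supported T" using supported_mult[OF T] unfolding Q_def by auto
      show "f * g \<in> Q"
      proof (rule ccontr)
        assume "f * g \<notin> Q"
        then have nz: "f * g \<noteq> 0" and "Fract 1 (f * g) \<in> ?R" using unit[OF s(2)] by auto
        then have "Fract f 1 * Fract 1 (f * g) \<in> ?R" using local_ring_mult[OF S] sub fg by blast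
        moreover have "Fract f 1 * Fract 1 (f * g) = Fract 1 g" using nz by (simp add: eq_fract mult.commute)
        ultimately show False using unit[OF s(1)] fg nz by auto
      qed
    qed
    show "1 \<notin> Q" using unit[of 1] supported_one[OF T] sub by (simp add: One_fract_def)
    fix f g :: "'m \<Rightarrow>\<^sub>0 'k" assume fg: "f \<in> supported T" "g \<in> supported T" "f * g \<in> Q"
    show "f \<in> Q \<or> g \<in> Q"
    proof (rule ccontr)
      assume "\<not> ?thesis"
      then have n: "f \<noteq> 0" "g \<noteq> 0" "Fract 1 f \<in> ?R" "Fract 1 g \<in> ?R" using unit fg by auto
      then have "Fract 1 f * Fract 1 g \<in> ?R" using local_ring_mult[OF S] by blast
      then show False using unit[of "f * g"] fg supported_mult[OF T] n by auto
    qed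
  qed
  moreover have "?R = local_ring T Q"
  proof
    show "?R \<subseteq> local_ring T Q"
    proof
      fix y assume "y \<in> ?R"
      then obtain a s where "a \<in> supported T" "s \<in> supported T" "s \<noteq> 0" "y = Fract a s" "Fract 1 s \<in> ?R"
        using frac by blast
      then show "y \<in> local_ring T Q" using unit by (auto intro: local_ringI)
    qed
    show "local_ring T Q \<subseteq> ?R"
    proof
      fix y assume "y \<in> local_ring T Q"
      then obtain a s where a: "a \<in> supported T" "s \<in> supported T" "s \<notin> Q" "y = Fract a s" by (rule local_ringE)
      then have "Fract a 1 * Fract 1 s \<in> ?R" using unit local_ring_mult[OF S] sub by blast
      then show "y \<in> ?R" using a by simp
    qed
  qed
  ultimately show thesis using that unfolding Q_def by blast
qed

subsection \<open>Open sets\<close>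

lemma local_ring_mono: "P0 \<subseteq> P \<Longrightarrow> local_ring S P \<subseteq> local_ring S P0"
  unfolding local_ring_def by auto

lemma openin_basic_open:
  "S \<in> C \<Longrightarrow> f \<in> supported S \<Longrightarrow> openin (zariski C) (basic_open S f)"
  unfolding zariski_def
  by (intro topology_generated_by_Basis) auto

text \<open>On a basic open set of a chart \<open>T\<close>, the local ring at \<open>P0\<close> is
  a localization of the one at \<open>P\<close>, so it too is a local ring of \<open>T\<close>, and
  \<open>f\<close> stays invertible in it. Unions and finite intersections inherit the
  property.\<close>

lemma open_generization:
  assumes U: "openin (zariski C) U" and C: "\<And>T. T \<in> C \<Longrightarrow> is_submonoid T"
    and S: "is_submonoid S" and P: "P \<in> Spec S" "P0 \<in> Spec S" "P0 \<subseteq> P" and x: "local_ring S P \<in> U"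
  shows "local_ring S P0 \<in> U"
proof -
  have "generate_topology_on {basic_open S f | S f. S \<in> C \<and> f \<in> carrier (monoid_algebra S)} U"
    using U unfolding zariski_def by (rule openin_topology_generated_by)
  then show ?thesis using x
  proof induction
    case (Basis V)
    then obtain T f where T: "T \<in> C" and f: "f \<in> supported T" and V: "V = basic_open T f" by auto
    note Tm = C[OF T]
    obtain P' where P': "P' \<in> Spec T" "f \<notin> P'" and eq: "local_ring S P = local_ring T P'"
      using Basis(2) unfolding V basic_open_def by blast
    let ?R = "local_ring S P0"
    have mono: "local_ring T P' \<subseteq> ?R" unfolding eq[symmetric] using P(3) by (rule local_ring_mono)
    have sub: "Fract g 1 \<in> ?R" if "g \<in> supported T" for g
      using mono supported_in_local_ring[OF Tm P'(1) that] by blast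
    have frac: "\<exists>a\<in>supported T. \<exists>s\<in>supported T. s \<noteq> 0 \<and> y = Fract a s \<and> Fract 1 s \<in> ?R"
      if y: "y \<in> ?R" for y
    proof -
      obtain a s where a: "a \<in> supported S" "s \<in> supported S" "s \<notin> P0" "y = Fract a s"
        using y by (rule local_ringE)
      have snz: "s \<noteq> 0" using Spec_nonzero[OF S P(2)] a by blast
      have "Fract a 1 \<in> local_ring T P'" "Fract s 1 \<in> local_ring T P'"
        using supported_in_local_ring[OF S P(1)] a unfolding eq by blast+
      then obtain a1 t1 s1 t2 where t: "a1 \<in> supported T" "t1 \<in> supported T" "t1 \<notin> P'" "Fract a 1 = Fract a1 t1"
        "s1 \<in> supported T" "t2 \<in> supported T" "t2 \<notin> P'" "Fract s 1 = Fract s1 t2"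
        by (elim local_ringE) blast
      have tnz: "t1 \<noteq> 0" "t2 \<noteq> 0" using Spec_nonzero[OF Tm P'(1)] t by blast+
      \<comment> \<open>Clearing denominators: the new denominator \<open>t1 * s1\<close> equals
        \<open>t1 * s * t2\<close>, a product of units at \<open>P0\<close>.\<close>
      have e: "a * t1 = a1" "s * t2 = s1" using t tnz by (simp_all add: eq_fract)
      have "Fract 1 t1 \<in> ?R" "Fract 1 t2 \<in> ?R"
        using mono local_ringI[of 1 T _ P'] t supported_one[OF Tm] by blast+
      moreover have "Fract 1 s \<in> ?R" using a supported_one[OF S] by (intro local_ringI)
      ultimately have "Fract 1 t1 * (Fract 1 s * Fract 1 t2) \<in> ?R"
        using local_ring_mult[OF S P(2)] by blast
      moreover have "y = Fract (a1 * t2) (t1 * s1)"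
        unfolding a(4) e[symmetric] using tnz snz by (simp add: eq_fract mult_ac)
      moreover have "t1 * s1 \<noteq> 0" using e tnz snz by auto
      ultimately show ?thesis using t supported_mult[OF Tm] e by (intro bexI[of _ "a1 * t2"] bexI[of _ "t1 * s1"]) auto
    qed
    obtain Q where Q: "Q \<in> Spec T" "?R = local_ring T Q"
      "\<And>f. f \<in> supported T \<Longrightarrow> f \<in> Q \<longleftrightarrow> Fract f 1 \<in> maximal_ideal_of ?R"
      using local_ring_change_chart[OF S P(2) Tm sub frac] by blast
    have "Fract 1 f \<in> ?R" using mono local_ringI[of 1 T f P'] f P' supported_one[OF Tm] by blast
    moreover have "Fract f 1 * Fract 1 f = 1"
      using Spec_nonzero[OF Tm P'] by (simp add: One_fract_def eq_fract)
    ultimately have "f \<notin> Q" using Q(3)[OF f] unfolding maximal_ideal_of_def by blast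
    then show ?case using Q unfolding V basic_open_def by blast
  qed auto
qed

text \<open>If the ideal of denominators of \<open>x\<close> missed \<open>W\<close>, some prime
  containing it would avoid \<open>W\<close>; regularity there supplies a denominator outside this
  prime, a contradiction.\<close>

lemma fraction_of_regular:
  fixes x :: "('m::{ordered_cancel_comm_monoid_add, linorder}, 'k::field) function_field"
  assumes S: "is_submonoid S"
    and W: "W \<subseteq> supported S" "1 \<in> W" "0 \<notin> W" "\<And>x y. x \<in> W \<Longrightarrow> y \<in> W \<Longrightarrow> x * y \<in> W"
    and reg: "\<And>P. P \<in> Spec S \<Longrightarrow> P \<inter> W = {} \<Longrightarrow> x \<in> local_ring S P"
  obtains a w where "a \<in> supported S" "w \<in> W" "x = Fract a w"
proof -
  define D where "D = {d \<in> supported S. \<exists>a\<in>supported S. Fract d 1 * x = Fract a 1}"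
  have D: "is_ideal S D"
    unfolding is_ideal_def
  proof (intro conjI ballI)
    show "D \<subseteq> supported S" unfolding D_def by blast
    have "Fract 0 1 * x = Fract 0 1" by (simp add: fract_collapse)
    then show "0 \<in> D" unfolding D_def by (auto intro!: bexI[of _ 0])
    fix f g assume "f \<in> D" "g \<in> D"
    then obtain a b where ab: "f \<in> supported S" "g \<in> supported S" "a \<in> supported S" "b \<in> supported S"
      "Fract f 1 * x = Fract a 1" "Fract g 1 * x = Fract b 1" unfolding D_def by blast
    have "Fract (f + g) 1 = Fract f 1 + Fract g 1" by simp
    then have "Fract (f + g) 1 * x = Fract a 1 + Fract b 1" using ab by (simp only: distrib_right)
    then have "Fract (f + g) 1 * x = Fract (a + b) 1" by simp
    then show "f + g \<in> D" unfolding D_def using ab supported_add by blast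
  next
    fix f g :: "'m \<Rightarrow>\<^sub>0 'k" assume f: "f \<in> supported S" and "g \<in> D"
    then obtain b where b: "g \<in> supported S" "b \<in> supported S" "Fract g 1 * x = Fract b 1" unfolding D_def by blast
    have "Fract (f * g) 1 = Fract f 1 * Fract g 1" by simp
    then have "Fract (f * g) 1 * x = Fract f 1 * Fract b 1" using b by (simp only: mult.assoc)
    then have "Fract (f * g) 1 * x = Fract (f * b) 1" by simp
    then show "f * g \<in> D" unfolding D_def using f b supported_mult[OF S] by blast
  qed
  have "D \<inter> W \<noteq> {}"
  proof
    assume "D \<inter> W = {}"
    then obtain P where P: "P \<in> Spec S" "D \<subseteq> P" "P \<inter> W = {}"
      using ex_prime_avoiding[OF S D _ W(1,2,4)] by blast
    then obtain a s where a: "a \<in> supported S" "s \<in> supported S" "s \<notin> P" "x = Fract a s"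
      using reg by (meson local_ringE)
    have "Fract s 1 * x = Fract a 1" using Spec_nonzero[OF S P(1) a(3)] by (simp add: a(4) eq_fract mult.commute)
    then have "s \<in> D" unfolding D_def using a by blast
    then show False using P a by blast
  qed
  then obtain w a where w: "w \<in> W" "a \<in> supported S" "Fract w 1 * x = Fract a 1" unfolding D_def by blast
  have wnz: "w \<noteq> 0" using w W(3) by blast
  have "Fract 1 w * Fract w 1 = 1" using wnz by (simp add: eq_fract One_fract_def)
  then have "x = (Fract 1 w * Fract w 1) * x" by simp
  also have "\<dots> = Fract 1 w * Fract a 1" using w(3) by (simp only: mult.assoc)
  finally have "x = Fract a w" by simp
  then show thesis using that w by blast
qed

subsection \<open>Pullbacks along monomial maps\<close>

lemma Spec_comap:
  fixes h :: "'n::{ordered_cancel_comm_monoid_add, linorder} \<Rightarrow> 'm::{ordered_cancel_comm_monoid_add, linorder}"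
    and P :: "('m \<Rightarrow>\<^sub>0 'k::field) set"
  assumes S: "is_submonoid S" and T: "is_submonoid T"
    and h: "h 0 = 0" "\<And>x y. h (x + y) = h x + h y" "\<And>x. x \<in> T \<Longrightarrow> h x \<in> S"
    and P: "P \<in> Spec S"
  shows "{f \<in> supported T. algebra_map h f \<in> P} \<in> Spec T"
proof -
  have supp: "algebra_map h f \<in> supported S" if "f \<in> supported T" for f :: "'n \<Rightarrow>\<^sub>0 'k"
    using keys_algebra_map[of h f] that h(3) unfolding supported_def by blast
  note I = SpecD(1)[OF S P]
  show ?thesis
    unfolding Spec_iff[OF T] is_ideal_def
    using is_idealD(2,3,4)[OF I] SpecD(2,3)[OF S P] supp
    by (auto simp: algebra_map_add algebra_map_mult[OF h(2)] algebra_map_one[of h, OF h(1)]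
        intro: supported_add supported_mult[OF T])
qed

lemma scale_Suc: "scale (Suc q) m = scale q m + m"
  by (simp add: scale_def)

lemma scale_zero [simp]: "scale q 0 = 0"
  by (simp add: scale_def)

lemma scale_add: "scale q (x + y) = scale q x + scale q y"
  by (simp add: scale_def sum.distrib)

lemma scale_strict_mono:
  fixes x y :: "'m::{ordered_cancel_comm_monoid_add, linorder}"
  assumes "x < y" "q > 0"
  shows "scale q x < scale q y"
proof -
  have "scale (Suc n) x < scale (Suc n) y" for n
  proof (induction n)
    case 0
    then show ?case using assms by (simp add: scale_def)
  next
    case (Suc n)
    then show ?case using add_strict_mono[OF Suc assms(1)] by (simp only: scale_Suc[of "Suc n"])
  qed
  then show ?thesis using assms(2) by (metis Suc_pred)
qed

lemma inj_scale:
  assumes "q > 0"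
  shows "inj (scale q :: 'm::{ordered_cancel_comm_monoid_add, linorder} \<Rightarrow> 'm)"
  by (rule injI) (metis assms scale_strict_mono less_irrefl linorder_less_linear)

lemma scale_in_submonoid:
  assumes "is_submonoid S" "m \<in> S"
  shows "scale q m \<in> S"
  by (induction q) (use assms in \<open>auto simp: is_submonoid_def scale_Suc scale_def\<close>)

lemma F_pullback_Fract:
  assumes "q > 0" "b \<noteq> 0"
  shows "F_pullback q (Fract a b) = Fract (algebra_map (scale q) a) (algebra_map (scale q) b)"
  unfolding F_pullback_def using assms by (intro function_field_map_Fract scale_add inj_scale)

lemma lookup_single_mult:
  fixes m i :: "'m::{comm_monoid_add, cancel_ab_semigroup_add}" and f :: "'m \<Rightarrow>\<^sub>0 'k::comm_ring_1"
  shows "Poly_Mapping.lookup (Poly_Mapping.single m c * f) (m + i) = c * Poly_Mapping.lookup f i"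
proof (rule additive_eq_on_monomials[where f = f and
      \<phi> = "\<lambda>f. Poly_Mapping.lookup (Poly_Mapping.single m c * f) (m + i)" and \<psi> = "\<lambda>f. c * Poly_Mapping.lookup f i"])
qed (simp_all add: distrib_left lookup_add mult_single lookup_single when_def)

text \<open>If every monomial of the denominator \<open>s\<close> lay in \<open>P\<close>, so would
  \<open>s\<close>. For an exponent \<open>i\<close> of \<open>s\<close> whose monomial is outside
  \<open>P\<close>, comparing coefficients in \<open>single m 1 * s = a\<close> gives
  \<open>m + i \<in> S\<close>, so the denominator can be taken monomial.\<close>

lemma monomial_in_local_ring:
  fixes P :: "('m::{ordered_cancel_comm_monoid_add, linorder} \<Rightarrow>\<^sub>0 'k::field) set"
  assumes S: "is_submonoid S" "P \<in> Spec S" and m: "Fract (Poly_Mapping.single m 1) 1 \<in> local_ring S P"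
  obtains i where "i \<in> S" "Poly_Mapping.single i 1 \<notin> P" "i + m \<in> S"
proof -
  note I = SpecD(1)[OF S]
  obtain a s where a: "a \<in> supported S" "s \<in> supported S" "s \<notin> P" "Fract (Poly_Mapping.single m 1) 1 = Fract a s"
    using m by (rule local_ringE)
  have "\<exists>i\<in>Poly_Mapping.keys s. Poly_Mapping.single i 1 \<notin> P"
  proof (rule ccontr)
    assume n: "\<not> ?thesis"
    have "s \<in> P"
    proof (rule poly_mapping_monomial_induct[OF order_refl, of "\<lambda>f. f \<in> P"])
      fix i and c :: 'k assume i: "i \<in> Poly_Mapping.keys s"
      have "Poly_Mapping.single 0 c * Poly_Mapping.single i 1 \<in> P"
        using n i S(1) by (intro is_idealD(4)[OF I] supported_single) (auto simp: is_submonoid_def)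
      then show "Poly_Mapping.single i c \<in> P" by (simp add: mult_single)
    qed (use is_idealD[OF I] in auto)
    then show False using a by blast
  qed
  then obtain i where i: "i \<in> Poly_Mapping.keys s" "Poly_Mapping.single i 1 \<notin> P" by blast
  have "Poly_Mapping.single m 1 * s = a"
    using a(4) Spec_nonzero[OF S a(3)] by (simp add: eq_fract)
  then have "Poly_Mapping.lookup a (m + i) = Poly_Mapping.lookup s i"
    using lookup_single_mult[of m 1 s i] by simp
  then have "m + i \<in> Poly_Mapping.keys a" using i by (simp add: in_keys_iff)
  then show thesis using that i a unfolding supported_def by (auto simp: add.commute)
qed

text \<open>A point \<open>P\<close> of the preimage maps to a prime \<open>P'\<close> at which the
  monomials of \<open>S\<close> are regular. Their monomial denominators avoid \<open>P'\<close>, so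
  the \<open>q\<close>-th powers of these avoid \<open>P\<close>, hence so do the denominators
  themselves, and the monomials are regular at \<open>P\<close>.\<close>

lemma chart_regular_on_F_preimage:
  fixes f :: "'m::{ordered_cancel_comm_monoid_add, linorder} \<Rightarrow>\<^sub>0 'k::field"
  assumes C: "\<And>T. T \<in> C \<Longrightarrow> is_submonoid T" and S: "S \<in> C" and q: "q > 0" and f: "f \<in> supported S"
  shows "Fract f 1 \<in> sections (F_preimage q C (basic_open S 1))"
  unfolding sections_def
proof
  fix y :: "('m, 'k) point" assume "y \<in> F_preimage q C (basic_open S 1)"
  then obtain T P where T: "T \<in> C" and P: "P \<in> Spec T" and y: "y = local_ring T P"
    and "local_ring T {f \<in> supported T. algebra_map (scale q) f \<in> P} \<in> basic_open S 1"
    unfolding F_preimage_def by auto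
  moreover define P' where "P' = {f \<in> supported T. algebra_map (scale q) f \<in> P}"
  ultimately obtain Q where Q: "Q \<in> Spec S" "local_ring T P' = local_ring S Q"
    unfolding basic_open_def by blast
  note Tm = C[OF T] and Sm = C[OF S]
  have P': "P' \<in> Spec T" unfolding P'_def
    using Tm scale_in_submonoid by (intro Spec_comap[OF Tm Tm _ _ _ P]) (auto simp: scale_add)
  from f show "Fract f 1 \<in> y"
    unfolding supported_def mem_Collect_eq
  proof (induction f rule: poly_mapping_monomial_induct)
    case zero
    show ?case unfolding y using supported_in_local_ring[OF Tm P] by simp
  next
    case (monomial m c)
    have "Fract (Poly_Mapping.single m 1) 1 \<in> local_ring T P'"
      unfolding Q(2) using monomial by (intro supported_in_local_ring[OF Sm Q(1)] supported_single)
    then obtain i where i: "i \<in> T" "Poly_Mapping.single i 1 \<notin> P'" "i + m \<in> T"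
      by (rule monomial_in_local_ring[OF Tm P'])
    have "Poly_Mapping.single i 1 \<notin> P"
    proof
      assume "Poly_Mapping.single i 1 \<in> P"
      then have "Poly_Mapping.single (scale (q - 1) i) 1 * Poly_Mapping.single i 1 \<in> P"
        using i scale_in_submonoid[OF Tm] by (intro is_idealD(4)[OF SpecD(1)[OF Tm P]] supported_single)
      moreover have "scale (q - 1) i + i = scale q i" using q scale_Suc[of "q - 1" i] by simp
      ultimately show False using i by (simp add: P'_def mult_single algebra_map_single supported_single)
    qed
    then have "Fract (Poly_Mapping.single (i + m) c) (Poly_Mapping.single i 1) \<in> y"
      unfolding y using i by (intro local_ringI supported_single)
    moreover have "Poly_Mapping.single i 1 \<noteq> (0 :: 'm \<Rightarrow>\<^sub>0 'k)"
      by (metis lookup_single_eq lookup_zero zero_neq_one)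
    then have "Fract (Poly_Mapping.single (i + m) c) (Poly_Mapping.single i 1) = Fract (Poly_Mapping.single m c) 1"
      by (simp add: eq_fract mult_single add.commute)
    ultimately show ?case by simp
  next
    case (add g h)
    then show ?case using local_ring_add[OF Tm P, of "Fract g 1" "Fract h 1"] unfolding y by simp
  qed
qed

section \<open>Splittings\<close>

subsection \<open>Splittings and monomial valuations\<close>

text \<open>For the order \<open>l\<close> belonging to a ray this is the generic point of the
  boundary divisor of the half-space chart \<open>l \<ge> 0\<close>.\<close>

definition valuation_prime :: "('m \<Rightarrow> int) \<Rightarrow> ('m \<Rightarrow>\<^sub>0 'k::field) set" where
  "valuation_prime l = {f. \<forall>m\<in>Poly_Mapping.keys f. 0 < l m}"

text \<open>Discarding the exponents with \<open>l > 0\<close> reduces modulo the ideal to functions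
  with exponents in the kernel of \<open>l\<close>, and there are no zero divisors among
  those.\<close>

lemma valuation_prime_in_Spec:
  fixes l :: "'m::{ordered_cancel_comm_monoid_add, linorder} \<Rightarrow> int"
  assumes l: "l 0 = 0" "\<And>x y. l (x + y) = l x + l y"
  shows "(valuation_prime l :: ('m \<Rightarrow>\<^sub>0 'k::field) set) \<in> Spec {x. 0 \<le> l x}"
proof -
  let ?S = "{x. 0 \<le> l x}" and ?P = "valuation_prime l :: ('m \<Rightarrow>\<^sub>0 'k::field) set"
  have S: "is_submonoid ?S" by (simp add: is_submonoid_def l)
  have mult: "f * g \<in> ?P" if f: "f \<in> supported ?S" and g: "g \<in> ?P" for f g
    unfolding valuation_prime_def
  proof (intro CollectI ballI)
    fix m assume "m \<in> Poly_Mapping.keys (f * g)"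
    then obtain a b where "m = a + b" "a \<in> Poly_Mapping.keys f" "b \<in> Poly_Mapping.keys g"
      using keys_mult[of f g] by blast
    then show "0 < l m" using f g by (auto simp: l supported_def valuation_prime_def intro: add_nonneg_pos)
  qed
  have add: "f + g \<in> ?P" if "f \<in> ?P" "g \<in> ?P" for f g
    using that Poly_Mapping.keys_add[of f g] unfolding valuation_prime_def by blast
  have neg: "- f \<in> ?P" if "f \<in> ?P" for f
    using that by (auto simp: valuation_prime_def in_keys_iff)
  define r :: "('m \<Rightarrow>\<^sub>0 'k) \<Rightarrow> ('m \<Rightarrow>\<^sub>0 'k)" where
    "r = linear_extension (\<lambda>m. if l m = 0 then Poly_Mapping.single m 1 else 0)"
  have lookup_r: "Poly_Mapping.lookup (r f) m = (if l m = 0 then Poly_Mapping.lookup f m else 0)" for f m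
    by (rule additive_eq_on_monomials[where \<phi> = "\<lambda>f. Poly_Mapping.lookup (r f) m"
          and \<psi> = "\<lambda>f. if l m = 0 then Poly_Mapping.lookup f m else 0"])
      (auto simp: r_def linear_extension_add lookup_add linear_extension_single mult_single lookup_single when_def)
  have diff: "f - r f \<in> ?P" if f: "f \<in> supported ?S" for f
    unfolding valuation_prime_def
  proof (intro CollectI ballI)
    fix m assume "m \<in> Poly_Mapping.keys (f - r f)"
    then have "l m \<noteq> 0 \<and> m \<in> Poly_Mapping.keys f"
      by (auto simp: in_keys_iff lookup_minus lookup_r split: if_splits)
    moreover from this have "0 \<le> l m" using f unfolding supported_def by blast
    ultimately show "0 < l m" by simp
  qed
  have r_supp: "r f \<in> supported ?S" for f
    by (auto simp: supported_def in_keys_iff lookup_r split: if_splits)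
  have r_zero: "f \<in> ?P" if "f \<in> supported ?S" "r f = 0" for f
    using diff[OF that(1)] that(2) by simp
  have "f \<in> ?P \<or> g \<in> ?P" if fg: "f \<in> supported ?S" "g \<in> supported ?S" "f * g \<in> ?P" for f g
  proof -
    have "r f * r g = f * g + (- (g * (f - r f)) + - (r f * (g - r g)))" by (simp add: algebra_simps)
    also have "\<dots> \<in> ?P"
      by (rule add[OF fg(3) add[OF neg[OF mult[OF fg(2) diff[OF fg(1)]]] neg[OF mult[OF r_supp diff[OF fg(2)]]]]])
    finally have P: "r f * r g \<in> ?P" .
    have "Poly_Mapping.keys (r f * r g) = {}"
    proof (rule ccontr)
      assume "Poly_Mapping.keys (r f * r g) \<noteq> {}"
      then obtain m where m: "m \<in> Poly_Mapping.keys (r f * r g)" by blast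
      then obtain a b where "m = a + b" "a \<in> Poly_Mapping.keys (r f)" "b \<in> Poly_Mapping.keys (r g)"
        using keys_mult[of "r f" "r g"] by blast
      then have "l m = 0" by (auto simp: in_keys_iff lookup_r l split: if_splits)
      then show False using P m by (auto simp: valuation_prime_def)
    qed
    then have "r f * r g = 0" by (metis emptyE in_keys_iff lookup_zero poly_mapping_eqI)
    then have "r f = 0 \<or> r g = 0" by simp
    then show ?thesis using r_zero fg by blast
  qed
  moreover have "is_ideal ?S ?P"
    unfolding is_ideal_def
  proof (intro conjI ballI)
    show "?P \<subseteq> supported ?S"
      unfolding valuation_prime_def supported_def by (intro Collect_mono impI subsetI) (simp add: less_imp_le)
    show "0 \<in> ?P" by (simp add: valuation_prime_def)
  qed (simp_all add: add mult)
  moreover have "1 \<notin> ?P" by (simp add: valuation_prime_def l)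
  ultimately show ?thesis unfolding Spec_iff[OF S] by blast
qed

text \<open>A monomial shift brings the lowest order of \<open>g\<close> to exactly 0, which keeps
  the shifted function out of the prime. If that order was negative, the shifting monomial lies in
  the prime, and regularity of \<open>g\<close> puts the shifted function there too.\<close>

lemma halfspace_supported_of_regular:
  fixes l :: "'m::{ordered_cancel_comm_monoid_add, linorder} \<Rightarrow> int" and g :: "'m \<Rightarrow>\<^sub>0 'k::field"
  assumes l: "l 0 = 0" "\<And>x y. l (x + y) = l x + l y" "surj l"
    and g: "Fract g 1 \<in> sections (basic_open {x. 0 \<le> l x} 1)"
  shows "g \<in> supported {x. 0 \<le> l x}"
proof (rule ccontr)
  let ?S = "{x. 0 \<le> l x}" and ?P = "valuation_prime l :: ('m \<Rightarrow>\<^sub>0 'k::field) set"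
  have S: "is_submonoid ?S" by (simp add: is_submonoid_def l)
  have P: "?P \<in> Spec ?S" using l(1,2) by (rule valuation_prime_in_Spec)
  assume "g \<notin> supported ?S"
  then obtain m0 where m0: "m0 \<in> Poly_Mapping.keys g" "l m0 < 0"
    by (auto simp: supported_def subset_iff not_le)
  define n where "n = Min (l ` Poly_Mapping.keys g)"
  have n: "n \<le> l m" if "m \<in> Poly_Mapping.keys g" for m using that unfolding n_def by simp
  have "n \<in> l ` Poly_Mapping.keys g" unfolding n_def using m0 by (intro Min_in) auto
  then obtain m1 where m1: "m1 \<in> Poly_Mapping.keys g" "l m1 = n" by blast
  obtain c where c: "l c = - n" using l(3) by (metis surjD)
  have nneg: "n < 0" using n[OF m0(1)] m0(2) by linarith
  let ?g = "Poly_Mapping.single c 1 * g"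
  have "?g \<in> supported ?S"
    unfolding supported_def
  proof (intro CollectI subsetI)
    fix m assume "m \<in> Poly_Mapping.keys ?g"
    then obtain b where "m = c + b" "b \<in> Poly_Mapping.keys g"
      using keys_mult[of "Poly_Mapping.single c 1" g] by auto
    then show "0 \<le> l m" using n c l(2) by simp
  qed
  moreover have "c + m1 \<in> Poly_Mapping.keys ?g"
    using m1 lookup_single_mult[of c 1 g m1] by (simp add: in_keys_iff)
  then have "?g \<notin> ?P" using m1 c l(2) by (force simp: valuation_prime_def)
  moreover have "Fract g 1 \<in> local_ring ?S ?P"
    using g P SpecD(2)[OF S P] unfolding sections_def basic_open_def by blast
  then obtain a s where a: "a \<in> supported ?S" "s \<in> supported ?S" "s \<notin> ?P" "Fract g 1 = Fract a s"
    by (rule local_ringE)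
  have "g * s = a" using a(4) Spec_nonzero[OF S P a(3)] by (simp add: eq_fract)
  then have gs: "?g * s = a * Poly_Mapping.single c 1" by (metis mult.assoc mult.commute)
  moreover have "(Poly_Mapping.single c 1 :: 'm \<Rightarrow>\<^sub>0 'k) \<in> ?P" using c nneg by (simp add: valuation_prime_def)
  then have "a * Poly_Mapping.single c 1 \<in> ?P" using is_idealD(4)[OF SpecD(1)[OF S P]] a by blast
  then have "?g * s \<in> ?P" unfolding gs .
  ultimately show False using SpecD(3)[OF S P, of ?g s] a(2,3) by blast
qed

text \<open>Multiplying numerator and denominator by a monomial of large order moves a fraction over
  the torus ring into the half-space chart, and the monomial is invertible on the torus.\<close>

lemma torus_subset_halfspace_chart:
  fixes l :: "'m::{ordered_cancel_comm_monoid_add, linorder, ab_group_add} \<Rightarrow> int"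
  assumes l: "l 0 = 0" "\<And>x y. l (x + y) = l x + l y" "surj l"
  shows "(basic_open UNIV 1 :: ('m, 'k::field) point set) \<subseteq> basic_open {x. 0 \<le> l x} 1"
proof
  let ?S = "{x. 0 \<le> l x}"
  have S: "is_submonoid ?S" and U: "is_submonoid (UNIV :: 'm set)" by (simp_all add: is_submonoid_def l)
  fix y :: "('m, 'k) point" assume "y \<in> basic_open UNIV 1"
  then obtain P where P: "P \<in> Spec UNIV" "y = local_ring UNIV P" unfolding basic_open_def by blast
  have frac: "\<exists>a\<in>supported ?S. \<exists>s\<in>supported ?S. s \<noteq> 0 \<and> x = Fract a s \<and> Fract 1 s \<in> local_ring UNIV P"
    if x: "x \<in> local_ring UNIV P" for x
  proof -
    obtain a s where a: "s \<notin> P" "x = Fract a s" using x by (rule local_ringE)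
    have snz: "s \<noteq> 0" using Spec_nonzero[OF U P(1) a(1)] .
    let ?K = "Poly_Mapping.keys a \<union> Poly_Mapping.keys s"
    \<comment> \<open>The sum dominates each \<open>\<bar>l m\<bar>\<close>, so shifting by
      \<open>c\<close> makes all orders nonnegative.\<close>
    obtain c where c: "l c = (\<Sum>m\<in>?K. \<bar>l m\<bar>)" using l(3) by (metis surjD)
    have pos: "0 \<le> l c + l m" if "m \<in> ?K" for m
    proof -
      have "\<bar>l m\<bar> \<le> l c" unfolding c using that by (intro member_le_sum) auto
      then show ?thesis by linarith
    qed
    let ?c = "Poly_Mapping.single c 1 :: 'm \<Rightarrow>\<^sub>0 'k"
    have supp: "?c * f \<in> supported ?S" if f: "Poly_Mapping.keys f \<subseteq> ?K" for f
      unfolding supported_def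
    proof (intro CollectI subsetI)
      fix m assume "m \<in> Poly_Mapping.keys (?c * f)"
      then obtain b where "m = c + b" "b \<in> Poly_Mapping.keys f" using keys_mult[of ?c f] by auto
      then show "0 \<le> l m" using pos f l(2) by auto
    qed
    have unit: "?c * Poly_Mapping.single (- c) 1 = 1" by (simp add: mult_single)
    then have cnz: "?c \<noteq> 0" by auto
    have "Fract (Poly_Mapping.single (- c) 1) s \<in> local_ring UNIV P" using a(1) by (intro local_ringI) simp_all
    moreover have "Fract (Poly_Mapping.single (- c) 1) s = Fract 1 (?c * s)"
    proof -
      have "Poly_Mapping.single (- c) 1 * (?c * s) = (?c * Poly_Mapping.single (- c) 1) * s" by (simp only: mult_ac)
      then show ?thesis using snz cnz unit by (simp add: eq_fract)
    qed
    moreover have "x = Fract (?c * a) (?c * s)" using a(2) snz cnz by (simp add: eq_fract mult_ac)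
    ultimately show ?thesis
      using supp[of a] supp[of s] snz cnz by (intro bexI[of _ "?c * a"] bexI[of _ "?c * s"]) auto
  qed
  obtain Q where "Q \<in> Spec ?S" "local_ring UNIV P = local_ring ?S Q"
    using local_ring_change_chart[OF U P(1) S supported_in_local_ring[OF U P(1) supported_UNIV] frac] by blast
  then show "y \<in> basic_open ?S 1" using SpecD(2)[OF S] P(2) unfolding basic_open_def by blast
qed

lemma torus_section_polynomial:
  fixes x :: "('m::{ordered_cancel_comm_monoid_add, linorder}, 'k::field) function_field"
  assumes "x \<in> sections (basic_open UNIV 1)"
  obtains g where "x = Fract g 1"
proof -
  have U: "is_submonoid (UNIV :: 'm set)" by (simp add: is_submonoid_def)
  have "x \<in> local_ring UNIV P" if "P \<in> Spec UNIV" for P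
    using assms that SpecD(2)[OF U that] unfolding sections_def basic_open_def by blast
  then show thesis using fraction_of_regular[OF U, of "{1}" x] that by auto
qed

lemma nonempty_open_chart:
  assumes "S \<in> C" "is_submonoid S"
  shows "nonempty_open C (basic_open S 1)"
  unfolding nonempty_open_def
  using openin_basic_open[OF assms(1) supported_one[OF assms(2)]] zero_in_Spec[OF assms(2)]
  by (auto simp: basic_open_def)

text \<open>Multiplying \<open>\<chi>\<^sup>e\<close> by a \<open>q\<close>-th power brings \<open>l e\<close> into \<open>{0..<q}\<close>; it is then regular on the chart
  \<open>l \<ge> 0\<close>, hence so is its image.\<close>

lemma splitting_valuation_bound:
  fixes l :: "'m::{ordered_cancel_comm_monoid_add, linorder, ab_group_add} \<Rightarrow> int"
    and g :: "'m \<Rightarrow>\<^sub>0 'k::field"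
  assumes l: "l 0 = 0" "\<And>x y. l (x + y) = l x + l y" "surj l"
    and C: "\<And>S. S \<in> C \<Longrightarrow> is_submonoid S" "UNIV \<in> C" "{x. 0 \<le> l x} \<in> C"
    and \<pi>: "is_module_map q C \<pi>" and q: "q > 0"
    and g: "\<pi> (basic_open UNIV 1) (Fract (Poly_Mapping.single e 1) 1) = Fract g 1"
    and w: "w \<in> Poly_Mapping.keys g"
  shows "- int q < int q * l w - l e"
proof -
  let ?S = "{x. 0 \<le> l x}"
  let ?T = "basic_open UNIV 1 :: ('m, 'k) point set" and ?U = "basic_open ?S 1 :: ('m, 'k) point set"
  \<comment> \<open>With this \<open>c\<close> the shifted exponent \<open>scale q c + e\<close> has
    order \<open>l e mod int q\<close>.\<close>
  obtain c where c: "l c = - (l e div int q)" using l(3) by (metis surjD)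
  have scale: "l (scale n c) = int n * l c" for n
    by (induction n) (simp_all add: scale_def l algebra_simps)
  have e': "l (scale q c + e) = l e mod int q"
    using minus_mult_div_eq_mod[of "l e" "int q"] by (simp add: l scale c)
  let ?f = "Poly_Mapping.single (scale q c + e) 1 :: 'm \<Rightarrow>\<^sub>0 'k" and ?c = "Poly_Mapping.single c 1 :: 'm \<Rightarrow>\<^sub>0 'k"
  have U: "is_submonoid (UNIV :: 'm set)" by (simp add: is_submonoid_def)
  have opT: "nonempty_open C ?T" and opU: "nonempty_open C ?U" using nonempty_open_chart C by blast+
  have mod: "\<And>b. b \<in> sections (F_preimage q C ?U) \<Longrightarrow> \<pi> ?U b \<in> sections ?U \<and> \<pi> ?T b = \<pi> ?U b"
    "\<And>a b. a \<in> sections ?T \<Longrightarrow> b \<in> sections (F_preimage q C ?T) \<Longrightarrow> \<pi> ?T (F_pullback q a * b) = a * \<pi> ?T b"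
    using \<pi> opT opU torus_subset_halfspace_chart[OF l] unfolding is_module_map_def by blast+
  have "Fract ?c 1 \<in> sections ?T"
    using supported_in_local_ring[OF U] unfolding sections_def basic_open_def by auto
  moreover have "Fract (Poly_Mapping.single e 1) 1 \<in> sections (F_preimage q C ?T)"
    using C(1,2) q by (intro chart_regular_on_F_preimage) auto
  moreover have "F_pullback q (Fract ?c 1) * Fract (Poly_Mapping.single e 1) 1 = Fract ?f 1"
    using q by (simp add: F_pullback_Fract algebra_map_single algebra_map_one mult_single)
  ultimately have "\<pi> ?T (Fract ?f 1) = Fract (?c * g) 1"
    using mod(2)[of "Fract ?c 1" "Fract (Poly_Mapping.single e 1) 1"] g by simp
  moreover have "?f \<in> supported ?S" using e' q by (intro supported_single) simp
  then have "Fract ?f 1 \<in> sections (F_preimage q C ?U)"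
    using C(1,3) q by (intro chart_regular_on_F_preimage) auto
  ultimately have "Fract (?c * g) 1 \<in> sections ?U" using mod(1) by metis
  then have "?c * g \<in> supported ?S" by (rule halfspace_supported_of_regular[OF l])
  moreover have "c + w \<in> Poly_Mapping.keys (?c * g)"
    using w lookup_single_mult[of c 1 g w] by (simp add: in_keys_iff)
  ultimately have "0 \<le> l (c + w)" unfolding supported_def by blast
  then have "0 \<le> l c + l w" by (simp add: l)
  \<comment> \<open>Combined with \<open>q * l c + l e = l e mod q < q\<close>, nonnegativity
    becomes the strict bound.\<close>
  then have "0 \<le> int q * (l c + l w)" by simp
  moreover have "int q * l c + l e < int q"
    using e' q by (simp add: l scale)
  ultimately show ?thesis by (simp add: distrib_left)
qed

subsection \<open>Diagonal splittings force lattice points\<close>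

lemma pairing_zero_left: "pairing 0 v = 0"
  by (simp add: pairing_def)

lemma pairing_add_left: "pairing (m + m') v = pairing m v + pairing m' v"
  by (simp add: pairing_def distrib_right)

lemma is_submonoid_dual_monoid: "is_submonoid (dual_monoid \<sigma>)"
  by (auto simp: is_submonoid_def dual_monoid_def pairing_add_left pairing_zero_left)

lemma is_submonoid_product_chart:
  assumes "S \<in> product_charts (toric_charts \<Sigma>)"
  shows "is_submonoid S"
proof -
  obtain \<sigma> \<tau> where S: "S = dual_monoid \<sigma> \<times> dual_monoid \<tau>"
    using assms unfolding product_charts_def toric_charts_def by blast
  show ?thesis
    using is_submonoid_dual_monoid[of \<sigma>] is_submonoid_dual_monoid[of \<tau>]
    unfolding S is_submonoid_def by (auto simp: zero_prod_def)
qed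

lemma UNIV_in_toric_charts:
  assumes "complete_fan \<Sigma>"
  shows "UNIV \<in> toric_charts \<Sigma>"
proof -
  have "dual_monoid {0} = UNIV" by (simp add: dual_monoid_def pairing_def)
  then show ?thesis using complete_fan_zero_cone[OF assms] unfolding toric_charts_def by (metis image_eqI)
qed

lemma sum_map_hom:
  "(\<lambda>(m, m'). m + m') 0 = (0 :: int \<times> int)"
  "(\<lambda>(m, m'). m + m') (x + y) = (\<lambda>(m, m'). m + m') x + ((\<lambda>(m, m'). m + m') y :: int \<times> int)"
  by (auto simp: case_prod_beta)

lemma dot_uminus: "dot (- m) p = - dot m p"
  by (simp add: dot_def)

lemma diagonally_split_imp_fractionally_covered:
  assumes \<Sigma>: "complete_fan \<Sigma>" and split: "diagonally_split TYPE('k::field) \<Sigma> q" and q: "q > 0"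
  shows "fractionally_covered (rays \<Sigma>) q"
  unfolding fractionally_covered_def
proof
  fix a :: "int \<times> int"
  let ?C = "product_charts (toric_charts \<Sigma>)"
  let ?sum = "\<lambda>(m, m'). m + m' :: int \<times> int"
  let ?T = "basic_open UNIV 1 :: ((int \<times> int) \<times> (int \<times> int), 'k) point set"
  let ?one = "1 :: (int \<times> int) \<times> (int \<times> int) \<Rightarrow>\<^sub>0 'k"
  obtain \<pi> :: "((int \<times> int) \<times> (int \<times> int), 'k) point set
           \<Rightarrow> ((int \<times> int) \<times> (int \<times> int), 'k) function_field
           \<Rightarrow> ((int \<times> int) \<times> (int \<times> int), 'k) function_field"
    where \<pi>: "is_splitting q ?C \<pi>" "compatible_with q ?C \<pi> (diagonal (toric_charts \<Sigma>))"
    using split unfolding diagonally_split_def by blast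
  have \<pi>m: "is_module_map q ?C \<pi>" using \<pi>(1) unfolding is_splitting_def by blast
  have C: "is_submonoid S" if "S \<in> ?C" for S using that by (rule is_submonoid_product_chart)
  have UC1: "UNIV \<in> toric_charts \<Sigma>" using \<Sigma> by (rule UNIV_in_toric_charts)
  have UC: "UNIV \<in> ?C" unfolding product_charts_def using UC1 UNIV_Times_UNIV by blast
  have U: "is_submonoid (UNIV :: ((int \<times> int) \<times> (int \<times> int)) set)" "is_submonoid (UNIV :: (int \<times> int) set)"
    by (simp_all add: is_submonoid_def)
  have op: "nonempty_open ?C ?T" using nonempty_open_chart UC U(1) by blast
  have reg: "Fract f 1 \<in> sections (F_preimage q ?C ?T)" for f
    using C UC q by (intro chart_regular_on_F_preimage) auto
  have mod: "\<And>b. b \<in> sections (F_preimage q ?C ?T) \<Longrightarrow> \<pi> ?T b \<in> sections ?T"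
    "\<And>b c. b \<in> sections (F_preimage q ?C ?T) \<Longrightarrow> c \<in> sections (F_preimage q ?C ?T) \<Longrightarrow>
       \<pi> ?T (b + c) = \<pi> ?T b + \<pi> ?T c"
    using \<pi>m op unfolding is_module_map_def by blast+
  \<comment> \<open>A character that is trivial on the diagonal, so its image must restrict to 1
    there.\<close>
  let ?f = "Poly_Mapping.single (a, - a) 1 :: (int \<times> int) \<times> (int \<times> int) \<Rightarrow>\<^sub>0 'k"
  obtain g where g: "\<pi> ?T (Fract ?f 1) = Fract g 1"
    using torus_section_polynomial[OF mod(1)[OF reg]] .
  have "Fract ?one 1 \<in> sections ?T"
    using supported_in_local_ring[OF U(1)] unfolding sections_def basic_open_def by auto
  then have "\<pi> ?T (F_pullback q (Fract ?one 1)) = Fract ?one 1"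
    using \<pi>(1) op unfolding is_splitting_def by blast
  then have one: "\<pi> ?T (Fract ?one 1) = Fract ?one 1"
    using q by (simp add: F_pullback_Fract algebra_map_one)
  have "Fract ?f 1 = Fract (?f - 1) 1 + Fract ?one 1" by simp
  then have "Fract g 1 = \<pi> ?T (Fract (?f - 1) 1) + Fract ?one 1"
    using mod(2)[OF reg reg, of "?f - 1" 1] one g by metis
  then have image: "\<pi> ?T (Fract (?f - 1) 1) = Fract (g - 1) 1"
    by (metis (no_types, lifting) add_diff_cancel_right' diff_fract mult_1 mult.right_neutral one_neq_zero)
  have diag: "Fract (?f - 1) 1 \<in> ideal_sheaf (diagonal (toric_charts \<Sigma>)) (F_preimage q ?C ?T)"
    unfolding ideal_sheaf_def
  proof (intro CollectI conjI ballI reg)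
    fix x assume x: "x \<in> F_preimage q ?C ?T \<inter> diagonal (toric_charts \<Sigma>)"
    then obtain S P where S: "S \<in> toric_charts \<Sigma>" and P: "P \<in> Spec S"
      and x_eq: "x = local_ring (S \<times> S) {f \<in> supported (S \<times> S). algebra_map ?sum f \<in> P}"
      unfolding diagonal_def by auto
    define Q where "Q = {f \<in> supported (S \<times> S). algebra_map ?sum f \<in> P}"
    have Sm: "is_submonoid S" using S is_submonoid_dual_monoid unfolding toric_charts_def by blast
    have SS: "is_submonoid (S \<times> S)" using S by (intro is_submonoid_product_chart) (auto simp: product_charts_def)
    have Q: "Q \<in> Spec (S \<times> S)" unfolding Q_def
      using sum_map_hom Sm by (intro Spec_comap[OF Sm SS _ _ _ P]) (auto simp: is_submonoid_def)
    \<comment> \<open>In this chart \<open>?f\<close> may be a genuine fraction. Over a monomial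
      denominator, the numerator of \<open>?f - 1\<close> is a difference of two monomials with the
      same image under \<open>?sum\<close>.\<close>
    have "Fract ?f 1 \<in> local_ring (S \<times> S) Q"
      using x reg[of ?f] unfolding sections_def x_eq Q_def by blast
    then obtain i where i: "i \<in> S \<times> S" "Poly_Mapping.single i 1 \<notin> Q" "i + (a, - a) \<in> S \<times> S"
      by (rule monomial_in_local_ring[OF SS Q])
    let ?i = "Poly_Mapping.single i 1 :: (int \<times> int) \<times> (int \<times> int) \<Rightarrow>\<^sub>0 'k"
    let ?h = "Poly_Mapping.single (i + (a, - a)) 1 - ?i"
    have h: "?h \<in> supported (S \<times> S)" using i by (intro supported_diff supported_single)
    have "algebra_map ?sum ?h = 0"
      by (simp add: algebra_map_diff algebra_map_single case_prod_beta)
    then have "?h \<in> Q" unfolding Q_def using h is_idealD(2)[OF SpecD(1)[OF Sm P]] by simp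
    moreover have "Fract (?f - 1) 1 = Fract ?h ?i"
      using Spec_nonzero[OF SS Q i(2)] by (simp add: eq_fract mult_single left_diff_distrib add.commute)
    ultimately show "Fract (?f - 1) 1 \<in> maximal_ideal_of x"
      using Fract_in_maximal_ideal_iff[OF SS Q h _ i(2)] i(1) unfolding x_eq Q_def[symmetric]
      by (simp add: supported_single)
  qed
  then have gI: "Fract (g - 1) 1 \<in> ideal_sheaf (diagonal (toric_charts \<Sigma>)) ?T"
    using \<pi>(2) op image unfolding compatible_with_def by (metis image_subset_iff)
  \<comment> \<open>The generic point of the diagonal, seen in the torus chart.\<close>
  define K where "K = {f :: (int \<times> int) \<times> (int \<times> int) \<Rightarrow>\<^sub>0 'k. algebra_map ?sum f \<in> {0}}"
  have K: "K \<in> Spec UNIV"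
    using Spec_comap[OF U(2,1) _ _ _ zero_in_Spec[OF U(2)], of ?sum] sum_map_hom by (simp add: K_def)
  have "local_ring UNIV K = local_ring (UNIV \<times> UNIV) {f \<in> carrier (monoid_algebra (UNIV \<times> UNIV)). algebra_map ?sum f \<in> {0}}"
    by (simp add: K_def)
  then have "local_ring UNIV K \<in> diagonal (toric_charts \<Sigma>)"
    unfolding diagonal_def using UC1 zero_in_Spec[OF U(2)] by blast
  moreover have "local_ring UNIV K \<in> ?T" using K SpecD(2)[OF U(1) K] unfolding basic_open_def by blast
  ultimately have "Fract (g - 1) 1 \<in> maximal_ideal_of (local_ring UNIV K)"
    using gI unfolding ideal_sheaf_def by blast
  then have "g - 1 \<in> K"
    using Fract_in_maximal_ideal_iff[OF U(1) K _ _ SpecD(2)[OF U(1) K]] by simp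
  then have "algebra_map ?sum g = 1"
    using sum_map_hom by (simp add: K_def algebra_map_diff algebra_map_one)
  \<comment> \<open>The exponent 0 survives in the restriction of \<open>g\<close>, so some exponent
    of \<open>g\<close> has the form \<open>(b, -b)\<close>.\<close>
  then have "0 \<in> ?sum ` Poly_Mapping.keys g" using keys_algebra_map[of ?sum g] by simp
  then obtain w where "w \<in> Poly_Mapping.keys g" "0 = fst w + snd w"
    by (metis (no_types, lifting) case_prod_beta imageE)
  then have w: "w \<in> Poly_Mapping.keys g" "snd w = - fst w" by (metis, metis add_eq_0_iff)
  have "\<bar>real q * pairing (fst w) v - pairing a v\<bar> < real q" if v: "v \<in> rays \<Sigma>" for v
  proof -
    have prim: "primitive v" and cone: "convex_cone hull {v} \<in> \<Sigma>" using v unfolding rays_def by auto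
    obtain p where p: "v = lat p" "coprime (fst p) (snd p)" using prim by (rule primitiveE)
    have dm: "dual_monoid (convex_cone hull {v}) = {m. 0 \<le> dot m p}"
      by (simp add: dual_monoid_convex_cone_hull p(1) pairing_lat)
    have ch: "{m. 0 \<le> dot m p} \<in> toric_charts \<Sigma>" unfolding toric_charts_def using cone dm by blast
    have surj: "surj (\<lambda>x. dot (fst x) p)" "surj (\<lambda>x. dot (snd x) p)"
      using primitive_dot_surj[OF p(2)] by (metis fst_conv surjI surj_def, metis snd_conv surjI surj_def)
    have "{x. 0 \<le> dot (fst x) p} = {m. 0 \<le> dot m p} \<times> UNIV" "{x. 0 \<le> dot (snd x) p} = UNIV \<times> {m. 0 \<le> dot m p}"
      by auto
    then have "{x. 0 \<le> dot (fst x) p} \<in> ?C" "{x. 0 \<le> dot (snd x) p} \<in> ?C"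
      unfolding product_charts_def using ch UC1 by blast+
    \<comment> \<open>The order along \<open>v\<close> in the first factor bounds
      \<open>dot (fst w) p\<close> from below; the second factor, where signs are reversed, bounds
      it from above.\<close>
    then have "- int q < int q * dot (fst w) p - dot (fst (a, - a)) p"
      "- int q < int q * dot (snd w) p - dot (snd (a, - a)) p"
      using splitting_valuation_bound[of "\<lambda>x. dot (fst x) p", OF _ _ surj(1) C UC _ \<pi>m q g w(1)]
        splitting_valuation_bound[of "\<lambda>x. dot (snd x) p", OF _ _ surj(2) C UC _ \<pi>m q g w(1)]
      by (simp_all add: dot_def distrib_right)
    then have "\<bar>int q * dot (fst w) p - dot a p\<bar> < int q"
      using w(2) by (simp add: abs_less_iff dot_uminus)
    moreover have "\<bar>real q * pairing (fst w) v - pairing a v\<bar> = of_int \<bar>int q * dot (fst w) p - dot a p\<bar>"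
      by (simp add: p(1) pairing_lat)
    ultimately show ?thesis by (metis of_int_less_iff of_int_of_nat_eq)
  qed
  then show "\<exists>b. \<forall>v\<in>rays \<Sigma>. \<bar>real q * pairing b v - pairing a v\<bar> < real q" by blast
qed

subsection \<open>Constructing splittings\<close>

text \<open>This is what a splitting amounts to on the chart algebras; inside the locale it is
  extended to all open sets.\<close>

locale monomial_splitting =
  fixes C :: "'m::{ordered_cancel_comm_monoid_add, linorder} set set"
    and q :: nat and p :: "('m \<Rightarrow>\<^sub>0 'k::field) \<Rightarrow> ('m \<Rightarrow>\<^sub>0 'k)"
  assumes charts: "\<And>S. S \<in> C \<Longrightarrow> is_submonoid S"
    and q_pos: "q > 0"
    and p_add: "p (f + g) = p f + p g"
    and p_linear: "p (algebra_map (scale q) s * f) = s * p f"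
    and p_one: "p 1 = 1"
    and p_supported: "S \<in> C \<Longrightarrow> f \<in> supported S \<Longrightarrow> p f \<in> supported S"
begin

abbreviation pullback :: "('m \<Rightarrow>\<^sub>0 'k) \<Rightarrow> ('m \<Rightarrow>\<^sub>0 'k)" where
  "pullback \<equiv> algebra_map (scale q)"

lemma pullback_mult: "pullback (f * g) = pullback f * pullback g"
  by (rule algebra_map_mult) (rule scale_add)

lemma pullback_eq_zero_iff: "pullback f = 0 \<longleftrightarrow> f = 0"
  using algebra_map_eq_zero_iff[OF inj_scale[OF q_pos]] .

lemma pullback_one: "pullback 1 = 1"
  by (rule algebra_map_one) simp

lemma pullback_supported: "is_submonoid S \<Longrightarrow> f \<in> supported S \<Longrightarrow> pullback f \<in> supported S"
  using keys_algebra_map[of "scale q" f] scale_in_submonoid unfolding supported_def by blast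

definition extension :: "('m, 'k) function_field \<Rightarrow> ('m, 'k) function_field" where
  "extension x = (THE y. \<exists>c s. s \<noteq> 0 \<and> x = Fract c (pullback s) \<and> y = Fract (p c) s)"

text \<open>Denominators that are pullbacks pass through \<open>p\<close> by
  \<open>p_linear\<close>, so the value does not depend on the representation.\<close>

lemma extension_Fract:
  assumes "s \<noteq> 0"
  shows "extension (Fract c (pullback s)) = Fract (p c) s"
  unfolding extension_def
proof (rule the_equality)
  show "\<exists>c' s'. s' \<noteq> 0 \<and> Fract c (pullback s) = Fract c' (pullback s') \<and> Fract (p c) s = Fract (p c') s'"
    using assms by blast
  fix y assume "\<exists>c' s'. s' \<noteq> 0 \<and> Fract c (pullback s) = Fract c' (pullback s') \<and> y = Fract (p c') s'"
  then obtain c' s' where c': "s' \<noteq> 0" "Fract c (pullback s) = Fract c' (pullback s')" "y = Fract (p c') s'" by blast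
  then have "pullback s' * c = pullback s * c'"
    using assms by (simp add: eq_fract pullback_eq_zero_iff mult.commute)
  then have "s' * p c = s * p c'" by (metis p_linear)
  then show "y = Fract (p c) s" using assms c' by (simp add: eq_fract mult.commute)
qed

lemma pullback_Spec:
  assumes "is_submonoid S" "P \<in> Spec S"
  shows "{f \<in> supported S. pullback f \<in> P} \<in> Spec S"
  using assms scale_in_submonoid by (intro Spec_comap) (auto simp: scale_add)

lemma section_fraction:
  assumes U: "openin (zariski C) U" and S: "S \<in> C" and P: "P \<in> Spec S" "local_ring S P \<in> U"
    and x: "x \<in> sections (F_preimage q C U)"
  obtains c s where "c \<in> supported S" "s \<in> supported S" "s \<notin> P" "x = Fract c (pullback s)"
proof -
  note Sm = charts[OF S]
  let ?W = "pullback ` (supported S - P)"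
  \<comment> \<open>A prime \<open>Q\<close> avoiding \<open>?W\<close> maps under multiplication by
    \<open>q\<close> to a generization of \<open>P\<close>, which still lies in
    \<open>U\<close>.\<close>
  have reg: "x \<in> local_ring S Q" if Q: "Q \<in> Spec S" "Q \<inter> ?W = {}" for Q
  proof -
    let ?Q = "{f \<in> supported S. pullback f \<in> Q}"
    have "?Q \<in> Spec S" using Sm Q(1) by (rule pullback_Spec)
    moreover have "?Q \<subseteq> P" using Q(2) by blast
    ultimately have "local_ring S ?Q \<in> U" using open_generization[OF U charts Sm P(1)] P(2) by blast
    then have "local_ring S Q \<in> F_preimage q C U" unfolding F_preimage_def using S Q(1) by auto
    then show ?thesis using x unfolding sections_def by blast
  qed
  have W1: "?W \<subseteq> supported S" using pullback_supported[OF Sm] by blast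
  have W2: "1 \<in> ?W" using pullback_one supported_one[OF Sm] SpecD(2)[OF Sm P(1)] by (metis DiffI image_eqI)
  have W3: "0 \<notin> ?W" using Spec_nonzero[OF Sm P(1)] pullback_eq_zero_iff by (metis DiffD2 imageE)
  have W4: "u * v \<in> ?W" if uv: "u \<in> ?W" "v \<in> ?W" for u v
  proof -
    obtain f g where "f \<in> supported S - P" "g \<in> supported S - P" "u = pullback f" "v = pullback g"
      using uv by blast
    then have "u * v = pullback (f * g)" "f * g \<in> supported S - P"
      using supported_mult[OF Sm] Spec_mult_notin[OF Sm P(1)] by (auto simp: pullback_mult)
    then show ?thesis by blast
  qed
  obtain c w where "c \<in> supported S" "w \<in> ?W" "x = Fract c w"
    using fraction_of_regular[OF Sm W1 W2 W3 W4 reg] .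
  then show thesis using that by blast
qed

lemma nonempty_open_point:
  assumes "nonempty_open C U"
  obtains S P where "S \<in> C" "P \<in> Spec S" "local_ring S P \<in> U"
proof -
  obtain x where x: "x \<in> U" "openin (zariski C) U" using assms unfolding nonempty_open_def by blast
  then have "x \<in> topspace (zariski C)" using openin_subset by blast
  then show thesis using that x unfolding zariski_def topology_generated_by_topspace basic_open_def by auto
qed

text \<open>One map of function fields serves on every open set, so restriction is respected at
  once. Regularity is checked at each point with a fraction adapted to that point; the algebraic
  identities need only some fraction.\<close>

lemma is_splitting_extension: "is_splitting q C (\<lambda>U. extension)"
  unfolding is_splitting_def is_module_map_def
proof (intro conjI allI impI ballI)
  fix U :: "('m, 'k) point set" assume U: "nonempty_open C U"
  then have op: "openin (zariski C) U" unfolding nonempty_open_def by blast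
  obtain S0 P0 where S0: "S0 \<in> C" "P0 \<in> Spec S0" "local_ring S0 P0 \<in> U" using nonempty_open_point[OF U] .
  have frac: "\<exists>c s. s \<noteq> 0 \<and> b = Fract c (pullback s)" if "b \<in> sections (F_preimage q C U)" for b
    using section_fraction[OF op S0 that] Spec_nonzero[OF charts[OF S0(1)] S0(2)] by metis
  have pull: "\<exists>u v. v \<noteq> 0 \<and> a = Fract u v \<and> F_pullback q a = Fract (pullback u) (pullback v)"
    for a :: "('m, 'k) function_field"
  proof -
    obtain u v where "v \<noteq> 0" "a = Fract u v" using Fract_cases[of a] by metis
    then show ?thesis using F_pullback_Fract[OF q_pos] by blast
  qed
  {
    fix b assume b: "b \<in> sections (F_preimage q C U)"
    show "extension b \<in> sections U"
      unfolding sections_def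
    proof
      fix x assume x: "x \<in> U"
      then have "x \<in> topspace (zariski C)" using op openin_subset by blast
      then obtain S P where S: "S \<in> C" "P \<in> Spec S" "x = local_ring S P"
        unfolding zariski_def topology_generated_by_topspace basic_open_def by auto
      then obtain c s where c: "c \<in> supported S" "s \<in> supported S" "s \<notin> P" "b = Fract c (pullback s)"
        using section_fraction[OF op S(1,2) _ b] x by metis
      then have "extension b = Fract (p c) s"
        using extension_Fract Spec_nonzero[OF charts[OF S(1)] S(2)] by blast
      then show "extension b \<in> x" unfolding S(3) using c p_supported[OF S(1)] by (auto intro: local_ringI)
    qed
    fix c assume c: "c \<in> sections (F_preimage q C U)"
    obtain b1 s where b1: "s \<noteq> 0" "b = Fract b1 (pullback s)" using frac[OF b] by blast
    obtain c1 t where c1: "t \<noteq> 0" "c = Fract c1 (pullback t)" using frac[OF c] by blast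
    have "b + c = Fract (pullback t * b1 + pullback s * c1) (pullback (s * t))"
      using b1 c1 by (simp add: pullback_eq_zero_iff pullback_mult mult.commute)
    then have "extension (b + c) = Fract (t * p b1 + s * p c1) (s * t)"
      using b1 c1 by (simp add: extension_Fract p_add p_linear)
    then show "extension (b + c) = extension b + extension c"
      using b1 c1 by (simp add: extension_Fract mult.commute)
  next
    fix a b assume a: "a \<in> sections U" and b: "b \<in> sections (F_preimage q C U)"
    obtain b1 s where b1: "s \<noteq> 0" "b = Fract b1 (pullback s)" using frac[OF b] by blast
    obtain u v where u: "v \<noteq> 0" "a = Fract u v" "F_pullback q a = Fract (pullback u) (pullback v)" using pull by blast
    have "F_pullback q a * b = Fract (pullback u * b1) (pullback (v * s))"
      by (simp add: u(3) b1(2) pullback_mult)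
    then have "extension (F_pullback q a * b) = Fract (u * p b1) (v * s)"
      using u b1 by (simp add: extension_Fract p_linear)
    then show "extension (F_pullback q a * b) = a * extension b"
      using u b1 by (simp add: extension_Fract)
  next
    fix a assume a: "a \<in> sections U"
    obtain u v where u: "v \<noteq> 0" "a = Fract u v" "F_pullback q a = Fract (pullback u) (pullback v)" using pull by blast
    have "p (pullback u * 1) = u" unfolding p_linear p_one by simp
    then show "extension (F_pullback q a) = a" using u by (simp add: extension_Fract)
  }
qed simp

end

section \<open>Monomial splittings from lattice points in the polygon\<close>

lemma scale_pair: "scale q (m :: int \<times> int) = (int q * fst m, int q * snd m)"
  by (induction q) (simp_all add: scale_def algebra_simps prod_eq_iff)

lemma scale_pair_pair: "scale q (m, m') = (scale q m, scale q m')"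
  by (induction q) (simp_all add: scale_def zero_prod_def)

lemma pairing_scale: "pairing (scale q m) v = real q * pairing m v"
  by (simp add: pairing_def scale_pair algebra_simps)

definition quotient :: "nat \<Rightarrow> int \<times> int \<Rightarrow> int \<times> int" where
  "quotient q m = (fst m div int q, snd m div int q)"

lemma quotient_add_scale: "q > 0 \<Longrightarrow> quotient q (scale q c + m) = c + quotient q m"
  by (simp add: quotient_def scale_pair prod_eq_iff)

text \<open>Applying the choice function only to remainders modulo \<open>q\<close> makes it
  equivariant under translation by \<open>q\<close> times the lattice.\<close>

lemma fractionally_covered_section:
  assumes R: "fractionally_covered A q" and q: "q > 0"
  obtains r where "\<And>a c. r (scale q c + a) = c + r a" "r 0 = 0"
    "\<And>a v. v \<in> A \<Longrightarrow> \<bar>real q * pairing (r a) v - pairing a v\<bar> < real q"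
proof -
  obtain b where b: "\<And>a v. v \<in> A \<Longrightarrow> \<bar>real q * pairing (b a) v - pairing a v\<bar> < real q"
    using R unfolding fractionally_covered_def by metis
  define rem where "rem a = a - scale q (quotient q a)" for a
  \<comment> \<open>The zero class is represented by 0 itself, which later makes the splitting send
    1 to 1.\<close>
  define r where "r a = (if rem a = 0 then 0 else b (rem a)) + quotient q a" for a
  have rem: "rem (scale q c + a) = rem a" for c a
    using q by (simp add: rem_def quotient_add_scale scale_add)
  show thesis
  proof (rule that)
    show "r (scale q c + a) = c + r a" for a c
      using q by (simp add: r_def rem quotient_add_scale)
    show "r 0 = 0" by (simp add: r_def rem_def quotient_def zero_prod_def scale_pair)
    fix a v assume v: "v \<in> A"
    have "a = rem a + scale q (quotient q a)" by (simp add: rem_def)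
    then have "pairing a v = pairing (rem a) v + real q * pairing (quotient q a) v"
      by (metis pairing_add_left pairing_scale)
    then have "real q * pairing (r a) v - pairing a v
        = real q * pairing (if rem a = 0 then 0 else b (rem a)) v - pairing (rem a) v"
      by (simp add: r_def pairing_add_left algebra_simps)
    then show "\<bar>real q * pairing (r a) v - pairing a v\<bar> < real q"
      using b[OF v, of "rem a"] q by (simp add: pairing_zero_left)
  qed
qed

text \<open>The splitting is the sum of the maps \<open>\<pi>\<^bsub>(u, -u)\<^esub>\<close> over the representatives \<open>u = r a - a/q\<close> of \<open>(1/q)M/M\<close>,
  where \<open>\<pi>\<^sub>w (\<chi>\<^sup>x) = \<chi>\<^bsup>x/q + w\<^esup>\<close> if the exponent is integral and \<open>0\<close> otherwise.\<close>

lemma fractionally_covered_imp_diagonally_split: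
  assumes \<Sigma>: "complete_fan \<Sigma>" and R: "fractionally_covered (rays \<Sigma>) q" and q: "q > 0"
  shows "diagonally_split TYPE('k::field) \<Sigma> q"
proof -
  let ?C = "product_charts (toric_charts \<Sigma>)"
  let ?sum = "\<lambda>(m, m'). m + m' :: int \<times> int"
  obtain r where r: "\<And>a c. r (scale q c + a) = c + r a" "r 0 = 0"
    and bound: "\<And>a v. v \<in> rays \<Sigma> \<Longrightarrow> \<bar>real q * pairing (r a) v - pairing a v\<bar> < real q"
    using fractionally_covered_section[OF R q] by metis
  define divisible where "divisible x \<longleftrightarrow> scale q (quotient q x) = x" for x :: "int \<times> int"
  have divisible_add: "divisible (scale q c + x) \<longleftrightarrow> divisible x" for c x
    using q by (simp add: divisible_def quotient_add_scale scale_add)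
  \<comment> \<open>For the exponent \<open>(a, a')\<close> only the representative
    \<open>u = r a - a/q\<close> makes the first component \<open>a/q + u = r a\<close> integral;
    the second, \<open>a'/q - u\<close>, equals \<open>(a + a')/q - r a\<close>.\<close>
  define B :: "(int \<times> int) \<times> (int \<times> int) \<Rightarrow> ((int \<times> int) \<times> (int \<times> int) \<Rightarrow>\<^sub>0 'k)" where
    "B = (\<lambda>(a, a'). if divisible (a + a') then Poly_Mapping.single (r a, quotient q (a + a') - r a) 1 else 0)"
  define p where "p = linear_extension B"
  \<comment> \<open>The map induced on the diagonal, which divides exponents by \<open>q\<close>
    where possible.\<close>
  define pM :: "(int \<times> int \<Rightarrow>\<^sub>0 'k) \<Rightarrow> (int \<times> int \<Rightarrow>\<^sub>0 'k)" where
    "pM = linear_extension (\<lambda>x. if divisible x then Poly_Mapping.single (quotient q x) 1 else 0)"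
  have B_scale: "B (scale q c + m) = Poly_Mapping.single c 1 * B m" for c m
  proof -
    obtain c1 c2 a a' where cm: "c = (c1, c2)" "m = (a, a')" by (metis surj_pair)
    have e: "(scale q c1 + a) + (scale q c2 + a') = scale q (c1 + c2) + (a + a')"
      by (simp add: scale_add algebra_simps)
    have "B (scale q c + m) = B (scale q c1 + a, scale q c2 + a')" by (simp add: cm scale_pair_pair)
    also have "\<dots> = (if divisible (scale q (c1 + c2) + (a + a'))
        then Poly_Mapping.single (r (scale q c1 + a), quotient q (scale q (c1 + c2) + (a + a')) - r (scale q c1 + a)) 1 else 0)"
      unfolding B_def prod.case e ..
    also have "\<dots> = Poly_Mapping.single c 1 * B m"
      unfolding divisible_add quotient_add_scale[OF q] r(1) by (simp add: cm B_def mult_single algebra_simps)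
    finally show ?thesis .
  qed
  have rays: "primitive v" if "v \<in> rays \<Sigma>" for v using that by (simp add: rays_def)
  \<comment> \<open>Pairings with lattice vectors are integers, so exceeding -1 means being
    nonnegative.\<close>
  have nonneg: "0 \<le> pairing m v" if v: "v \<in> rays \<Sigma>" and "- real q < real q * pairing m v" for m v
  proof -
    obtain x where x: "v = lat x" using rays[OF v] by (rule primitiveE)
    have "real q * (- 1) < real q * pairing m v" using that(2) by simp
    then have "- 1 < pairing m v" using q by (simp only: mult_less_cancel_left_pos of_nat_0_less_iff)
    then have "- 1 < dot m x" by (simp add: x pairing_lat)
    then show ?thesis by (simp add: x pairing_lat)
  qed
  have B_supported: "B m \<in> supported S" if S: "S \<in> ?C" and m: "m \<in> S" for S m
  proof -
    obtain \<sigma> \<tau> where \<sigma>: "\<sigma> \<in> \<Sigma>" "\<tau> \<in> \<Sigma>" and S_eq: "S = dual_monoid \<sigma> \<times> dual_monoid \<tau>"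
      using S unfolding product_charts_def toric_charts_def by blast
    have fan: "fan \<Sigma>" using \<Sigma> unfolding complete_fan_def by blast
    obtain a a' where a: "m = (a, a')" by (metis surj_pair)
    show ?thesis
    proof (cases "divisible (a + a')")
      case True
      let ?s = "quotient q (a + a')"
      have s: "real q * pairing ?s v = pairing a v + pairing a' v" for v
        using True pairing_scale[of q ?s v] by (simp add: divisible_def pairing_add_left)
      have "0 \<le> pairing (r a) v" if v: "v \<in> rays \<Sigma> \<inter> \<sigma>" for v
      proof (rule nonneg)
        have "0 \<le> pairing a v" using m v unfolding a S_eq dual_monoid_def by auto
        then show "- real q < real q * pairing (r a) v" using bound[of v a] v by auto
      qed (use v in blast)
      then have 1: "r a \<in> dual_monoid \<sigma>" unfolding dual_monoid_fan_cone[OF fan \<sigma>(1)] by blast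
      have "0 \<le> pairing (?s - r a) v" if v: "v \<in> rays \<Sigma> \<inter> \<tau>" for v
      proof (rule nonneg)
        have "0 \<le> pairing a' v" using m v unfolding a S_eq dual_monoid_def by auto
        moreover have "pairing (?s - r a) v = pairing ?s v - pairing (r a) v"
          by (simp add: pairing_def left_diff_distrib)
        ultimately show "- real q < real q * pairing (?s - r a) v"
          using bound[of v a] v s[of v] by (auto simp: right_diff_distrib)
      qed (use v in blast)
      then have 2: "?s - r a \<in> dual_monoid \<tau>" unfolding dual_monoid_fan_cone[OF fan \<sigma>(2)] by blast
      show ?thesis using True 1 2 by (simp add: B_def a S_eq supported_single)
    next
      case False
      then show ?thesis by (simp add: B_def a)
    qed
  qed
  interpret monomial_splitting ?C q p
  proof
    show sub: "is_submonoid S" if "S \<in> ?C" for S using that by (rule is_submonoid_product_chart)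
    show "q > 0" by (rule q)
    show add: "p (f + g) = p f + p g" for f g by (simp add: p_def linear_extension_add)
    have q0: "quotient q 0 = 0" by (simp add: quotient_def zero_prod_def)
    then have "divisible 0" by (simp add: divisible_def)
    then have "B (0, 0) = Poly_Mapping.single (0, 0) 1"
      unfolding B_def prod.case by (simp add: q0 r(2))
    then have "B 0 = 1" by (simp add: zero_prod_def[symmetric])
    then show "p 1 = 1"
      using linear_extension_single[of B 0 1] by (simp add: p_def)
    show "p (algebra_map (scale q) s * f) = s * p f" for s f
    proof (rule additive_eq_on_monomials[where f = s and \<phi> = "\<lambda>s. p (algebra_map (scale q) s * f)"])
      fix m and c :: 'k
      show "p (algebra_map (scale q) (Poly_Mapping.single m c) * f) = Poly_Mapping.single m c * p f"
      proof (rule additive_eq_on_monomials[where f = f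
            and \<phi> = "\<lambda>f. p (algebra_map (scale q) (Poly_Mapping.single m c) * f)"])
        fix n and d :: 'k
        have "Poly_Mapping.single m c = Poly_Mapping.single 0 c * Poly_Mapping.single m 1" by (simp add: mult_single)
        then show "p (algebra_map (scale q) (Poly_Mapping.single m c) * Poly_Mapping.single n d)
            = Poly_Mapping.single m c * p (Poly_Mapping.single n d)"
          by (simp add: p_def algebra_map_single mult_single linear_extension_single B_scale)
      qed (simp_all add: distrib_left add)
    qed (simp_all add: distrib_right algebra_map_add add)
    fix S and f :: "(int \<times> int) \<times> (int \<times> int) \<Rightarrow>\<^sub>0 'k" assume S: "S \<in> ?C" "f \<in> supported S"
    have z: "0 \<in> S" using sub[OF S(1)] by (simp add: is_submonoid_def)
    from S(2) have "Poly_Mapping.keys f \<subseteq> S" by (simp add: supported_def)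
    then show "p f \<in> supported S"
    proof (induction f rule: poly_mapping_monomial_induct)
      case (monomial m c)
      show ?case
        unfolding p_def linear_extension_single
        by (rule supported_mult[OF sub[OF S(1)] supported_single[OF z] B_supported[OF S(1) monomial]])
    qed (simp_all add: linear_extension_add supported_add p_def)
  qed
  \<comment> \<open>Adding the two components of the exponent in \<open>B\<close> cancels
    \<open>r a\<close>, so \<open>p\<close> descends to the diagonal.\<close>
  have sum_p: "algebra_map ?sum (p f) = pM (algebra_map ?sum f)" for f
  proof (rule additive_eq_on_monomials[where f = f and \<phi> = "\<lambda>f. algebra_map ?sum (p f)"])
    fix m and c :: 'k
    show "algebra_map ?sum (p (Poly_Mapping.single m c)) = pM (algebra_map ?sum (Poly_Mapping.single m c))"
      by (cases m) (simp add: p_def pM_def linear_extension_single algebra_map_single B_def mult_single)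
  qed (simp_all add: p_add algebra_map_add pM_def linear_extension_add)
  have sum_pullback: "algebra_map ?sum (pullback f) = 0 \<longleftrightarrow> algebra_map ?sum f = 0" for f
  proof -
    have "algebra_map ?sum (pullback f) = algebra_map (scale q) (algebra_map ?sum f)"
      by (rule additive_eq_on_monomials[where f = f and \<phi> = "\<lambda>f. algebra_map ?sum (pullback f)"])
        (auto simp: algebra_map_add algebra_map_single scale_pair_pair scale_add)
    then show ?thesis using algebra_map_eq_zero_iff[OF inj_scale[OF q]] by simp
  qed
  have "compatible_with q ?C (\<lambda>U. extension) (diagonal (toric_charts \<Sigma>))"
    unfolding compatible_with_def
  proof (intro allI impI image_subsetI)
    fix U :: "((int \<times> int) \<times> (int \<times> int), 'k) point set" and x
    assume U: "nonempty_open ?C U"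
      and x: "x \<in> ideal_sheaf (diagonal (toric_charts \<Sigma>)) (F_preimage q ?C U)"
    have op: "openin (zariski ?C) U" using U unfolding nonempty_open_def by blast
    have xs: "x \<in> sections (F_preimage q ?C U)" using x unfolding ideal_sheaf_def by blast
    have ext: "extension x \<in> sections U"
      using is_splitting_extension U xs unfolding is_splitting_def is_module_map_def by blast
    have "extension x \<in> maximal_ideal_of y" if y: "y \<in> U" "y \<in> diagonal (toric_charts \<Sigma>)" for y
    proof -
      obtain S P where S: "S \<in> toric_charts \<Sigma>" and P: "P \<in> Spec S"
        and y_eq: "y = local_ring (S \<times> S) {f \<in> supported (S \<times> S). algebra_map ?sum f \<in> P}"
        using y(2) unfolding diagonal_def by auto
      define Q where "Q = {f \<in> supported (S \<times> S). algebra_map ?sum f \<in> P}"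
      \<comment> \<open>The generic point of the diagonal in this chart; multiplication by
        \<open>q\<close> fixes it, so it lies in the preimage of \<open>U\<close> once it lies in
        \<open>U\<close>.\<close>
      define K where "K = {f \<in> supported (S \<times> S). algebra_map ?sum f \<in> {0 :: int \<times> int \<Rightarrow>\<^sub>0 'k}}"
      have SC: "S \<times> S \<in> ?C" using S unfolding product_charts_def by blast
      have Sm: "is_submonoid S" using S is_submonoid_dual_monoid unfolding toric_charts_def by blast
      have SS: "is_submonoid (S \<times> S)" using charts[OF SC] .
      have hom: "?sum z \<in> S" if "z \<in> S \<times> S" for z using that Sm by (auto simp: is_submonoid_def)
      have Q: "Q \<in> Spec (S \<times> S)" unfolding Q_def
        using sum_map_hom hom by (intro Spec_comap[OF Sm SS _ _ _ P])
      have K: "K \<in> Spec (S \<times> S)" unfolding K_def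
        using sum_map_hom hom by (intro Spec_comap[OF Sm SS _ _ _ zero_in_Spec[OF Sm]])
      have KQ: "K \<subseteq> Q" using is_idealD(2)[OF SpecD(1)[OF Sm P]] unfolding K_def Q_def by auto
      have yU: "local_ring (S \<times> S) Q \<in> U" using y y_eq unfolding Q_def by simp
      have "local_ring (S \<times> S) K \<in> U" using open_generization[OF op charts SS Q K KQ yU] .
      moreover have "{f \<in> supported (S \<times> S). pullback f \<in> K} = K"
        using pullback_supported[OF SS] sum_pullback unfolding K_def by auto
      ultimately have KF: "local_ring (S \<times> S) K \<in> F_preimage q ?C U"
        unfolding F_preimage_def using SC K by (intro CollectI exI[of _ "S \<times> S"] exI[of _ K]) simp
      moreover have "local_ring (S \<times> S) K \<in> diagonal (toric_charts \<Sigma>)"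
        unfolding diagonal_def K_def carrier_monoid_algebra using S zero_in_Spec[OF Sm] by blast
      ultimately have xm: "x \<in> maximal_ideal_of (local_ring (S \<times> S) K)"
        using x unfolding ideal_sheaf_def by blast
      obtain c s where c: "c \<in> supported (S \<times> S)" "s \<in> supported (S \<times> S)" "s \<notin> Q" "x = Fract c (pullback s)"
        using section_fraction[OF op SC Q yU xs] .
      have "s \<notin> K" using c(3) KQ by blast
      then have "pullback s \<notin> K" using c(2) sum_pullback unfolding K_def by simp
      then have "c \<in> K"
        using xm Fract_in_maximal_ideal_iff[OF SS K c(1) pullback_supported[OF SS c(2)]] c(4) by blast
      \<comment> \<open>As \<open>c\<close> restricts to zero on the diagonal, so does
        \<open>p c\<close>, which therefore lies in the prime \<open>Q\<close> of the given diagonal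
        point.\<close>
      then have "algebra_map ?sum (p c) = 0" unfolding sum_p by (simp add: K_def pM_def)
      then have "p c \<in> Q"
        using p_supported[OF SC c(1)] is_idealD(2)[OF SpecD(1)[OF Sm P]] by (simp add: Q_def)
      moreover have "extension x = Fract (p c) s"
        unfolding c(4) by (rule extension_Fract[OF Spec_nonzero[OF SS Q c(3)]])
      ultimately show ?thesis
        using Fract_in_maximal_ideal_iff[OF SS Q p_supported[OF SC c(1)] c(2,3)] y_eq unfolding Q_def[symmetric] by simp
    qed
    then show "extension x \<in> ideal_sheaf (diagonal (toric_charts \<Sigma>)) U"
      using ext unfolding ideal_sheaf_def by blast
  qed
  then show ?thesis using is_splitting_extension unfolding diagonally_split_def by blast
qed

theorem corollary1p7:
  fixes \<Sigma> :: "(real \<times> real) set set"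
  assumes "complete_fan \<Sigma>"
  shows "exactly_one_of_three
    (unimodular (rays \<Sigma>) \<and> (\<forall>q::nat\<ge>2. diagonally_split TYPE('k::field) \<Sigma> q))
    (k_regular 2 (rays \<Sigma>) \<and> \<not> unimodular (rays \<Sigma>)
       \<and> (\<forall>q::nat\<ge>2. diagonally_split TYPE('k) \<Sigma> q \<longleftrightarrow> odd q))
    (\<not> k_regular 2 (rays \<Sigma>) \<and> (\<nexists>q::nat. q \<ge> 2 \<and> diagonally_split TYPE('k) \<Sigma> q))"
proof (rule trichotomy_from_covering)
  show "\<forall>v\<in>rays \<Sigma>. primitive v" by (simp add: rays_def)
  show "span (rays \<Sigma>) = UNIV" using assms by (rule complete_fan_span_rays)
  show "diagonally_split TYPE('k) \<Sigma> q \<longleftrightarrow> fractionally_covered (rays \<Sigma>) q" if "q \<ge> 2" for q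
    using diagonally_split_imp_fractionally_covered[OF assms, of q]
      fractionally_covered_imp_diagonally_split[OF assms, of q] that by auto
qed

end
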